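(* Let $U\subset\mathbb{R}^2$ be a Lipschitz domain with $0\in\partial U$, and let $L,r_0,M_0>0$ be such that (a) in some orthonormal coordinate system, $\partial U\cap B_{2r_0}$ is represented by the graph of a Lipschitz function with Lipschitz constant $L$; (b) there is a function $\psi$ on $(-r_0,r_0)$ such that, in an orthonormal coordinate system $(x,y)$ centered at $0$, $\psi(0)=\psi'(0)=0$, $U_{r_0}=\{(x,y)\in B_{r_0}:y>\psi(x)\}$, and for any $r\in(0,r_0)$, $\{(x,y)\in B_r:y>M_0r^2\}\subset U_r$; (c) $U$ satisfies the exterior ball condition at $0$ with radius $1/M_0$. Let $u$ be a harmonic function in $U$ which vanishes on $\partial U$. Then $u$ is $C^{1,\alpha}$ at $0$; that is, for any $(x,y)\in U$ such that $\sqrt{x^2+y^2}<r_0$, $$|u(x,y)-(x,y)\cdot\nabla_{x,y}u(0)|\le M\,|x^2+y^2|^{\frac{1+\alpha}{2}}\,r_0^{-2-\alpha}\,\|u\|_{L^2(U_{2r_0})},$$ where $M>0$ is a constant depending only on $M_0r_0$ and $L$, and $\alpha\in(0,1)$ is a small constant depending only on $L$.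
   Context: $B_r$ is the ball of radius $r$ centered at $0$ in $\mathbb{R}^2$ and $U_r=B_r\cap U$. In (a), $U\cap B_{2r_0}$ is the part of $B_{2r_0}$ lying on one side of the graph. "Vanishes on $\partial U$" is understood in the usual Sobolev sense: $\zeta u\in H^1_0(U)$ for every $\zeta\in C_c^\infty(\mathbb{R}^2)$. The exterior ball condition at $0$ with radius $R$ means there is an open ball of radius $R$ contained in $\mathbb{R}^2\setminus\overline U$ whose boundary contains $0$. The vector $\nabla_{x,y}u(0)$ is the (unique) vector $v$ for which the displayed inequality holds, its existence being part of the conclusion. *)

theory Defs
  imports "HOL-Analysis.Analysis"
begin

section \<open>Smooth and harmonic functions\<close>

text \<open>These notions are used only for open sets \<open>S\<close>.\<close>

definition partial_deriv :: "'a \<Rightarrow> ('a::euclidean_space \<Rightarrow> real) \<Rightarrow> 'a \<Rightarrow> real" where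
  "partial_deriv b f = (\<lambda>x. frechet_derivative f (at x) b)"

definition gradient :: "('a::euclidean_space \<Rightarrow> real) \<Rightarrow> 'a \<Rightarrow> 'a" where
  "gradient f x = (\<Sum>b\<in>Basis. partial_deriv b f x *\<^sub>R b)"

definition laplacian :: "('a::euclidean_space \<Rightarrow> real) \<Rightarrow> 'a \<Rightarrow> real" where
  "laplacian f x = (\<Sum>b\<in>Basis. partial_deriv b (partial_deriv b f) x)"

fun Ck_on :: "nat \<Rightarrow> ('a::euclidean_space \<Rightarrow> real) \<Rightarrow> 'a set \<Rightarrow> bool" where
  "Ck_on 0 f S \<longleftrightarrow> continuous_on S f"
| "Ck_on (Suc k) f S \<longleftrightarrow>
     (\<forall>x\<in>S. f differentiable (at x)) \<and> (\<forall>b\<in>Basis. Ck_on k (partial_deriv b f) S)"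

definition harmonic_on :: "('a::euclidean_space \<Rightarrow> real) \<Rightarrow> 'a set \<Rightarrow> bool" where
  "harmonic_on u U \<longleftrightarrow> Ck_on 2 u U \<and> (\<forall>x\<in>U. laplacian u x = 0)"

definition test_function :: "'a::euclidean_space set \<Rightarrow> ('a \<Rightarrow> real) \<Rightarrow> bool" where
  "test_function U \<phi> \<longleftrightarrow>
     (\<forall>k. Ck_on k \<phi> UNIV) \<and> compact (closure {x. \<phi> x \<noteq> 0}) \<and> closure {x. \<phi> x \<noteq> 0} \<subseteq> U"

section \<open>Sobolev spaces\<close>

definition L2_on :: "'a::euclidean_space set \<Rightarrow> ('a \<Rightarrow> 'b::euclidean_space) \<Rightarrow> bool" where
  "L2_on U f \<longleftrightarrow>
     set_borel_measurable lebesgue U f \<and> set_integrable lebesgue U (\<lambda>x. (norm (f x))\<^sup>2)"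

definition L2_norm :: "'a::euclidean_space set \<Rightarrow> ('a \<Rightarrow> 'b::euclidean_space) \<Rightarrow> real" where
  "L2_norm U f = sqrt (LINT x:U|lebesgue. (norm (f x))\<^sup>2)"

definition weak_gradient ::
    "'a::euclidean_space set \<Rightarrow> ('a \<Rightarrow> real) \<Rightarrow> ('a \<Rightarrow> 'a) \<Rightarrow> bool" where
  "weak_gradient U w g \<longleftrightarrow>
     (\<forall>\<phi>. test_function U \<phi> \<longrightarrow> (\<forall>b\<in>Basis.
        (LINT x:U|lebesgue. w x * partial_deriv b \<phi> x) = - (LINT x:U|lebesgue. (g x \<bullet> b) * \<phi> x)))"

text \<open>\<open>H10 U w\<close> says that (the restriction to \<open>U\<close> of) \<open>w\<close> belongs to \<open>H\<^sup>1(U)\<close>, with weak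
  gradient \<open>g\<close>, and is a limit in the norm of \<open>H\<^sup>1(U)\<close> of smooth functions compactly supported
  in \<open>U\<close>.\<close>

definition H10 :: "'a::euclidean_space set \<Rightarrow> ('a \<Rightarrow> real) \<Rightarrow> bool" where
  "H10 U w \<longleftrightarrow>
     (\<exists>g. L2_on U w \<and> L2_on U g \<and> weak_gradient U w g \<and>
        (\<exists>\<phi> :: nat \<Rightarrow> 'a \<Rightarrow> real. (\<forall>n. test_function U (\<phi> n)) \<and>
           (\<lambda>n. L2_norm U (\<lambda>x. \<phi> n x - w x)) \<longlonglongrightarrow> 0 \<and>
           (\<lambda>n. L2_norm U (\<lambda>x. gradient (\<phi> n) x - g x)) \<longlonglongrightarrow> 0))"

definition vanishes_on_boundary :: "'a::euclidean_space set \<Rightarrow> ('a \<Rightarrow> real) \<Rightarrow> bool" where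
  "vanishes_on_boundary U u \<longleftrightarrow> (\<forall>\<zeta>. test_function UNIV \<zeta> \<longrightarrow> H10 U (\<lambda>x. \<zeta> x * u x))"

section \<open>Planar domains\<close>

definition orthonormal_frame :: "real^2 \<Rightarrow> real^2 \<Rightarrow> bool" where
  "orthonormal_frame e1 e2 \<longleftrightarrow> norm e1 = 1 \<and> norm e2 = 1 \<and> orthogonal e1 e2"

text \<open>In the orthonormal coordinates with origin \<open>c\<close> and axes \<open>e1\<close>, \<open>e2\<close>, a point \<open>q\<close> has the
  coordinates \<open>(q - c) \<bullet> e1\<close> and \<open>(q - c) \<bullet> e2\<close>.  Both orientations of the axes are allowed, so
  it is no restriction that \<open>U\<close> lies above the graph rather than below it; nor is it one that
  \<open>f\<close> is defined on the whole line.\<close>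

definition lipschitz_graph_boundary_in :: "real \<Rightarrow> (real^2) set \<Rightarrow> (real^2) set \<Rightarrow> bool" where
  "lipschitz_graph_boundary_in L B U \<longleftrightarrow>
     (\<exists>c e1 e2 f. orthonormal_frame e1 e2 \<and> L-lipschitz_on UNIV (f :: real \<Rightarrow> real) \<and>
        frontier U \<inter> B = {q \<in> B. (q - c) \<bullet> e2 = f ((q - c) \<bullet> e1)} \<and>
        U \<inter> B = {q \<in> B. (q - c) \<bullet> e2 > f ((q - c) \<bullet> e1)})"

definition lipschitz_domain :: "(real^2) set \<Rightarrow> bool" where
  "lipschitz_domain U \<longleftrightarrow> open U \<and> connected U \<and> U \<noteq> {} \<and>
     (\<forall>p\<in>frontier U. \<exists>r>0. \<exists>L. lipschitz_graph_boundary_in L (ball p r) U)"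

text \<open>Here the coordinates are centered at \<open>0\<close>.  On \<open>ball 0 r\<^sub>0\<close> the first one lies in
  \<open>{-r\<^sub>0<..<r\<^sub>0}\<close>, so the values of \<open>\<psi>\<close> outside this interval are irrelevant.\<close>

definition quadratic_epigraph_at_0 :: "real \<Rightarrow> real \<Rightarrow> (real^2) set \<Rightarrow> bool" where
  "quadratic_epigraph_at_0 M\<^sub>0 r\<^sub>0 U \<longleftrightarrow>
     (\<exists>\<psi> e1 e2. orthonormal_frame e1 e2 \<and> \<psi> 0 = 0 \<and> (\<psi> has_real_derivative 0) (at 0) \<and>
        U \<inter> ball 0 r\<^sub>0 = {p \<in> ball 0 r\<^sub>0. p \<bullet> e2 > \<psi> (p \<bullet> e1)} \<and>
        (\<forall>r\<in>{0<..<r\<^sub>0}. {p \<in> ball 0 r. p \<bullet> e2 > M\<^sub>0 * r\<^sup>2} \<subseteq> U \<inter> ball 0 r))"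

definition exterior_ball_at :: "'a::euclidean_space \<Rightarrow> real \<Rightarrow> 'a set \<Rightarrow> bool" where
  "exterior_ball_at p R U \<longleftrightarrow>
     R > 0 \<and> (\<exists>c. ball c R \<subseteq> - closure U \<and> p \<in> frontier (ball c R))"

end

theory Submission
  imports Defs "HOL-Complex_Analysis.Complex_Analysis"
begin

text \<open>Extended by zero, \<open>\<bar>u\<bar>\<close> is weakly subharmonic in the ball of radius \<open>2 r\<^sub>0\<close>, so it is bounded by
  \<open>A = C r\<^sub>0\<^sup>-\<^sup>1 \<parallel>u\<parallel>\<close> in the ball of radius \<open>r\<^sub>0\<close> and satisfies a comparison principle.  The quadratic
  interior condition forces the exterior ball to be tangent, from below, to the axis \<open>y = 0\<close>, and a barrier
  around a smaller exterior ball that touches the boundary of the given one at the point nearest to \<open>p\<close>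
  yields \<open>\<bar>u(p)\<bar> \<le> C A (y + M\<^sub>0 \<bar>p\<bar>\<^sup>2 / 2) / s\<close>, where \<open>s\<close> is comparable to \<open>min r\<^sub>0 (1 / M\<^sub>0)\<close>.  On the
  boundary of an interior disc tangent at \<open>0\<close> the height \<open>y\<close> is quadratic in \<open>\<bar>p\<bar>\<close>, hence so is \<open>u\<close>, and
  the Poisson formula in that disc gives the linear expansion with error of order \<open>3/2\<close>.  Outside the disc
  both \<open>u\<close> and the linear term are quadratically small.  Thus \<open>\<alpha> = 1/2\<close> is possible for every \<open>L\<close>.\<close>

section \<open>Calculus of \<open>C\<^sup>k\<close> functions\<close>

text \<open>Membership in the Sobolev closure gives no pointwise values on the frontier. Positivity
  repairs this: the zero extension \<open>w\<close> of |u| satisfies a sub-mean inequality at points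
  of \<open>U\<close>, where it is continuous, by shrinking the radius, and elsewhere because
  \<open>w\<close> is 0 there. The means carry a continuous, compactly supported weight instead of
  surface measure. Its potential is an explicit C^2 function, the mean of an integrable function is
  continuous in the centre, and Cauchy-Schwarz against the weight produces the L2 norm.

  The order 3/2 comes from the Poisson kernel. If continuous boundary values on the unit circle are
  at most K |w - 1|^2, then dividing by |w - 1|^2 leaves a bounded function, and its integral is the
  slope at 1. The error compares |w - z|^(-2) with |w - 1|^(-2); besides |1 - z|^2 it contains
  sqrt(1 - |z|^2) |1 - z|, and for unrestricted approach to 1 the square root is only of order |1 -
  z|^(1/2).\<close>

lemma partial_derivI: "(f has_derivative D) (at x) \<Longrightarrow> partial_deriv b f x = D b"
  unfolding partial_deriv_def using frechet_derivative_at by metis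

text \<open>No differentiability is required: \<open>frechet_derivative\<close> is a choice, and for
  both functions it is made from the same predicate.\<close>

lemma partial_deriv_cong_open:
  assumes "open S" "x \<in> S" "\<And>y. y \<in> S \<Longrightarrow> f y = g y"
  shows "partial_deriv b f x = partial_deriv b g x"
proof -
  have "(f has_derivative D) (at x) \<longleftrightarrow> (g has_derivative D) (at x)" for D
    using assms by (intro iffI; elim has_derivative_transform_within_open) auto
  then show ?thesis unfolding partial_deriv_def frechet_derivative_def by simp
qed

lemma differentiable_cong_open:
  assumes "open S" "x \<in> S" "\<And>y. y \<in> S \<Longrightarrow> f y = g y" "f differentiable (at x)"
  shows "g differentiable (at x)"
  using assms unfolding differentiable_def
  by (metis has_derivative_transform_within_open)

text \<open>The rules for sums, products and compositions identify the partial derivatives only at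
  points of \<open>S\<close>; this congruence lets the inductions on \<open>k\<close> substitute the
  computed formula there.\<close>

lemma Ck_on_cong:
  assumes "open S" "\<And>y. y \<in> S \<Longrightarrow> f y = g y"
  shows "Ck_on k f S \<longleftrightarrow> Ck_on k g S"
  using assms(2)
proof (induction k arbitrary: f g)
  case 0
  then show ?case by (simp cong: continuous_on_cong)
next
  case (Suc k)
  have "Ck_on k (partial_deriv b f) S \<longleftrightarrow> Ck_on k (partial_deriv b g) S" for b
    by (rule Suc.IH) (rule partial_deriv_cong_open[OF assms(1)], auto simp: Suc.prems)
  moreover have "f differentiable (at x) \<longleftrightarrow> g differentiable (at x)" if "x \<in> S" for x
    using differentiable_cong_open[OF assms(1) that] Suc.prems by metis
  ultimately show ?case by simp
qed

lemma Ck_on_subset: "Ck_on k f S \<Longrightarrow> T \<subseteq> S \<Longrightarrow> Ck_on k f T"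
  by (induction k arbitrary: f) (auto intro: continuous_on_subset)

lemma Ck_on_Un: "open S \<Longrightarrow> open T \<Longrightarrow> Ck_on k f S \<Longrightarrow> Ck_on k f T \<Longrightarrow> Ck_on k f (S \<union> T)"
  by (induction k arbitrary: f) (auto intro: continuous_on_open_Un)

lemma Ck_on_SucD: "Ck_on (Suc k) f S \<Longrightarrow> Ck_on k f S"
proof (induction k arbitrary: f)
  case 0
  then show ?case
    by (simp add: continuous_at_imp_continuous_on differentiable_imp_continuous_within)
qed simp_all

lemma Ck_on_le: "Ck_on n f S \<Longrightarrow> m \<le> n \<Longrightarrow> Ck_on m f S"
proof (induction n)
  case (Suc n)
  then show ?case using Ck_on_SucD[of n f S] by (cases "m = Suc n") auto
qed simp

lemma Ck_on_continuous: "Ck_on k f S \<Longrightarrow> continuous_on S f"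
  using Ck_on_le[of k f S 0] by simp

lemma has_derivative_gradient:
  fixes f :: "'a::euclidean_space \<Rightarrow> real"
  assumes "f differentiable (at x)"
  shows "(f has_derivative (\<lambda>h. gradient f x \<bullet> h)) (at x)"
proof -
  obtain D where D: "(f has_derivative D) (at x)" using assms differentiable_def by blast
  then interpret D: bounded_linear D by (rule has_derivative_bounded_linear)
  have "D h = gradient f x \<bullet> h" for h
  proof -
    have "D h = D (\<Sum>b\<in>Basis. (h \<bullet> b) *\<^sub>R b)" by (simp add: euclidean_representation)
    also have "\<dots> = (\<Sum>b\<in>Basis. (h \<bullet> b) * D b)" by (simp add: D.sum D.scaleR)
    also have "\<dots> = gradient f x \<bullet> h"
      by (simp add: gradient_def partial_derivI[OF D] inner_sum_left inner_sum_right inner_commute mult.commute)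
    finally show ?thesis .
  qed
  then show ?thesis using D by (metis ext)
qed

lemma partial_deriv_eq_inner_gradient:
  fixes f :: "'a::euclidean_space \<Rightarrow> real"
  assumes "f differentiable (at x)"
  shows "partial_deriv v f x = gradient f x \<bullet> v"
  using partial_derivI[OF has_derivative_gradient[OF assms]] .

lemma gradient_inner_Basis: "b \<in> Basis \<Longrightarrow> gradient f x \<bullet> b = partial_deriv b f x"
  unfolding gradient_def by (simp add: inner_sum_left inner_Basis if_distrib cong: if_cong)

lemma partial_deriv_add:
  assumes "f differentiable (at x)" "g differentiable (at x)"
  shows "partial_deriv b (\<lambda>x. f x + g x) x = partial_deriv b f x + partial_deriv b g x"
  by (subst partial_derivI[OF has_derivative_add[OF assms[THEN has_derivative_gradient]]])
    (simp add: assms partial_deriv_eq_inner_gradient)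

lemma partial_deriv_mult:
  fixes f g :: "'a::euclidean_space \<Rightarrow> real"
  assumes "f differentiable (at x)" "g differentiable (at x)"
  shows "partial_deriv b (\<lambda>x. f x * g x) x = f x * partial_deriv b g x + partial_deriv b f x * g x"
  by (subst partial_derivI[OF has_derivative_mult[OF assms[THEN has_derivative_gradient]]])
    (simp add: assms partial_deriv_eq_inner_gradient)

lemma partial_deriv_const [simp]: "partial_deriv b (\<lambda>x. c) = (\<lambda>x. 0)"
  by (rule ext, rule partial_derivI) simp

lemma partial_deriv_inner [simp]: "partial_deriv b (\<lambda>x. x \<bullet> v) = (\<lambda>x. b \<bullet> v)"
  by (rule ext, rule partial_derivI) (auto intro!: derivative_eq_intros)

lemma differentiable_compose_real:
  fixes f :: "real \<Rightarrow> real"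
  assumes "f differentiable (at (g x))" "g differentiable (at x)"
  shows "(\<lambda>x. f (g x)) differentiable (at x)"
  using assms unfolding differentiable_def by (blast intro: has_derivative_compose)

lemma partial_deriv_compose:
  fixes g :: "'a::euclidean_space \<Rightarrow> real"
  assumes "f differentiable (at (g x))" "g differentiable (at x)"
  shows "partial_deriv b (\<lambda>x. f (g x)) x = deriv f (g x) * partial_deriv b g x"
proof -
  have "(f has_field_derivative deriv f (g x)) (at (g x))"
    using assms(1) by (simp add: DERIV_deriv_iff_real_differentiable)
  then have "((\<lambda>x. f (g x)) has_derivative (\<lambda>h. deriv f (g x) * (gradient g x \<bullet> h))) (at x)"
    using has_derivative_compose[OF has_derivative_gradient[OF assms(2)]]
    by (simp add: has_field_derivative_def)
  from partial_derivI[OF this] show ?thesis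
    by (simp add: assms partial_deriv_eq_inner_gradient)
qed

lemma partial_deriv_real:
  assumes "f differentiable (at (x::real))"
  shows "partial_deriv 1 f x = deriv f x"
proof -
  have "(f has_derivative (\<lambda>h. deriv f x * h)) (at x)"
    using assms by (simp add: DERIV_deriv_iff_real_differentiable[symmetric] has_field_derivative_def)
  from partial_derivI[OF this, of 1] show ?thesis by simp
qed

lemma Ck_on_const [simp]: "Ck_on k (\<lambda>x. c) S"
  by (induction k arbitrary: c) auto

lemma Ck_on_inner: "Ck_on k (\<lambda>x. x \<bullet> v) S"
proof (cases k)
  case 0
  then show ?thesis by (simp add: continuous_on_inner)
next
  case (Suc j)
  have "((\<lambda>x. x \<bullet> v) has_derivative (\<lambda>h. h \<bullet> v)) (at x)" for x
    by (auto intro!: derivative_eq_intros)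
  then show ?thesis using Suc by (auto simp: differentiable_def)
qed

lemma Ck_on_add:
  "open S \<Longrightarrow> Ck_on k f S \<Longrightarrow> Ck_on k g S \<Longrightarrow> Ck_on k (\<lambda>x. f x + g x) S"
proof (induction k arbitrary: f g)
  case (Suc k)
  show ?case unfolding Ck_on.simps
  proof (intro conjI ballI)
    fix b :: 'a assume b: "b \<in> Basis"
    have "Ck_on k (\<lambda>x. partial_deriv b f x + partial_deriv b g x) S" using Suc b by simp
    then show "Ck_on k (partial_deriv b (\<lambda>x. f x + g x)) S"
      by (subst Ck_on_cong[OF \<open>open S\<close>]) (use Suc in \<open>auto simp: partial_deriv_add\<close>)
  qed (use Suc in auto)
qed (simp add: continuous_on_add)

lemma Ck_on_mult:
  "open S \<Longrightarrow> Ck_on k f S \<Longrightarrow> Ck_on k g S \<Longrightarrow> Ck_on k (\<lambda>x. f x * g x) S"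
proof (induction k arbitrary: f g)
  case (Suc k)
  show ?case unfolding Ck_on.simps
  proof (intro conjI ballI)
    fix b :: 'a assume b: "b \<in> Basis"
    have "Ck_on k (\<lambda>x. f x * partial_deriv b g x + partial_deriv b f x * g x) S"
      using Suc b Ck_on_SucD[of k f S] Ck_on_SucD[of k g S] by (intro Ck_on_add) auto
    then show "Ck_on k (partial_deriv b (\<lambda>x. f x * g x)) S"
      by (subst Ck_on_cong[OF \<open>open S\<close>]) (use Suc in \<open>auto simp: partial_deriv_mult\<close>)
  qed (use Suc in auto)
qed (simp add: continuous_on_mult)

lemma Ck_on_diff:
  assumes "open S" "Ck_on k f S" "Ck_on k g S"
  shows "Ck_on k (\<lambda>x. f x - g x) S"
  using Ck_on_add[OF assms(1,2) Ck_on_mult[OF assms(1) Ck_on_const assms(3)], of "-1"] by simp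

lemma Ck_on_sum:
  assumes "open S" "\<And>i. i \<in> I \<Longrightarrow> Ck_on k (f i) S"
  shows "Ck_on k (\<lambda>x. \<Sum>i\<in>I. f i x) S"
  using assms(2) by (induction I rule: infinite_finite_induct) (auto intro: Ck_on_add[OF assms(1)])

lemma Ck_on_power:
  assumes "open S" "Ck_on k f S"
  shows "Ck_on k (\<lambda>x. f x ^ n) S"
  by (induction n) (auto intro: Ck_on_mult assms)

lemma Ck_on_SucI_real:
  fixes f :: "real \<Rightarrow> real"
  assumes "open S" "\<And>x. x \<in> S \<Longrightarrow> (f has_field_derivative f' x) (at x)" "Ck_on k f' S"
  shows "Ck_on (Suc k) f S"
proof -
  have "partial_deriv 1 f x = f' x" if "x \<in> S" for x
    using assms(2)[OF that] by (metis DERIV_imp_deriv partial_deriv_real real_differentiable_def)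
  then have "Ck_on k (partial_deriv 1 f) S"
    using Ck_on_cong[OF assms(1), of "partial_deriv 1 f" f' k] assms(3) by blast
  with assms(2) show ?thesis by (auto simp: real_differentiable_def)
qed

lemma Ck_on_Suc_real:
  fixes f :: "real \<Rightarrow> real"
  assumes "open S" "Ck_on (Suc k) f S"
  shows "Ck_on k (deriv f) S"
  using assms Ck_on_cong[OF assms(1), of "partial_deriv 1 f" "deriv f" k] by (auto simp: partial_deriv_real)

lemma Ck_on_compose:
  fixes f :: "real \<Rightarrow> real"
  assumes "open S" "open T"
  shows "Ck_on k f T \<Longrightarrow> Ck_on k g S \<Longrightarrow> g ` S \<subseteq> T \<Longrightarrow> Ck_on k (\<lambda>x. f (g x)) S"
proof (induction k arbitrary: f g)
  case 0
  then show ?case by (simp add: continuous_on_compose2[of T f S g])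
next
  case (Suc k)
  have f: "Ck_on k (deriv f) T" and g: "Ck_on k g S"
    by (rule Ck_on_Suc_real[OF assms(2) Suc.prems(1)]) (rule Ck_on_SucD[OF Suc.prems(2)])
  have "\<forall>t\<in>T. f differentiable (at t)" "\<forall>x\<in>S. g differentiable (at x)"
    using Suc.prems(1,2) unfolding Ck_on.simps by blast+
  then have d: "f differentiable (at (g x))" "g differentiable (at x)" if "x \<in> S" for x
    using Suc.prems(3) that by blast+
  show ?case unfolding Ck_on.simps
  proof (intro conjI ballI)
    fix b :: 'a assume "b \<in> Basis"
    then have "Ck_on k (partial_deriv b g) S" using Suc.prems(2) by simp
    then have "Ck_on k (\<lambda>x. deriv f (g x) * partial_deriv b g x) S"
      by (intro Ck_on_mult assms(1) Suc.IH[OF f g Suc.prems(3)])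
    moreover have "partial_deriv b (\<lambda>x. f (g x)) x = deriv f (g x) * partial_deriv b g x" if "x \<in> S" for x
      by (rule partial_deriv_compose[OF d[OF that]])
    ultimately show "Ck_on k (partial_deriv b (\<lambda>x. f (g x))) S"
      by (subst Ck_on_cong[OF assms(1)]) assumption
  next
    fix x assume x: "x \<in> S"
    show "(\<lambda>x. f (g x)) differentiable at x"
      by (rule differentiable_compose_real[OF d[OF x]])
  qed
qed

lemma norm_square_Basis: "(norm x)\<^sup>2 = (\<Sum>b\<in>Basis. (x \<bullet> b)\<^sup>2)"
  unfolding power2_norm_eq_inner by (subst euclidean_inner) (simp add: power2_eq_square)

lemma Ck_on_norm_square:
  "Ck_on k (\<lambda>x::'a::euclidean_space. (norm (x - c))\<^sup>2) UNIV"
proof -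
  have "(norm (x - c))\<^sup>2 = (\<Sum>b\<in>Basis. (x \<bullet> b - c \<bullet> b) ^ 2)" for x :: 'a
    by (simp add: norm_square_Basis inner_diff_left)
  then show ?thesis by (auto intro!: Ck_on_sum Ck_on_power Ck_on_diff Ck_on_inner)
qed

lemma partial_deriv_norm_square:
  "partial_deriv b (\<lambda>x::'a::euclidean_space. (norm (x - c))\<^sup>2) = (\<lambda>x. 2 * ((x - c) \<bullet> b))"
  by (rule ext, rule partial_derivI)
    (auto intro!: derivative_eq_intros simp: power2_norm_eq_inner inner_commute)

lemma continuous_on_laplacian: "Ck_on 2 f S \<Longrightarrow> continuous_on S (laplacian f)"
  unfolding laplacian_def[abs_def] by (intro continuous_on_sum) (auto simp: numeral_2_eq_2)

lemma continuous_on_gradient: "Ck_on (Suc k) f S \<Longrightarrow> continuous_on S (gradient f)"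
  unfolding gradient_def[abs_def]
  by (intro continuous_on_sum continuous_on_scaleR continuous_on_const) (auto dest: Ck_on_continuous)

text \<open>The squared distance serves as radial variable because it is smooth at the centre too.
  Its gradient is 2 (y - c) and its Laplacian is twice the dimension, so the chain rule gives the
  formula.\<close>

lemma laplacian_radial:
  fixes c :: "'a::euclidean_space"
  assumes S: "open S" "x \<in> S" and f: "Ck_on 2 f T" "open T"
    and ST: "\<And>y. y \<in> S \<Longrightarrow> (norm (y - c))\<^sup>2 \<in> T"
  shows "laplacian (\<lambda>y. f ((norm (y - c))\<^sup>2)) x =
    2 * real DIM('a) * deriv f ((norm (x - c))\<^sup>2) +
    4 * (norm (x - c))\<^sup>2 * deriv (deriv f) ((norm (x - c))\<^sup>2)"
proof -
  let ?q = "\<lambda>y::'a. (norm (y - c))\<^sup>2"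
  have q: "?q differentiable (at y)" for y
    using Ck_on_norm_square[of 1 c] by auto
  have f1: "f differentiable (at t)" if "t \<in> T" for t
    using f that by (auto simp: numeral_2_eq_2)
  have f2: "deriv f differentiable (at t)" if "t \<in> T" for t
    using Ck_on_Suc_real[of T "Suc 0" f] f that by (auto simp: numeral_2_eq_2)
  have 1: "partial_deriv b (\<lambda>y. f (?q y)) y = deriv f (?q y) * (2 * ((y - c) \<bullet> b))" if "y \<in> S" for b y
    using partial_deriv_compose[OF f1 q] ST that by (simp add: partial_deriv_norm_square)
  have lin: "(\<lambda>y. 2 * ((y - c) \<bullet> b)) differentiable (at y)" for b y
    using Ck_on_inner[of 1 b UNIV] by (auto simp: inner_diff_left intro!: differentiable_mult differentiable_diff)
  have 2: "partial_deriv b (partial_deriv b (\<lambda>y. f (?q y))) x =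
     deriv f (?q x) * 2 + 4 * deriv (deriv f) (?q x) * ((x - c) \<bullet> b)\<^sup>2" if "b \<in> Basis" for b
  proof -
    have "partial_deriv b (partial_deriv b (\<lambda>y. f (?q y))) x
       = partial_deriv b (\<lambda>y. deriv f (?q y) * (2 * ((y - c) \<bullet> b))) x"
      by (rule partial_deriv_cong_open[OF S]) (rule 1)
    also have "\<dots> = deriv f (?q x) * partial_deriv b (\<lambda>y. 2 * ((y - c) \<bullet> b)) x +
         partial_deriv b (\<lambda>y. deriv f (?q y)) x * (2 * ((x - c) \<bullet> b))"
      by (rule partial_deriv_mult[OF _ lin])
        (use ST[OF S(2)] f2 q in \<open>auto intro: differentiable_compose_real\<close>)
    also have "partial_deriv b (\<lambda>y. 2 * ((y - c) \<bullet> b)) x = 2 * (b \<bullet> b)"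
      by (rule partial_derivI) (auto intro!: derivative_eq_intros)
    also have "partial_deriv b (\<lambda>y. deriv f (?q y)) x = deriv (deriv f) (?q x) * (2 * ((x - c) \<bullet> b))"
      using partial_deriv_compose[OF f2 q] ST S(2) by (simp add: partial_deriv_norm_square)
    finally show ?thesis using that by (simp add: power2_eq_square algebra_simps)
  qed
  have "laplacian (\<lambda>y. f (?q y)) x =
     2 * real DIM('a) * deriv f (?q x) + 4 * deriv (deriv f) (?q x) * (\<Sum>b\<in>Basis. ((x - c) \<bullet> b)\<^sup>2)"
    unfolding laplacian_def by (simp add: 2 sum.distrib sum_distrib_left)
  then show ?thesis by (simp add: norm_square_Basis[symmetric])
qed

section \<open>Compactly supported functions and integration by parts\<close>

text \<open>Unlike \<open>test_function\<close>, this asks for finitely many derivatives only: the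
  logarithmic potentials used as test functions below are C^2 and not smoother. Vanishing off some
  compact subset of \<open>U\<close> replaces a condition on the closed support.\<close>

definition Ckc :: "nat \<Rightarrow> ('a::euclidean_space \<Rightarrow> real) \<Rightarrow> 'a set \<Rightarrow> bool" where
  "Ckc k f U \<longleftrightarrow> Ck_on k f UNIV \<and> (\<exists>K. compact K \<and> K \<subseteq> U \<and> (\<forall>x. x \<notin> K \<longrightarrow> f x = 0))"

lemma CkcE:
  assumes "Ckc k f U"
  obtains K where "Ck_on k f UNIV" "compact K" "K \<subseteq> U" "\<And>x. x \<notin> K \<Longrightarrow> f x = 0"
  using assms unfolding Ckc_def by blast

lemma CkcI:
  assumes "Ck_on k f UNIV" "compact K" "K \<subseteq> U" "\<And>x. x \<notin> K \<Longrightarrow> f x = 0"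
  shows "Ckc k f U"
  using assms unfolding Ckc_def by blast

lemma Ckc_le: "Ckc n f U \<Longrightarrow> m \<le> n \<Longrightarrow> Ckc m f U"
  unfolding Ckc_def using Ck_on_le by blast

lemma Ckc_mono: "Ckc n f U \<Longrightarrow> U \<subseteq> V \<Longrightarrow> Ckc n f V"
  unfolding Ckc_def by blast

lemma Ckc_zero: "Ckc n f U \<Longrightarrow> x \<notin> U \<Longrightarrow> f x = 0"
  unfolding Ckc_def by blast

lemma Ckc_continuous: "Ckc n f U \<Longrightarrow> continuous_on UNIV f"
  unfolding Ckc_def using Ck_on_continuous by blast

lemma test_function_Ckc: "test_function U f \<Longrightarrow> Ckc k f U"
  by (rule CkcI[of _ _ "closure {x. f x \<noteq> 0}"])
    (auto simp: test_function_def intro: subsetD[OF closure_subset])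

lemma partial_deriv_zero_off:
  assumes "closed K" "\<And>x. x \<notin> K \<Longrightarrow> f x = 0" "x \<notin> K"
  shows "partial_deriv b f x = 0"
proof -
  have "partial_deriv b f x = partial_deriv b (\<lambda>x. 0) x"
    by (rule partial_deriv_cong_open[of "- K"]) (use assms in auto)
  then show ?thesis by simp
qed

lemma Ckc_partial_deriv:
  assumes "Ckc (Suc k) f U" "b \<in> Basis"
  shows "Ckc k (partial_deriv b f) U"
proof -
  obtain K where K: "Ck_on (Suc k) f UNIV" "compact K" "K \<subseteq> U" "\<And>x. x \<notin> K \<Longrightarrow> f x = 0"
    using assms(1) by (rule CkcE) blast
  show ?thesis
  proof (rule CkcI[OF _ K(2,3)])
    show "Ck_on k (partial_deriv b f) UNIV" using K(1) assms(2) by simp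
    show "partial_deriv b f x = 0" if "x \<notin> K" for x
      by (rule partial_deriv_zero_off[OF compact_imp_closed[OF K(2)] K(4) that])
  qed
qed

lemma Ckc_add:
  assumes "Ckc k f U" "Ckc k g U"
  shows "Ckc k (\<lambda>x. f x + g x) U"
proof -
  obtain K where K: "Ck_on k f UNIV" "compact K" "K \<subseteq> U" "\<And>x. x \<notin> K \<Longrightarrow> f x = 0"
    using assms(1) by (rule CkcE) blast
  obtain L where L: "Ck_on k g UNIV" "compact L" "L \<subseteq> U" "\<And>x. x \<notin> L \<Longrightarrow> g x = 0"
    using assms(2) by (rule CkcE) blast
  show ?thesis
    by (rule CkcI[of _ _ "K \<union> L"]) (use K L Ck_on_add[OF open_UNIV K(1) L(1)] in auto)
qed

text \<open>Off \<open>U\<close> the factor \<open>f\<close> is arbitrary. The product is C^k on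
  \<open>U\<close> by the product rule and on the complement of the support of \<open>g\<close>
  because it is zero there; these two open sets cover the space.\<close>

lemma Ckc_mult:
  assumes "open U" "Ck_on k f U" "Ckc k g U"
  shows "Ckc k (\<lambda>x. f x * g x) U"
proof -
  obtain K where K: "Ck_on k g UNIV" "compact K" "K \<subseteq> U" "\<And>x. x \<notin> K \<Longrightarrow> g x = 0"
    using assms(3) by (rule CkcE) blast
  have "Ck_on k (\<lambda>x. f x * g x) U"
    by (rule Ck_on_mult[OF assms(1,2) Ck_on_subset[OF K(1)]]) simp
  moreover have "Ck_on k (\<lambda>x. f x * g x) (- K)"
    by (subst Ck_on_cong[of _ _ "\<lambda>_. 0"]) (use K in \<open>auto simp: compact_imp_closed open_Compl\<close>)
  ultimately have "Ck_on k (\<lambda>x. f x * g x) (U \<union> - K)"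
    by (intro Ck_on_Un assms(1)) (use K in \<open>auto simp: compact_imp_closed open_Compl\<close>)
  moreover have "U \<union> - K = UNIV" using K(3) by blast
  ultimately show ?thesis
    by (intro CkcI[OF _ K(2,3)]) (use K(4) in auto)
qed

lemma Ckc_sum:
  "(\<And>i. i \<in> I \<Longrightarrow> Ckc k (f i) U) \<Longrightarrow> Ckc k (\<lambda>x. \<Sum>i\<in>I. f i x) U"
proof (induction I rule: infinite_finite_induct)
  case (insert i I)
  then show ?case using Ckc_add[of k "f i" U "\<lambda>x. \<Sum>i\<in>I. f i x"] by simp
qed (auto intro!: CkcI[of _ _ "{}"])

lemma Ckc_laplacian: "Ckc 2 f U \<Longrightarrow> Ckc 0 (laplacian f) U"
  unfolding laplacian_def[abs_def]
  by (intro Ckc_sum Ckc_partial_deriv) (simp_all add: numeral_2_eq_2)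

lemma Ckc_compose:
  assumes "Ck_on k G UNIV" "G 0 = 0" "Ckc k f U"
  shows "Ckc k (\<lambda>x. G (f x)) U"
proof -
  obtain K where K: "Ck_on k f UNIV" "compact K" "K \<subseteq> U" "\<And>x. x \<notin> K \<Longrightarrow> f x = 0"
    using assms(3) by (rule CkcE) blast
  show ?thesis
    by (rule CkcI[OF _ K(2,3)])
      (use Ck_on_compose[OF open_UNIV open_UNIV assms(1) K(1)] K(4) assms(2) in auto)
qed

lemma borel_measurable_lebesgue_continuous:
  fixes f :: "'a::euclidean_space \<Rightarrow> 'b::{second_countable_topology,metric_space}"
  assumes "continuous_on UNIV f"
  shows "f \<in> borel_measurable lebesgue"
  by (rule measurable_completion) (use borel_measurable_continuous_onI[OF assms] in simp)

lemma Ckc_bounded: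
  assumes "Ckc k f U"
  obtains B where "B > 0" "\<And>x. \<bar>f x\<bar> \<le> B"
proof -
  obtain K where K: "Ck_on k f UNIV" "compact K" "K \<subseteq> U" "\<And>x. x \<notin> K \<Longrightarrow> f x = 0"
    using assms by (rule CkcE) blast
  have "compact (f ` K)"
    by (rule compact_continuous_image[OF continuous_on_subset[OF Ck_on_continuous[OF K(1)]] K(2)]) simp
  then obtain B where "B > 0" "\<And>y. y \<in> f ` K \<Longrightarrow> norm y \<le> B"
    by (metis compact_imp_bounded bounded_pos)
  then show ?thesis using K(4) that[of B]
    by (metis abs_zero image_eqI less_eq_real_def real_norm_def)
qed

lemma integrable_lborel_compact_support:
  fixes f :: "'a::euclidean_space \<Rightarrow> real"
  assumes "continuous_on UNIV f" "compact K" "\<And>x. x \<notin> K \<Longrightarrow> f x = 0"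
  shows "integrable lborel f"
proof -
  have "integrable lborel (\<lambda>x. indicator K x *\<^sub>R f x)"
    by (rule borel_integrable_compact[OF assms(2) continuous_on_subset[OF assms(1)]]) simp
  also have "(\<lambda>x. indicator K x *\<^sub>R f x) = f" by (rule ext) (use assms(3) in \<open>auto simp: indicator_def\<close>)
  finally show ?thesis .
qed

lemma Ckc_integrable_lborel: "Ckc k f U \<Longrightarrow> integrable lborel f"
  using Ck_on_continuous integrable_lborel_compact_support unfolding Ckc_def by metis

lemma Ckc_integrable: "Ckc k f U \<Longrightarrow> integrable lebesgue f"
  using Ckc_integrable_lborel integrable_completion
  by (metis borel_measurable_integrable)

lemma integral_translate_lborel:
  fixes f :: "'a::euclidean_space \<Rightarrow> real"
  assumes "f \<in> borel_measurable borel"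
  shows "(LINT x|lborel. f (c + x)) = (LINT x|lborel. f x)"
proof -
  have "(LINT x|lborel. f x) = (LINT x|distr lborel borel ((+) c). f x)"
    by (simp add: lborel_distr_plus)
  also have "\<dots> = (LINT x|lborel. f (c + x))"
    by (rule integral_distr) (use assms in auto)
  finally show ?thesis by simp
qed

text \<open>By translation invariance every difference quotient has integral 0. The steps
  \<open>h n\<close> are at most 1, so all quotients are supported in the compact set
  \<open>K'\<close> and bounded by the supremum of the partial derivative; dominated convergence
  passes to the limit.\<close>

lemma Ckc_integral_partial_deriv:
  fixes f :: "'a::euclidean_space \<Rightarrow> real"
  assumes f: "Ckc 1 f U" and b: "b \<in> Basis"
  shows "(LINT x|lebesgue. partial_deriv b f x) = 0"
proof -
  obtain K where K: "Ck_on 1 f UNIV" "compact K" "K \<subseteq> U" "\<And>x. x \<notin> K \<Longrightarrow> f x = 0"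
    using f by (rule CkcE) blast
  have diff: "f differentiable (at x)" for x using K(1) by simp
  have pd: "Ckc 0 (partial_deriv b f) U" using Ckc_partial_deriv[of 0] f b by simp
  obtain B where B: "B > 0" "\<And>x. \<bar>partial_deriv b f x\<bar> \<le> B" using pd by (rule Ckc_bounded) blast
  define K' where "K' = {x + y |x y. x \<in> K \<and> y \<in> cball 0 (norm b)}"
  have cK': "compact K'" unfolding K'_def using compact_sums[OF K(2) compact_cball[of 0 "norm b"]] by simp
  define h where "h n = 1 / real (Suc n)" for n
  have h: "0 < h n" "h n \<le> 1" for n by (auto simp: h_def)
  define F where "F n x = (f (h n *\<^sub>R b + x) - f x) / h n" for n x
  have mf: "f \<in> borel_measurable borel"
    using Ckc_continuous[OF f] by (rule borel_measurable_continuous_onI)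
  have mpd: "partial_deriv b f \<in> borel_measurable borel"
    using Ckc_continuous[OF pd] by (rule borel_measurable_continuous_onI)
  have intf: "integrable lborel f" using Ckc_integrable_lborel[OF f] .
  have shift: "integrable lborel (\<lambda>x. f (c + x))" for c
  proof -
    have "integrable (distr lborel borel ((+) c)) f" using intf by (simp add: lborel_distr_plus)
    then show ?thesis by (subst (asm) integrable_distr_eq) (use mf in auto)
  qed
  have line: "((\<lambda>t. f (t *\<^sub>R b + x)) has_field_derivative partial_deriv b f (t *\<^sub>R b + x)) (at t)" for t x
  proof -
    have "((\<lambda>t. t *\<^sub>R b + x) has_derivative (\<lambda>t. t *\<^sub>R b)) (at t)"
      by (auto intro!: derivative_eq_intros)
    from has_derivative_compose[OF this has_derivative_gradient[OF diff]]
    show ?thesis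
      by (simp add: has_field_derivative_def partial_deriv_eq_inner_gradient[OF diff] mult.commute[of _ "_ \<bullet> _"]
          cong: if_cong) 
  qed
  have "(\<lambda>n. LINT x|lborel. F n x) \<longlonglongrightarrow> (LINT x|lborel. partial_deriv b f x)"
  proof (rule integral_dominated_convergence)
    show "partial_deriv b f \<in> borel_measurable lborel" using mpd by simp
    show "F n \<in> borel_measurable lborel" for n unfolding F_def using mf by measurable
    show "integrable lborel (\<lambda>x. indicator K' x *\<^sub>R B)"
      by (rule borel_integrable_compact[OF cK']) simp
    show "AE x in lborel. (\<lambda>n. F n x) \<longlonglongrightarrow> partial_deriv b f x"
    proof (rule AE_I2)
      fix x
      have "((\<lambda>t. (f (t *\<^sub>R b + x) - f x) / t) \<longlongrightarrow> partial_deriv b f x) (at 0)"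
        using line[of x 0] by (simp add: has_field_derivative_def DERIV_def[unfolded has_field_derivative_def] has_field_derivative_iff)
      moreover have "filterlim h (at 0) sequentially"
      proof -
        have "h \<longlonglongrightarrow> 0"
          using LIMSEQ_inverse_real_of_nat unfolding h_def[abs_def] by (simp add: inverse_eq_divide)
        then show ?thesis unfolding filterlim_at by (simp add: h_def)
      qed
      ultimately show "(\<lambda>n. F n x) \<longlonglongrightarrow> partial_deriv b f x"
        unfolding F_def by (rule filterlim_compose)
    qed
    show "AE x in lborel. norm (F n x) \<le> indicator K' x *\<^sub>R B" for n
    proof (rule AE_I2)
      fix x
      show "norm (F n x) \<le> indicator K' x *\<^sub>R B"
      proof (cases "x \<in> K'")
        case True
        have "norm (f (h n *\<^sub>R b + x) - f (0 *\<^sub>R b + x)) \<le> B * norm (h n - 0)"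
          by (rule field_differentiable_bound[of UNIV]) (use line B in auto)
        then show ?thesis using True h[of n] by (simp add: F_def field_simps)
      next
        case False
        have "f (h n *\<^sub>R b + x) = 0"
        proof (rule K(4), rule notI)
          assume a: "h n *\<^sub>R b + x \<in> K"
          have "x \<in> K'" unfolding K'_def
            by (rule CollectI, rule exI[of _ "h n *\<^sub>R b + x"], rule exI[of _ "- (h n *\<^sub>R b)"])
              (use a h[of n] b in auto)
          with False show False by simp
        qed
        moreover have "f x = 0"
        proof (rule K(4), rule notI)
          assume a: "x \<in> K"
          have "x \<in> K'" unfolding K'_def
            by (rule CollectI, rule exI[of _ "x"], rule exI[of _ "0"]) (use a in auto)
          with False show False by simp
        qed
        ultimately show ?thesis by (simp add: F_def False)
      qed
    qed
  qed
  moreover have "(LINT x|lborel. F n x) = 0" for n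
    unfolding F_def using integral_translate_lborel[OF mf, of "h n *\<^sub>R b"]
    by (simp add: Bochner_Integration.integral_diff[OF shift intf])
  ultimately have "(LINT x|lborel. partial_deriv b f x) = 0"
    using LIMSEQ_unique[OF _ tendsto_const[of 0]] by simp
  then show ?thesis using integral_completion[of "partial_deriv b f" lborel] mpd by simp
qed

lemma integral_by_parts_partial_deriv:
  assumes "open U" "Ck_on 1 f U" "Ckc 1 g U" "b \<in> Basis"
  shows "(LINT x|lebesgue. f x * partial_deriv b g x) = - (LINT x|lebesgue. partial_deriv b f x * g x)"
proof -
  have fg: "Ckc 1 (\<lambda>x. f x * g x) U" by (rule Ckc_mult[OF assms(1-3)])
  have i1: "integrable lebesgue (\<lambda>x. f x * partial_deriv b g x)"
    by (rule Ckc_integrable[of 0 _ U], rule Ckc_mult[OF assms(1)])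
      (use assms Ckc_partial_deriv[of 0 g U b] Ck_on_continuous[of 1 f U] in auto)
  have i2: "integrable lebesgue (\<lambda>x. partial_deriv b f x * g x)"
    by (rule Ckc_integrable[of 0 _ U], rule Ckc_mult[OF assms(1)])
      (use assms Ckc_le[of 1 g U 0] in auto)
  have "partial_deriv b (\<lambda>x. f x * g x) x = f x * partial_deriv b g x + partial_deriv b f x * g x" for x
  proof (cases "x \<in> U")
    case True
    then show ?thesis using assms(2,3) by (intro partial_deriv_mult) (auto simp: Ckc_def)
  next
    case False
    then have "partial_deriv b g x = 0" "g x = 0" "partial_deriv b (\<lambda>x. f x * g x) x = 0"
      using Ckc_partial_deriv[of 0] assms(3,4) fg
      by (metis Ckc_zero One_nat_def)+
    then show ?thesis by simp
  qed
  then show ?thesis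
    using Ckc_integral_partial_deriv[OF fg assms(4)] Bochner_Integration.integral_add[OF i1 i2] by simp
qed

lemma green_first:
  assumes "open U" "Ck_on 1 f U" "Ckc 2 g U"
  shows "(LINT x|lebesgue. f x * laplacian g x) = - (LINT x|lebesgue. gradient f x \<bullet> gradient g x)"
proof -
  have g: "Ckc (Suc 0) (partial_deriv b g) U" if "b \<in> Basis" for b
    using Ckc_partial_deriv[of "Suc 0" g U b] assms(3) that by (simp add: numeral_2_eq_2)
  have i1: "integrable lebesgue (\<lambda>x. f x * partial_deriv b (partial_deriv b g) x)" if "b \<in> Basis" for b
    by (rule Ckc_integrable[of 0 _ U], rule Ckc_mult[OF assms(1)])
      (use assms Ckc_partial_deriv[OF g[OF that] that] Ck_on_continuous[of 1 f U] in auto)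
  have i2: "integrable lebesgue (\<lambda>x. partial_deriv b f x * partial_deriv b g x)" if "b \<in> Basis" for b
    by (rule Ckc_integrable[of 0 _ U], rule Ckc_mult[OF assms(1)])
      (use assms that Ckc_le[OF g[OF that], of 0] in auto)
  have "(LINT x|lebesgue. f x * laplacian g x) =
     (\<Sum>b\<in>Basis. LINT x|lebesgue. f x * partial_deriv b (partial_deriv b g) x)"
    unfolding laplacian_def sum_distrib_left by (rule Bochner_Integration.integral_sum) (rule i1)
  also have "\<dots> = (\<Sum>b\<in>Basis. - (LINT x|lebesgue. partial_deriv b f x * partial_deriv b g x))"
    by (intro sum.cong refl integral_by_parts_partial_deriv[OF assms(1,2)]) (use g in auto)
  also have "\<dots> = - (LINT x|lebesgue. (\<Sum>b\<in>Basis. partial_deriv b f x * partial_deriv b g x))"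
    by (subst Bochner_Integration.integral_sum) (auto intro: i2 simp: sum_negf)
  also have "(\<lambda>x. \<Sum>b\<in>Basis. partial_deriv b f x * partial_deriv b g x) = (\<lambda>x. gradient f x \<bullet> gradient g x)"
    by (rule ext) (subst euclidean_inner, simp add: gradient_inner_Basis)
  finally show ?thesis .
qed

lemma green_second:
  assumes U: "open U" "Ck_on 2 f U" "Ckc 2 g U"
  shows "(LINT x|lebesgue. f x * laplacian g x) = (LINT x|lebesgue. laplacian f x * g x)"
proof -
  have f1: "Ck_on 1 f U" by (rule Ck_on_le[OF U(2)]) simp
  have g1: "Ckc 1 g U" by (rule Ckc_le[OF U(3)]) simp
  have f2: "Ck_on 1 (partial_deriv b f) U" if "b \<in> Basis" for b
    using U(2) that by (simp add: numeral_2_eq_2)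
  have g: "Ckc 1 (partial_deriv b g) U" if "b \<in> Basis" for b
    using Ckc_partial_deriv[of 1 g U b] U(3) that by (simp add: numeral_2_eq_2)
  have i1: "integrable lebesgue (\<lambda>x. f x * partial_deriv b (partial_deriv b g) x)" if "b \<in> Basis" for b
    by (rule Ckc_integrable[of 0 _ U], rule Ckc_mult[OF U(1)])
      (use Ckc_partial_deriv[of 0] g[OF that] that Ck_on_continuous[OF f1] in auto)
  have i2: "integrable lebesgue (\<lambda>x. partial_deriv b (partial_deriv b f) x * g x)" if "b \<in> Basis" for b
    by (rule Ckc_integrable[of 0 _ U], rule Ckc_mult[OF U(1)])
      (use f2[OF that] that Ckc_le[OF g1, of 0] in auto)
  have "(LINT x|lebesgue. f x * laplacian g x) =
     (\<Sum>b\<in>Basis. LINT x|lebesgue. f x * partial_deriv b (partial_deriv b g) x)"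
    unfolding laplacian_def sum_distrib_left by (rule Bochner_Integration.integral_sum) (rule i1)
  also have "\<dots> = (\<Sum>b\<in>Basis. LINT x|lebesgue. partial_deriv b (partial_deriv b f) x * g x)"
  proof (rule sum.cong[OF refl])
    fix b :: 'a assume b: "b \<in> Basis"
    show "(LINT x|lebesgue. f x * partial_deriv b (partial_deriv b g) x) =
      (LINT x|lebesgue. partial_deriv b (partial_deriv b f) x * g x)"
      using integral_by_parts_partial_deriv[OF U(1) f1 g[OF b] b]
        integral_by_parts_partial_deriv[OF U(1) f2[OF b] g1 b] by simp
  qed
  also have "\<dots> = (LINT x|lebesgue. laplacian f x * g x)"
    unfolding laplacian_def sum_distrib_right
    by (rule Bochner_Integration.integral_sum[symmetric]) (rule i2)
  finally show ?thesis .
qed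

section \<open>Square integrable functions\<close>

lemma L2_onI:
  assumes "set_borel_measurable lebesgue U f" "set_integrable lebesgue U h"
    "\<And>x. x \<in> U \<Longrightarrow> (norm (f x))\<^sup>2 \<le> h x"
  shows "L2_on U f"
  unfolding L2_on_def
proof
  show "set_integrable lebesgue U (\<lambda>x. (norm (f x))\<^sup>2)"
    unfolding set_integrable_def
  proof (rule Bochner_Integration.integrable_bound[OF assms(2)[unfolded set_integrable_def]])
    have "(\<lambda>x. (norm (indicator U x *\<^sub>R f x))\<^sup>2) \<in> borel_measurable lebesgue"
      using assms(1) unfolding set_borel_measurable_def by measurable
    also have "(\<lambda>x. (norm (indicator U x *\<^sub>R f x))\<^sup>2) = (\<lambda>x. indicator U x *\<^sub>R (norm (f x))\<^sup>2)"
      by (auto simp: fun_eq_iff indicator_def)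
    finally show "(\<lambda>x. indicator U x *\<^sub>R (norm (f x))\<^sup>2) \<in> borel_measurable lebesgue" .
    show "AE x in lebesgue. norm (indicator U x *\<^sub>R (norm (f x))\<^sup>2) \<le> norm (indicator U x *\<^sub>R h x)"
      using assms(3) by (intro AE_I2) (fastforce simp: indicator_def)
  qed
qed (rule assms(1))

lemma L2_on_inner:
  assumes "L2_on U f" "L2_on U g"
  shows "set_integrable lebesgue U (\<lambda>x. f x \<bullet> g x)"
  unfolding set_integrable_def
proof (rule Bochner_Integration.integrable_bound)
  show "integrable lebesgue (\<lambda>x. indicator U x *\<^sub>R ((norm (f x))\<^sup>2) + indicator U x *\<^sub>R ((norm (g x))\<^sup>2))"
    using assms unfolding L2_on_def set_integrable_def by (intro Bochner_Integration.integrable_add) auto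
  have "(\<lambda>x. (indicator U x *\<^sub>R f x) \<bullet> (indicator U x *\<^sub>R g x)) \<in> borel_measurable lebesgue"
    using assms unfolding L2_on_def set_borel_measurable_def by (intro borel_measurable_inner) auto
  also have "(\<lambda>x. (indicator U x *\<^sub>R f x) \<bullet> (indicator U x *\<^sub>R g x)) = (\<lambda>x. indicator U x *\<^sub>R (f x \<bullet> g x))"
    by (auto simp: fun_eq_iff indicator_def)
  finally show "(\<lambda>x. indicator U x *\<^sub>R (f x \<bullet> g x)) \<in> borel_measurable lebesgue" .
  have "norm (f x \<bullet> g x) \<le> (norm (f x))\<^sup>2 + (norm (g x))\<^sup>2" for x
  proof -
    have "norm (f x \<bullet> g x) \<le> norm (f x) * norm (g x)" by (simp add: Cauchy_Schwarz_ineq2)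
    moreover have "2 * (norm (f x) * norm (g x)) \<le> (norm (f x))\<^sup>2 + (norm (g x))\<^sup>2"
      using sum_squares_bound[of "norm (f x)" "norm (g x)"] by simp
    moreover have "0 \<le> norm (f x) * norm (g x)" by simp
    ultimately show ?thesis by linarith
  qed
  then show "AE x in lebesgue. norm (indicator U x *\<^sub>R (f x \<bullet> g x)) \<le>
      norm (indicator U x *\<^sub>R ((norm (f x))\<^sup>2) + indicator U x *\<^sub>R ((norm (g x))\<^sup>2))"
    by (intro AE_I2) (auto simp: indicator_def)
qed

lemma L2_on_add:
  assumes "L2_on U f" "L2_on U g"
  shows "L2_on U (\<lambda>x. f x + g x)"
proof (rule L2_onI)
  show "set_borel_measurable lebesgue U (\<lambda>x. f x + g x)"
    using assms unfolding L2_on_def set_borel_measurable_def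
    by (auto simp: scaleR_add_right)
  show "set_integrable lebesgue U (\<lambda>x. 2 * (norm (f x))\<^sup>2 + 2 * (norm (g x))\<^sup>2)"
    using assms unfolding L2_on_def by (intro set_integral_add set_integrable_mult_right) auto
  show "(norm (f x + g x))\<^sup>2 \<le> 2 * (norm (f x))\<^sup>2 + 2 * (norm (g x))\<^sup>2" for x
  proof -
    have "(norm (f x + g x))\<^sup>2 \<le> (norm (f x) + norm (g x))\<^sup>2"
      by (intro power_mono norm_triangle_ineq) simp
    then show ?thesis using sum_squares_bound[of "norm (f x)" "norm (g x)"]
      by (simp add: power2_sum)
  qed
qed

lemma L2_on_scaleR:
  assumes "L2_on U f"
  shows "L2_on U (\<lambda>x. c *\<^sub>R f x)"
proof -
  have "(\<lambda>x. indicator U x *\<^sub>R (c *\<^sub>R f x)) = (\<lambda>x. c *\<^sub>R (indicator U x *\<^sub>R f x))" by auto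
  then have "set_borel_measurable lebesgue U (\<lambda>x. c *\<^sub>R f x)"
    using assms borel_measurable_const_scaleR[of "\<lambda>x. indicator U x *\<^sub>R f x" lebesgue c]
    unfolding L2_on_def set_borel_measurable_def by argo
  moreover have "set_integrable lebesgue U (\<lambda>x. (norm (c *\<^sub>R f x))\<^sup>2)"
    using assms unfolding L2_on_def by (simp add: power_mult_distrib)
  ultimately show ?thesis unfolding L2_on_def by simp
qed

lemma L2_on_diff: "L2_on U f \<Longrightarrow> L2_on U g \<Longrightarrow> L2_on U (\<lambda>x. f x - g x)"
  using L2_on_add[of U f "\<lambda>x. (-1) *\<^sub>R g x"] L2_on_scaleR[of U g "-1"] by simp

lemma L2_norm_nonneg: "0 \<le> L2_norm U f"
  unfolding L2_norm_def set_lebesgue_integral_def by simp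

lemma L2_norm_square: "(L2_norm U f)\<^sup>2 = (LINT x:U|lebesgue. (norm (f x))\<^sup>2)"
  unfolding L2_norm_def set_lebesgue_integral_def by simp

lemma L2_cauchy_schwarz:
  assumes f: "L2_on U f" and g: "L2_on U g"
  shows "\<bar>LINT x:U|lebesgue. f x \<bullet> g x\<bar> \<le> L2_norm U f * L2_norm U g"
proof -
  define a where "a = (L2_norm U f)\<^sup>2"
  define b where "b = (L2_norm U g)\<^sup>2"
  define c where "c = (LINT x:U|lebesgue. f x \<bullet> g x)"
  have quad: "0 \<le> a + 2 * t * c + t\<^sup>2 * b" for t
  proof -
    have i: "set_integrable lebesgue U (\<lambda>x. (norm (f x))\<^sup>2)"
      "set_integrable lebesgue U (\<lambda>x. 2 * t * (f x \<bullet> g x))"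
      "set_integrable lebesgue U (\<lambda>x. t\<^sup>2 * (norm (g x))\<^sup>2)"
      using f g L2_on_inner[OF f g] unfolding L2_on_def by (auto intro!: set_integrable_mult_right)
    have "0 \<le> (LINT x:U|lebesgue. (norm (f x + t *\<^sub>R g x))\<^sup>2)"
      unfolding set_lebesgue_integral_def by simp
    also have "(\<lambda>x. (norm (f x + t *\<^sub>R g x))\<^sup>2) =
        (\<lambda>x. (norm (f x))\<^sup>2 + 2 * t * (f x \<bullet> g x) + t\<^sup>2 * (norm (g x))\<^sup>2)"
      unfolding power2_norm_eq_inner
      by (rule ext) (simp add: inner_add inner_commute algebra_simps power2_eq_square)
    also have "(LINT x:U|lebesgue. \<dots> x) = a + 2 * t * c + t\<^sup>2 * b"
      using i by (simp add: set_integral_add a_def b_def c_def L2_norm_square)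
    finally show ?thesis .
  qed
  have "c\<^sup>2 \<le> a * b"
  \<comment> \<open>A nonnegative polynomial in \<open>t\<close>: if \<open>b = 0\<close> it is
    affine and must have slope 0, otherwise it is evaluated at its minimum
    \<open>- c / b\<close>.\<close>
  proof (cases "b = 0")
    case True
    have "c = 0"
    proof (rule ccontr)
      assume "c \<noteq> 0"
      then show False using quad[of "- (a + 1) / (2 * c)"] True by (simp add: field_simps)
    qed
    then show ?thesis using True by simp
  next
    case False
    then have "b > 0" unfolding b_def by simp
    have "0 \<le> a - c\<^sup>2 / b" using quad[of "- c / b"] \<open>b > 0\<close>
      by (simp add: field_simps power2_eq_square)
    then show ?thesis using \<open>b > 0\<close> by (simp add: field_simps)
  qed
  then have "c\<^sup>2 \<le> (L2_norm U f * L2_norm U g)\<^sup>2" by (simp add: a_def b_def power_mult_distrib)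
  then show ?thesis unfolding c_def[symmetric]
    by (metis L2_norm_nonneg abs_le_square_iff abs_of_nonneg mult_nonneg_nonneg)
qed

lemma L2_tendsto_inner:
  assumes "\<And>n. L2_on U (f n)" "L2_on U f'" "L2_on U h"
    and lim: "(\<lambda>n. L2_norm U (\<lambda>x. f n x - f' x)) \<longlonglongrightarrow> 0"
  shows "(\<lambda>n. LINT x:U|lebesgue. f n x \<bullet> h x) \<longlonglongrightarrow> (LINT x:U|lebesgue. f' x \<bullet> h x)"
proof -
  have "(\<lambda>n. (LINT x:U|lebesgue. f n x \<bullet> h x) - (LINT x:U|lebesgue. f' x \<bullet> h x)) \<longlonglongrightarrow> 0"
  proof (rule tendsto_rabs_zero_cancel, rule tendsto_sandwich[OF _ _ tendsto_const])
    show "(\<lambda>n. L2_norm U (\<lambda>x. f n x - f' x) * L2_norm U h) \<longlonglongrightarrow> 0"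
      using tendsto_mult_right[OF lim, of "L2_norm U h"] by simp
    have "\<bar>(LINT x:U|lebesgue. f n x \<bullet> h x) - (LINT x:U|lebesgue. f' x \<bullet> h x)\<bar>
      \<le> L2_norm U (\<lambda>x. f n x - f' x) * L2_norm U h" for n
    proof -
      have "(LINT x:U|lebesgue. f n x \<bullet> h x) - (LINT x:U|lebesgue. f' x \<bullet> h x)
        = (LINT x:U|lebesgue. (f n x - f' x) \<bullet> h x)"
        by (subst set_integral_diff(2)[symmetric]) (auto intro: L2_on_inner assms simp: inner_diff_left)
      then show ?thesis using L2_cauchy_schwarz[OF L2_on_diff[OF assms(1,2)] assms(3)] by simp
    qed
    then show "\<forall>\<^sub>F n in sequentially. \<bar>(LINT x:U|lebesgue. f n x \<bullet> h x) - (LINT x:U|lebesgue. f' x \<bullet> h x)\<bar>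
      \<le> L2_norm U (\<lambda>x. f n x - f' x) * L2_norm U h" by simp
  qed simp
  then show ?thesis by (simp add: Lim_null[symmetric])
qed

lemma L2_on_compact_support:
  fixes f :: "'a::euclidean_space \<Rightarrow> 'b::euclidean_space"
  assumes "open U" "continuous_on UNIV f" "compact K" "\<And>x. x \<notin> K \<Longrightarrow> f x = 0"
  shows "L2_on U f"
proof -
  have U: "U \<in> sets lebesgue" using assms(1) by auto
  have "set_borel_measurable lebesgue U f"
    unfolding set_borel_measurable_def
    using borel_measurable_lebesgue_continuous[OF assms(2)] U by measurable
  moreover have "integrable lborel (\<lambda>x. (norm (f x))\<^sup>2)"
    by (rule integrable_lborel_compact_support[OF _ assms(3)])
      (use assms in \<open>auto intro!: continuous_intros\<close>)
  then have "integrable lebesgue (\<lambda>x. (norm (f x))\<^sup>2)"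
    by (metis borel_measurable_integrable integrable_completion)
  then have "set_integrable lebesgue U (\<lambda>x. (norm (f x))\<^sup>2)"
    unfolding set_integrable_def using U integrable_mult_indicator by blast
  ultimately show ?thesis unfolding L2_on_def by simp
qed

lemma Ckc_L2_on: "open U \<Longrightarrow> Ckc k f V \<Longrightarrow> L2_on U f"
  by (erule CkcE) (rule L2_on_compact_support[OF _ Ck_on_continuous])

lemma Ckc_gradient_L2_on:
  assumes "open U" "Ckc (Suc k) f V"
  shows "L2_on U (gradient f)"
proof -
  obtain K where K: "Ck_on (Suc k) f UNIV" "compact K" "\<And>x. x \<notin> K \<Longrightarrow> f x = 0"
    using assms(2) by (rule CkcE) blast
  show ?thesis
  proof (rule L2_on_compact_support[OF assms(1) continuous_on_gradient[OF K(1)] K(2)])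
    show "gradient f x = 0" if "x \<notin> K" for x
      unfolding gradient_def using partial_deriv_zero_off[OF compact_imp_closed[OF K(2)] K(3) that] by simp
  qed
qed

lemma set_lebesgue_integral_eq_full:
  assumes "\<And>x. x \<notin> U \<Longrightarrow> f x = 0"
  shows "(LINT x:U|lebesgue. f x) = (LINT x|lebesgue. (f x :: real))"
  unfolding set_lebesgue_integral_def
  by (rule Bochner_Integration.integral_cong) (use assms in \<open>auto simp: indicator_def\<close>)

section \<open>Smooth square roots and a smoothed absolute value\<close>

lemma Ck_on_inverse: "Ck_on k inverse ({0<..} :: real set)"
proof (induction k)
  case (Suc k)
  show ?case
  proof (rule Ck_on_SucI_real)
    show "(inverse has_field_derivative (-1) * (inverse x * inverse x)) (at x)" if "x \<in> {0<..}" for x :: real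
      using that DERIV_inverse[of x UNIV] by (simp add: numeral_2_eq_2)
    show "Ck_on k (\<lambda>x. (-1) * (inverse x * inverse x)) ({0<..} :: real set)"
      by (intro Ck_on_mult Ck_on_const Suc) auto
  qed simp
qed (auto intro!: continuous_on_inverse)

text \<open>The derivative is written with \<open>sqrt x * inverse x\<close> instead of the inverse
  of \<open>sqrt x\<close>, which makes it a product of functions that the induction already
  covers.\<close>

lemma Ck_on_sqrt: "Ck_on k sqrt {0<..}"
proof (induction k)
  case (Suc k)
  show ?case
  proof (rule Ck_on_SucI_real)
    show "(sqrt has_field_derivative (sqrt x * inverse x) * (1/2)) (at x)" if "x \<in> {0<..}" for x :: real
    proof -
      have "sqrt x * inverse x = inverse (sqrt x)"
        using that by (simp add: field_simps)
      then show ?thesis using DERIV_real_sqrt[of x] that by simp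
    qed
    show "Ck_on k (\<lambda>x. (sqrt x * inverse x) * (1/2)) ({0<..} :: real set)"
      by (intro Ck_on_mult Ck_on_const Ck_on_inverse Suc) auto
  qed simp
qed (auto intro!: continuous_on_real_sqrt)

text \<open>For \<open>d > 0\<close> a smooth, convex, 1-Lipschitz function within distance
  \<open>d\<close> of the absolute value. Subtracting \<open>d\<close> makes it vanish at 0, so that
  composition preserves compact support.\<close>

definition soft_abs :: "real \<Rightarrow> real \<Rightarrow> real" where
  "soft_abs d t = sqrt (t\<^sup>2 + d\<^sup>2) - d"

definition soft_sgn :: "real \<Rightarrow> real \<Rightarrow> real" where
  "soft_sgn d t = t / sqrt (t\<^sup>2 + d\<^sup>2)"

lemma Ck_on_soft_abs: assumes "d > 0" shows "Ck_on k (soft_abs d) UNIV"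
proof -
  have "Ck_on k (\<lambda>t::real. t) UNIV" using Ck_on_inner[of k 1 "UNIV :: real set"] by simp
  then have "Ck_on k (\<lambda>t::real. t\<^sup>2 + d\<^sup>2) UNIV"
    by (intro Ck_on_add Ck_on_power Ck_on_const) auto
  then have "Ck_on k (\<lambda>t::real. sqrt (t\<^sup>2 + d\<^sup>2)) UNIV"
    by (intro Ck_on_compose[OF _ _ Ck_on_sqrt]) (use assms in \<open>auto simp: add_nonneg_pos\<close>)
  then show ?thesis unfolding soft_abs_def[abs_def]
    by (intro Ck_on_diff Ck_on_const) auto
qed

lemma DERIV_soft_abs:
  assumes "d > 0" shows "(soft_abs d has_field_derivative soft_sgn d t) (at t)"
proof -
  have "t\<^sup>2 + d\<^sup>2 > 0" using assms by (simp add: add_nonneg_pos)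
  then show ?thesis
    unfolding soft_abs_def[abs_def] soft_sgn_def
    by (auto intro!: derivative_eq_intros simp: field_simps)
qed

text \<open>The sign of \<open>D\<close> is the convexity from which subharmonicity follows. The
  bound \<open>1 / d\<close> keeps the gradients of test functions containing
  \<open>soft_sgn\<close> under control for fixed \<open>d\<close>.\<close>

lemma DERIV_soft_sgn:
  assumes "d > 0"
  obtains D where "\<And>t. (soft_sgn d has_field_derivative D t) (at t)" "\<And>t. 0 \<le> D t" "\<And>t. D t \<le> 1 / d"
proof (rule that)
  fix t :: real
  let ?s = "sqrt (t\<^sup>2 + d\<^sup>2)"
  have pos: "t\<^sup>2 + d\<^sup>2 > 0" using assms by (simp add: add_nonneg_pos)
  then have s: "?s > 0" "?s\<^sup>2 = t\<^sup>2 + d\<^sup>2" by simp_all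
  have "d \<le> ?s" using real_le_rsqrt[of d "t\<^sup>2 + d\<^sup>2"] by simp
  have "((\<lambda>t. sqrt (t\<^sup>2 + d\<^sup>2)) has_field_derivative t / ?s) (at t)"
    using pos by (auto intro!: derivative_eq_intros simp: field_simps)
  then have "(soft_sgn d has_field_derivative (1 * ?s - t * (t / ?s)) / (?s * ?s)) (at t)"
    unfolding soft_sgn_def[abs_def] using s(1) by (intro DERIV_divide DERIV_ident) auto
  moreover have "(1 * ?s - t * (t / ?s)) / (?s * ?s) = (?s\<^sup>2 - t\<^sup>2) / ?s ^ 3"
    using s(1) by (simp add: divide_simps power2_eq_square power3_eq_cube del: real_sqrt_gt_0_iff)
  ultimately show "(soft_sgn d has_field_derivative d\<^sup>2 / ?s ^ 3) (at t)"
    using s(2) by simp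
  show "0 \<le> d\<^sup>2 / ?s ^ 3" by simp
  have "d\<^sup>2 * d \<le> ?s ^ 3"
    using power_mono[OF \<open>d \<le> ?s\<close>, of 3] assms by (simp add: power2_eq_square power3_eq_cube)
  then show "d\<^sup>2 / ?s ^ 3 \<le> 1 / d" using s(1) assms by (simp add: field_simps)
qed

lemma soft_abs_0 [simp]: "d > 0 \<Longrightarrow> soft_abs d 0 = 0"
  by (simp add: soft_abs_def)

lemma soft_sgn_0 [simp]: "soft_sgn d 0 = 0"
  by (simp add: soft_sgn_def)

lemma abs_soft_sgn_le: "\<bar>soft_sgn d t\<bar> \<le> 1"
proof (cases "sqrt (t\<^sup>2 + d\<^sup>2) = 0")
  case False
  then have "sqrt (t\<^sup>2 + d\<^sup>2) > 0" by (simp add: order_less_le)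
  moreover have "\<bar>t\<bar> \<le> sqrt (t\<^sup>2 + d\<^sup>2)" by (rule real_le_rsqrt) simp
  ultimately show ?thesis by (simp add: soft_sgn_def)
qed (simp add: soft_sgn_def)

lemma soft_abs_lipschitz: assumes "d > 0" shows "\<bar>soft_abs d s - soft_abs d t\<bar> \<le> \<bar>s - t\<bar>"
proof -
  have "norm (soft_abs d s - soft_abs d t) \<le> 1 * norm (s - t)"
    by (rule field_differentiable_bound[of UNIV])
      (use DERIV_soft_abs[OF assms] abs_soft_sgn_le in \<open>auto intro: has_field_derivative_at_within\<close>)
  then show ?thesis by simp
qed

lemma abs_diff_soft_abs_le: assumes "d > 0" shows "\<bar>\<bar>t\<bar> - soft_abs d t\<bar> \<le> d"
proof -
  have "\<bar>t\<bar> \<le> sqrt (t\<^sup>2 + d\<^sup>2)" by (rule real_le_rsqrt) simp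
  moreover have "sqrt (t\<^sup>2 + d\<^sup>2) \<le> \<bar>t\<bar> + d"
    by (rule real_le_lsqrt) (use assms in \<open>auto simp: power2_sum\<close>)
  moreover have "d \<le> sqrt (t\<^sup>2 + d\<^sup>2)" by (rule real_le_rsqrt) simp
  ultimately show ?thesis unfolding soft_abs_def using assms by linarith
qed

section \<open>Weak subharmonicity of the absolute value\<close>

definition flat :: "real poly \<Rightarrow> real \<Rightarrow> real" where
  "flat p t = (if t > 0 then poly p (1 / t) * exp (- (1 / t)) else 0)"

lemma tendsto_poly_times_exp_minus:
  "((\<lambda>y::real. poly p y * exp (- y)) \<longlongrightarrow> 0) at_top"
proof -
  have "((\<lambda>y::real. \<Sum>i\<le>degree p. coeff p i * (y ^ i / exp y)) \<longlongrightarrow> (\<Sum>i\<le>degree p. coeff p i * 0)) at_top"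
    by (intro tendsto_sum tendsto_mult tendsto_const tendsto_power_div_exp_0)
  then show ?thesis by (simp add: poly_altdef exp_minus sum_distrib_right divide_inverse mult.assoc)
qed

text \<open>With s = 1/t, differentiation in t is -s^2 d/ds, so p(s) exp(-s) becomes s^2 (p - p')(s)
  exp(-s): the family is closed under differentiation, which gives smoothness by induction. At 0 the
  difference quotient is again of this form, with \<open>pCons 0 p\<close>, and the exponential
  wins.\<close>

lemma DERIV_flat:
  "(flat p has_field_derivative flat (pCons 0 (pCons 0 (p - pderiv p))) t) (at t)"
proof -
  consider "t > 0" | "t < 0" | "t = 0" by linarith
  then show ?thesis
  proof cases
    case 1
    have 2: "((\<lambda>t. 1 / t) has_field_derivative - (1 / t\<^sup>2)) (at t)"
      using 1 by (auto intro!: derivative_eq_intros simp: power2_eq_square)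
    have "((\<lambda>t. poly p (1 / t) * exp (- (1 / t))) has_field_derivative
        poly (pderiv p) (1 / t) * - (1 / t\<^sup>2) * exp (- (1 / t)) + exp (- (1 / t)) * - (- (1 / t\<^sup>2)) * poly p (1 / t)) (at t)"
      by (intro DERIV_mult DERIV_chain2[OF poly_DERIV 2] DERIV_chain2[OF DERIV_exp] DERIV_minus 2)
    then have "((\<lambda>t. poly p (1 / t) * exp (- (1 / t))) has_field_derivative
        flat (pCons 0 (pCons 0 (p - pderiv p))) t) (at t)"
      using 1 by (simp add: flat_def power2_eq_square algebra_simps)
    then show ?thesis
      by (rule has_field_derivative_transform_within_open[of _ _ _ "{0<..}"]) (use 1 in \<open>auto simp: flat_def\<close>)
  next
    case 2
    have "((\<lambda>t. 0) has_field_derivative 0) (at t)" by simp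
    then have "(flat p has_field_derivative 0) (at t)"
      by (rule has_field_derivative_transform_within_open[of _ _ _ "{..<0}"]) (use 2 in \<open>auto simp: flat_def\<close>)
    then show ?thesis using 2 by (simp add: flat_def)
  next
    case 3
    have "((\<lambda>h. poly (pCons 0 p) (inverse h) * exp (- inverse h)) \<longlongrightarrow> 0) (at_right (0::real))"
      by (rule filterlim_compose[OF tendsto_poly_times_exp_minus filterlim_inverse_at_top_right])
    then have r: "((\<lambda>h. flat p h / h) \<longlongrightarrow> 0) (at_right 0)"
      by (rule Lim_transform_eventually)
        (auto simp: eventually_at_right_less flat_def divide_inverse intro!: eventually_mono[OF eventually_at_right_less])
    have l: "((\<lambda>h. flat p h / h) \<longlongrightarrow> 0) (at_left 0)"
      by (rule Lim_transform_eventually[OF tendsto_const])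
        (auto simp: flat_def eventually_at_left_field intro!: exI[of _ "-1"])
    have "((\<lambda>h. flat p h / h) \<longlongrightarrow> 0) (at 0)"
      using l r by (rule filterlim_split_at)
    then show ?thesis using 3 by (simp add: has_field_derivative_iff flat_def)
  qed
qed

lemma Ck_on_flat: "Ck_on k (flat p) UNIV"
proof (induction k arbitrary: p)
  case 0
  show ?case unfolding Ck_on.simps
    by (rule DERIV_continuous_on) (use DERIV_flat in \<open>auto intro: has_field_derivative_at_within\<close>)
next
  case (Suc k)
  show ?case by (rule Ck_on_SucI_real[OF open_UNIV DERIV_flat Suc])
qed

text \<open>The threshold \<open>exp (-1)\<close> is the value of \<open>flat 1\<close> at 1. For
  |x| \<le> R the inner \<open>flat\<close> is 0 and the quotient is 1; for |x| \<ge> 2 R its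
  argument is at least 3, so the outer argument is not positive. Writing \<open>x - 0\<close> and
  multiplying by \<open>1 / R\<^sup>2\<close> matches the rules for C^k functions.\<close>

definition smooth_cutoff :: "real \<Rightarrow> 'a::euclidean_space \<Rightarrow> real" where
  "smooth_cutoff R x = flat 1 (exp (-1) - flat 1 ((norm (x - 0))\<^sup>2 * (1 / R\<^sup>2) - 1)) * (1 / flat 1 (exp (-1)))"

lemma smooth_cutoff_eq_1: "R > 0 \<Longrightarrow> norm x \<le> R \<Longrightarrow> smooth_cutoff R x = 1"
proof -
  assume R: "R > 0" "norm x \<le> R"
  then have "(norm x)\<^sup>2 \<le> R\<^sup>2" by (intro power_mono) auto
  then have "(norm x)\<^sup>2 / R\<^sup>2 \<le> 1" using R by simp
  then have "flat 1 ((norm x)\<^sup>2 / R\<^sup>2 - 1) = 0" by (simp add: flat_def)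
  moreover have "flat 1 (exp (-1)) \<noteq> 0" by (simp add: flat_def)
  ultimately show ?thesis by (simp add: smooth_cutoff_def)
qed

lemma smooth_cutoff_eq_0: "R > 0 \<Longrightarrow> norm x \<ge> 2 * R \<Longrightarrow> smooth_cutoff R x = 0"
proof -
  assume R: "R > 0" "norm x \<ge> 2 * R"
  then have "(2 * R)\<^sup>2 \<le> (norm x)\<^sup>2" by (intro power_mono) auto
  then have "4 * R\<^sup>2 \<le> (norm x)\<^sup>2" by (simp add: power_mult_distrib)
  moreover have "R\<^sup>2 > 0" using R by simp
  ultimately have "4 \<le> (norm x)\<^sup>2 / R\<^sup>2" by (simp add: pos_le_divide_eq)
  then have t: "1 \<le> (norm x)\<^sup>2 / R\<^sup>2 - 1" by simp
  then have "1 / ((norm x)\<^sup>2 / R\<^sup>2 - 1) \<le> 1" by (subst divide_le_eq_1) auto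
  then have "exp (-1) \<le> exp (- (1 / ((norm x)\<^sup>2 / R\<^sup>2 - 1)))" by simp
  with t have "exp (-1) \<le> flat 1 ((norm x)\<^sup>2 / R\<^sup>2 - 1)" unfolding flat_def by simp
  then show ?thesis by (simp add: smooth_cutoff_def) (simp add: flat_def)
qed

lemma test_function_smooth_cutoff:
  assumes "R > 0" shows "test_function UNIV (smooth_cutoff R :: 'a::euclidean_space \<Rightarrow> real)"
proof -
  have "{x::'a. smooth_cutoff R x \<noteq> 0} \<subseteq> cball 0 (2 * R)"
  proof (rule subsetI, rule ccontr)
    fix x :: 'a assume "x \<in> {x. smooth_cutoff R x \<noteq> 0}" "x \<notin> cball 0 (2 * R)"
    then show False using smooth_cutoff_eq_0[OF assms, of x] by simp
  qed
  then have "closure {x::'a. smooth_cutoff R x \<noteq> 0} \<subseteq> cball 0 (2 * R)"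
    by (rule closure_minimal) simp
  then have "compact (closure {x::'a. smooth_cutoff R x \<noteq> 0})"
    by (meson bounded_cball bounded_subset closed_closure compact_eq_bounded_closed)
  moreover have "Ck_on k (smooth_cutoff R :: 'a \<Rightarrow> real) UNIV" for k
    unfolding smooth_cutoff_def[abs_def]
    by (intro Ck_on_mult Ck_on_const Ck_on_diff Ck_on_compose[OF open_UNIV open_UNIV Ck_on_flat]
        Ck_on_norm_square open_UNIV subset_UNIV)
  ultimately show ?thesis unfolding test_function_def by simp
qed

lemma set_integrable_L2_mult:
  assumes "L2_on U (f :: _ \<Rightarrow> real)" "L2_on U g"
  shows "set_integrable lebesgue U (\<lambda>x. f x * g x)"
  using L2_on_inner[OF assms] by simp

lemma L2_on_soft_abs:
  assumes "d > 0" "L2_on U h" shows "L2_on U (\<lambda>x. soft_abs d (h x))"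
proof (rule L2_onI)
  have "soft_abs d \<in> borel_measurable borel"
    by (rule borel_measurable_continuous_onI) (rule Ck_on_continuous[OF Ck_on_soft_abs[OF assms(1)]])
  then have "(\<lambda>x. soft_abs d (indicator U x *\<^sub>R h x)) \<in> borel_measurable lebesgue"
    using assms(2) measurable_compose[of _ lebesgue borel "soft_abs d" borel]
    unfolding L2_on_def set_borel_measurable_def by blast
  also have "(\<lambda>x. soft_abs d (indicator U x *\<^sub>R h x)) = (\<lambda>x. indicator U x *\<^sub>R soft_abs d (h x))"
    using assms(1) by (auto simp: fun_eq_iff indicator_def)
  finally show "set_borel_measurable lebesgue U (\<lambda>x. soft_abs d (h x))"
    unfolding set_borel_measurable_def .
  show "set_integrable lebesgue U (\<lambda>x. (norm (h x))\<^sup>2)" using assms(2) unfolding L2_on_def by simp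
  show "(norm (soft_abs d (h x)))\<^sup>2 \<le> (norm (h x))\<^sup>2" for x
    using soft_abs_lipschitz[OF assms(1), of "h x" 0] assms(1) by (intro power_mono) auto
qed

text \<open>The weak gradient \<open>g\<close> supplied by the definition of \<open>H\<^sup>1\<^sub>0\<close> is never identified with the classical
  gradient of \<open>u\<close>: harmonicity of \<open>u\<close> enters only through \<open>\<integral> g \<bullet> \<nabla>\<Psi> = 0\<close> for
  \<open>\<Psi> = \<phi> soft_sgn(\<phi>\<^sub>n)\<close>, where \<open>\<phi>\<^sub>n\<close> are the approximating test functions.\<close>

lemma soft_abs_weakly_subharmonic:
  fixes u :: "'a::euclidean_space \<Rightarrow> real"
  assumes U: "open U" and u: "harmonic_on u U" and H: "H10 U (\<lambda>x. \<zeta> x * u x)"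
    and \<zeta>: "\<And>x. x \<in> B \<Longrightarrow> \<zeta> x = 1"
    and \<phi>: "Ckc 2 \<phi> B" "\<And>x. \<phi> x \<ge> 0" and d: "d > 0"
  shows "0 \<le> (LINT x:U|lebesgue. soft_abs d (\<zeta> x * u x) * laplacian \<phi> x)"
proof -
  define w where "w x = \<zeta> x * u x" for x
  obtain g f where w: "L2_on U w" and g: "L2_on U g" and f: "\<And>n. test_function U (f n)"
    and fw: "(\<lambda>n. L2_norm U (\<lambda>x. f n x - w x)) \<longlonglongrightarrow> 0"
    and fg: "(\<lambda>n. L2_norm U (\<lambda>x. gradient (f n) x - g x)) \<longlonglongrightarrow> 0"
    using H unfolding H10_def w_def by blast
  have f_Ckc: "Ckc k (f n) U" for k n by (rule test_function_Ckc[OF f])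
  have f_Ck: "Ck_on k (f n) UNIV" for k n using f_Ckc[of k n] unfolding Ckc_def by blast
  have f_L2: "L2_on U (f n)" for n by (rule Ckc_L2_on[OF U f_Ckc[of 0]])
  have gf_L2: "L2_on U (gradient (f n))" for n by (rule Ckc_gradient_L2_on[OF U f_Ckc[of "Suc 0"]])
  have \<phi>_Ck: "Ck_on 2 \<phi> UNIV" using \<phi>(1) unfolding Ckc_def by blast
  have \<phi>_Ck1: "Ck_on 1 \<phi> UNIV" by (rule Ck_on_le[OF \<phi>_Ck]) simp
  have \<phi>_UNIV: "Ckc 2 \<phi> UNIV" by (rule Ckc_mono[OF \<phi>(1)]) simp
  have g\<phi>_L2: "L2_on U (gradient \<phi>)"
    by (rule Ckc_gradient_L2_on[OF U, of "Suc 0" _ B]) (use \<phi>(1) in \<open>simp add: numeral_2_eq_2\<close>)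
  have l\<phi>: "Ckc 0 (laplacian \<phi>) B" by (rule Ckc_laplacian[OF \<phi>(1)])
  have l\<phi>_L2: "L2_on U (laplacian \<phi>)" by (rule Ckc_L2_on[OF U l\<phi>])
  obtain D where D: "\<And>t. (soft_sgn d has_field_derivative D t) (at t)" "\<And>t. 0 \<le> D t" "\<And>t. D t \<le> 1 / d"
    using d by (rule DERIV_soft_sgn) blast
  have "deriv (soft_abs d) = soft_sgn d"
    using DERIV_soft_abs[OF d] by (auto intro!: ext DERIV_imp_deriv)
  then have sgn_Ck: "Ck_on k (soft_sgn d) UNIV" for k
    using Ck_on_Suc_real[OF open_UNIV Ck_on_soft_abs[OF d, of "Suc k"]] by simp
  have dsgn: "deriv (soft_sgn d) t = D t" for t by (rule DERIV_imp_deriv[OF D(1)])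
  have dabs: "deriv (soft_abs d) t = soft_sgn d t" for t by (rule DERIV_imp_deriv[OF DERIV_soft_abs[OF d]])

  \<comment> \<open>\<open>P n\<close> vanishes off a compact subset of \<open>U\<close> since
    \<open>soft_sgn d 0 = 0\<close>, and off one of \<open>B\<close> since \<phi> does. The first
    makes it admissible for \<open>u\<close>, the second replaces \<zeta> u by
    \<open>u\<close>.\<close>
  define P where "P n x = \<phi> x * soft_sgn d (f n x)" for n x
  have P_U: "Ckc 2 (P n) U" for n
    unfolding P_def[abs_def]
    by (rule Ckc_mult[OF U Ck_on_subset[OF \<phi>_Ck subset_UNIV] Ckc_compose[OF sgn_Ck soft_sgn_0 f_Ckc]])
  have P_L2: "L2_on U (gradient (P n))" for n
    by (rule Ckc_gradient_L2_on[OF U, of "Suc 0" _ U]) (use P_U in \<open>simp add: numeral_2_eq_2\<close>)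
  have P_B: "Ckc 2 (P n) B" for n
  proof -
    have "Ck_on 2 (\<lambda>x. soft_sgn d (f n x)) UNIV"
      by (rule Ck_on_compose[OF open_UNIV open_UNIV sgn_Ck f_Ck subset_UNIV])
    from Ckc_mult[OF open_UNIV this Ckc_mono[OF \<phi>(1)]] have "Ck_on 2 (P n) UNIV"
      unfolding P_def[abs_def] Ckc_def by (simp add: mult.commute)
    moreover obtain K where K: "compact K" "K \<subseteq> B" "\<And>x. x \<notin> K \<Longrightarrow> \<phi> x = 0"
      using \<phi>(1) by (rule CkcE) blast
    ultimately show ?thesis by (intro CkcI[of _ _ K]) (auto simp: P_def)
  qed
  have lP_L2: "L2_on U (laplacian (P n))" for n by (rule Ckc_L2_on[OF U Ckc_laplacian[OF P_U]])

  have gP: "(LINT x:U|lebesgue. g x \<bullet> gradient (P n) x) = 0" for n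
  proof -
    \<comment> \<open>Here \<open>n\<close> is fixed and only the approximation in the first factor
      varies. Its limit expresses the pairing with \<open>g\<close> as an integral of
      \<open>u\<close> against a Laplacian, to which harmonicity applies.\<close>
    have 1: "(LINT x:U|lebesgue. f m x * laplacian (P n) x) =
        - (LINT x:U|lebesgue. gradient (f m) x \<bullet> gradient (P n) x)" for m
    proof -
      have "Ckc (Suc 0) (P n) U" by (rule Ckc_le[OF P_U]) simp
      then have "gradient (P n) x = 0" if "x \<notin> U" for x
        using that Ckc_zero[OF Ckc_partial_deriv[of 0 "P n" U]] unfolding gradient_def by simp
      then show ?thesis
        using green_first[OF U Ck_on_subset[OF f_Ck] P_U, of m n] Ckc_zero[OF f_Ckc]
        by (simp add: set_lebesgue_integral_eq_full)
    qed
    have "(\<lambda>m. LINT x:U|lebesgue. f m x * laplacian (P n) x) \<longlonglongrightarrow> (LINT x:U|lebesgue. w x * laplacian (P n) x)"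
      using L2_tendsto_inner[OF f_L2 w lP_L2 fw] by simp
    moreover have "(\<lambda>m. - (LINT x:U|lebesgue. gradient (f m) x \<bullet> gradient (P n) x))
        \<longlonglongrightarrow> - (LINT x:U|lebesgue. g x \<bullet> gradient (P n) x)"
      by (intro tendsto_minus L2_tendsto_inner[OF gf_L2 g P_L2 fg])
    ultimately have "(LINT x:U|lebesgue. w x * laplacian (P n) x) = - (LINT x:U|lebesgue. g x \<bullet> gradient (P n) x)"
      unfolding 1 by (rule LIMSEQ_unique)
    moreover have "w x * laplacian (P n) x = u x * laplacian (P n) x" for x
      using \<zeta>[of x] Ckc_zero[OF Ckc_laplacian[OF P_B], of x n] by (cases "x \<in> B") (auto simp: w_def)
    moreover have "(LINT x:U|lebesgue. u x * laplacian (P n) x) = (LINT x|lebesgue. u x * laplacian (P n) x)"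
      by (rule set_lebesgue_integral_eq_full) (simp add: Ckc_zero[OF Ckc_laplacian[OF P_U]])
    moreover have "(LINT x|lebesgue. u x * laplacian (P n) x) = (LINT x|lebesgue. laplacian u x * P n x)"
      by (rule green_second[OF U _ P_U]) (use u in \<open>simp add: harmonic_on_def\<close>)
    moreover have "laplacian u x * P n x = 0" for x
      using u Ckc_zero[OF P_U, of x n] by (cases "x \<in> U") (auto simp: harmonic_on_def)
    ultimately show ?thesis by simp
  qed

  have gradP: "gradient (P n) x = soft_sgn d (f n x) *\<^sub>R gradient \<phi> x + (\<phi> x * D (f n x)) *\<^sub>R gradient (f n) x" for n x
  proof -
    have fd: "f n differentiable (at x)" using f_Ck[of 1 n] by simp
    have \<phi>d: "\<phi> differentiable (at x)" using \<phi>_Ck1 by simp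
    have sd: "soft_sgn d differentiable (at (f n x))" using D(1) real_differentiable_def by blast
    have "partial_deriv b (P n) x = soft_sgn d (f n x) * partial_deriv b \<phi> x + \<phi> x * D (f n x) * partial_deriv b (f n) x" for b
      unfolding P_def[abs_def]
      by (subst partial_deriv_mult[OF \<phi>d differentiable_compose_real[OF sd fd]],
          subst partial_deriv_compose[OF sd fd]) (simp add: dsgn)
    then show ?thesis unfolding gradient_def by (simp add: scaleR_add_left sum.distrib scaleR_sum_right)
  qed
  have gradG: "gradient (\<lambda>x. soft_abs d (f n x)) x = soft_sgn d (f n x) *\<^sub>R gradient (f n) x" for n x
  proof -
    have fd: "f n differentiable (at x)" using f_Ck[of 1 n] by simp
    have sd: "soft_abs d differentiable (at (f n x))" using DERIV_soft_abs[OF d] real_differentiable_def by blast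
    show ?thesis unfolding gradient_def
      by (simp add: partial_deriv_compose[OF sd fd] dabs scaleR_sum_right)
  qed

  define c where "c n = (LINT x:U|lebesgue. gradient (f n) x \<bullet> gradient (P n) x)" for n
  define e where "e n = (LINT x:U|lebesgue. soft_abs d (f n x) * laplacian \<phi> x)" for n

  \<comment> \<open>By \<open>gP\<close> the field \<open>g\<close> may be subtracted from the first
    factor, so \<open>c n\<close> is at most the gradient error \<open>E n\<close> times the norm of
    the gradient of \<open>P n\<close>. That norm is bounded in terms of \<open>E n\<close>, with
    constants depending on \<open>d\<close>.\<close>
  have c_lim: "c \<longlonglongrightarrow> 0"
  proof -
    obtain C where C: "C > 0" "\<And>x. \<bar>\<phi> x\<bar> \<le> C" using \<phi>(1) by (rule Ckc_bounded) blast
    define E where "E n = L2_norm U (\<lambda>x. gradient (f n) x - g x)" for n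
    define A where "A = 2 * (L2_norm U (gradient \<phi>))\<^sup>2"
    define A' where "A' = 2 * (C / d)\<^sup>2"
    define A'' where "A'' = 2 * (L2_norm U g)\<^sup>2"
    have i: "set_integrable lebesgue U (\<lambda>x. (norm (h x))\<^sup>2)" if "L2_on U h" for h :: "'a \<Rightarrow> 'a"
      using that unfolding L2_on_def by simp
    have sq2: "(norm (a + b))\<^sup>2 \<le> 2 * (norm a)\<^sup>2 + 2 * (norm b)\<^sup>2" for a b :: 'a
    proof -
      have "(norm (a + b))\<^sup>2 \<le> (norm a + norm b)\<^sup>2" by (intro power_mono norm_triangle_ineq) simp
      then show ?thesis using sum_squares_bound[of "norm a" "norm b"] by (simp add: power2_sum)
    qed
    have gf: "(L2_norm U (gradient (f n)))\<^sup>2 \<le> 2 * (E n)\<^sup>2 + A''" for n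
    proof -
      have "(L2_norm U (gradient (f n)))\<^sup>2 \<le>
         (LINT x:U|lebesgue. 2 * (norm (gradient (f n) x - g x))\<^sup>2 + 2 * (norm (g x))\<^sup>2)"
        unfolding L2_norm_square
        by (rule set_integral_mono)
          (use sq2[of "gradient (f n) x - g x" "g x" for x] in
            \<open>auto intro!: set_integral_add set_integrable_mult_right i gf_L2 g L2_on_diff\<close>)
      also have "\<dots> = 2 * (E n)\<^sup>2 + A''"
        unfolding E_def A''_def L2_norm_square
        by (subst set_integral_add) (auto intro!: set_integrable_mult_right i gf_L2 g L2_on_diff)
      finally show ?thesis .
    qed
    have gP_bound: "(L2_norm U (gradient (P n)))\<^sup>2 \<le> A + A' * (2 * (E n)\<^sup>2 + A'')" for n
    proof -
      have "(norm (gradient (P n) x))\<^sup>2 \<le> 2 * (norm (gradient \<phi> x))\<^sup>2 + A' * (norm (gradient (f n) x))\<^sup>2" for x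
      proof -
        have "norm (soft_sgn d (f n x) *\<^sub>R gradient \<phi> x) \<le> norm (gradient \<phi> x)"
          using mult_right_mono[OF abs_soft_sgn_le] by fastforce
        then have 1: "(norm (soft_sgn d (f n x) *\<^sub>R gradient \<phi> x))\<^sup>2 \<le> (norm (gradient \<phi> x))\<^sup>2"
          by (rule power_mono) simp
        have "\<bar>\<phi> x * D (f n x)\<bar> \<le> C * (1 / d)"
          unfolding abs_mult by (rule mult_mono) (use C D in auto)
        then have "norm ((\<phi> x * D (f n x)) *\<^sub>R gradient (f n) x) \<le> C / d * norm (gradient (f n) x)"
          unfolding norm_scaleR by (intro mult_right_mono) auto
        then have "(norm ((\<phi> x * D (f n x)) *\<^sub>R gradient (f n) x))\<^sup>2 \<le> (C / d * norm (gradient (f n) x))\<^sup>2"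
          by (rule power_mono) simp
        then have "(norm ((\<phi> x * D (f n x)) *\<^sub>R gradient (f n) x))\<^sup>2 \<le> (C / d)\<^sup>2 * (norm (gradient (f n) x))\<^sup>2"
          unfolding power_mult_distrib[of "C / d"] .
        with 1 show ?thesis unfolding gradP A'_def
          using sq2[of "soft_sgn d (f n x) *\<^sub>R gradient \<phi> x" "(\<phi> x * D (f n x)) *\<^sub>R gradient (f n) x"]
          by linarith
      qed
      then have "(L2_norm U (gradient (P n)))\<^sup>2 \<le>
         (LINT x:U|lebesgue. 2 * (norm (gradient \<phi> x))\<^sup>2 + A' * (norm (gradient (f n) x))\<^sup>2)"
        unfolding L2_norm_square
        by (intro set_integral_mono) (auto intro!: set_integral_add set_integrable_mult_right i gf_L2 g\<phi>_L2 P_L2)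
      also have "\<dots> = A + A' * (L2_norm U (gradient (f n)))\<^sup>2"
        unfolding A_def L2_norm_square
        by (subst set_integral_add) (auto intro!: set_integrable_mult_right i gf_L2 g\<phi>_L2)
      also have "\<dots> \<le> A + A' * (2 * (E n)\<^sup>2 + A'')"
        using gf[of n] by (intro add_left_mono mult_left_mono) (auto simp: A'_def)
      finally show ?thesis .
    qed
    have E_lim: "E \<longlonglongrightarrow> 0" using fg unfolding E_def[abs_def] .
    have "(\<lambda>n. E n * sqrt (A + A' * (2 * (E n)\<^sup>2 + A''))) \<longlonglongrightarrow> 0 * sqrt (A + A' * (2 * 0\<^sup>2 + A''))"
      by (intro tendsto_intros E_lim)
    then have lim: "(\<lambda>n. E n * sqrt (A + A' * (2 * (E n)\<^sup>2 + A''))) \<longlonglongrightarrow> 0" by simp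
    have "\<bar>c n\<bar> \<le> E n * sqrt (A + A' * (2 * (E n)\<^sup>2 + A''))" for n
    proof -
      have "c n = (LINT x:U|lebesgue. (gradient (f n) x - g x) \<bullet> gradient (P n) x)"
        using gP[of n] unfolding c_def
        by (simp add: inner_diff_left set_integral_diff(2)[OF L2_on_inner[OF gf_L2 P_L2] L2_on_inner[OF g P_L2]])
      then have "\<bar>c n\<bar> \<le> E n * L2_norm U (gradient (P n))"
        unfolding E_def using L2_cauchy_schwarz[OF L2_on_diff[OF gf_L2 g] P_L2] by simp
      also have "\<dots> \<le> E n * sqrt (A + A' * (2 * (E n)\<^sup>2 + A''))"
        using real_le_rsqrt[OF gP_bound] by (intro mult_left_mono) (auto simp: E_def L2_norm_nonneg)
      finally show ?thesis .
    qed
    then show ?thesis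
      by (intro tendsto_rabs_zero_cancel[OF tendsto_sandwich[OF _ _ tendsto_const lim]]) auto
  qed

  \<comment> \<open>After one integration by parts, \<open>e n + c n\<close> is the integral of
    \<phi> D(f n) |grad (f n)|^2, which is nonnegative by convexity of
    \<open>soft_abs\<close>.\<close>
  have ce: "- c n \<le> e n" for n
  proof -
    have G: "Ckc 2 (\<lambda>x. soft_abs d (f n x)) U"
      by (rule Ckc_compose[OF Ck_on_soft_abs[OF d] soft_abs_0[OF d] f_Ckc])
    then have G1: "Ck_on 1 (\<lambda>x. soft_abs d (f n x)) UNIV"
      unfolding Ckc_def using Ck_on_le[of 2 _ UNIV 1] by auto
    have z: "gradient (f n) x = 0" if "x \<notin> U" for x
      using that Ckc_zero[OF Ckc_partial_deriv[OF f_Ckc]] unfolding gradient_def by simp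
    have "e n = (LINT x|lebesgue. soft_abs d (f n x) * laplacian \<phi> x)"
      unfolding e_def by (rule set_lebesgue_integral_eq_full) (simp add: Ckc_zero[OF G])
    also have "\<dots> = - (LINT x|lebesgue. gradient (\<lambda>x. soft_abs d (f n x)) x \<bullet> gradient \<phi> x)"
      by (rule green_first[OF open_UNIV G1 \<phi>_UNIV])
    also have "(LINT x|lebesgue. gradient (\<lambda>x. soft_abs d (f n x)) x \<bullet> gradient \<phi> x) =
        (LINT x:U|lebesgue. (soft_sgn d (f n x) *\<^sub>R gradient (f n) x) \<bullet> gradient \<phi> x)"
      unfolding gradG by (rule set_lebesgue_integral_eq_full[symmetric]) (simp add: z)
    finally have en: "e n = - (LINT x:U|lebesgue. (soft_sgn d (f n x) *\<^sub>R gradient (f n) x) \<bullet> gradient \<phi> x)" .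
    have "(LINT x:U|lebesgue. (soft_sgn d (f n x) *\<^sub>R gradient (f n) x) \<bullet> gradient \<phi> x) \<le> c n"
      unfolding c_def
    proof (rule set_integral_mono)
      have "L2_on U (gradient (\<lambda>x. soft_abs d (f n x)))"
        by (rule Ckc_gradient_L2_on[OF U, of "Suc 0" _ U]) (use G in \<open>simp add: numeral_2_eq_2\<close>)
      then show "set_integrable lebesgue U (\<lambda>x. (soft_sgn d (f n x) *\<^sub>R gradient (f n) x) \<bullet> gradient \<phi> x)"
        using L2_on_inner[OF _ g\<phi>_L2] unfolding gradG[abs_def] by blast
      show "set_integrable lebesgue U (\<lambda>x. gradient (f n) x \<bullet> gradient (P n) x)"
        by (rule L2_on_inner[OF gf_L2 P_L2])
      show "(soft_sgn d (f n x) *\<^sub>R gradient (f n) x) \<bullet> gradient \<phi> x \<le> gradient (f n) x \<bullet> gradient (P n) x" for x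
        using D(2)[of "f n x"] \<phi>(2)[of x] by (simp add: gradP inner_add_right)
    qed
    then show ?thesis using en by simp
  qed

  note G_L2 = L2_on_soft_abs[OF d]
  have e_lim: "e \<longlonglongrightarrow> (LINT x:U|lebesgue. soft_abs d (w x) * laplacian \<phi> x)"
  proof -
    have "(\<lambda>n. L2_norm U (\<lambda>x. soft_abs d (f n x) - soft_abs d (w x))) \<longlonglongrightarrow> 0"
    proof (rule tendsto_sandwich[OF _ _ tendsto_const fw])
      have "L2_norm U (\<lambda>x. soft_abs d (f n x) - soft_abs d (w x)) \<le> L2_norm U (\<lambda>x. f n x - w x)" for n
        unfolding L2_norm_def
      proof (intro real_sqrt_le_mono set_integral_mono)
        show "set_integrable lebesgue U (\<lambda>x. (norm (soft_abs d (f n x) - soft_abs d (w x)))\<^sup>2)"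
          "set_integrable lebesgue U (\<lambda>x. (norm (f n x - w x))\<^sup>2)"
          using L2_on_diff[OF G_L2[OF f_L2] G_L2[OF w]] L2_on_diff[OF f_L2 w] unfolding L2_on_def by auto
        show "(norm (soft_abs d (f n x) - soft_abs d (w x)))\<^sup>2 \<le> (norm (f n x - w x))\<^sup>2" for x
          using soft_abs_lipschitz[OF d] by (intro power_mono) auto
      qed
      then show "\<forall>\<^sub>F n in sequentially. L2_norm U (\<lambda>x. soft_abs d (f n x) - soft_abs d (w x)) \<le> L2_norm U (\<lambda>x. f n x - w x)"
        by simp
    qed (simp add: L2_norm_nonneg)
    from L2_tendsto_inner[OF G_L2[OF f_L2] G_L2[OF w] l\<phi>_L2 this] show ?thesis
      unfolding e_def[abs_def] by simp
  qed
  have "- 0 \<le> (LINT x:U|lebesgue. soft_abs d (w x) * laplacian \<phi> x)"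
    by (rule LIMSEQ_le[OF tendsto_minus[OF c_lim] e_lim]) (use ce in auto)
  then show ?thesis by (simp add: w_def)
qed

text \<open>Replacing \<open>soft_abs d\<close> by the absolute value costs at most \<open>d\<close>
  times the integral of the absolute value of the Laplacian of \<phi>, so the inequality survives as
  \<open>d\<close> tends to 0. Since \<phi> lives in \<open>B\<close>, the cutoff disappears from
  the integrand.\<close>

lemma abs_weakly_subharmonic:
  fixes u :: "'a::euclidean_space \<Rightarrow> real"
  assumes U: "open U" and u: "harmonic_on u U" and H: "H10 U (\<lambda>x. \<zeta> x * u x)"
    and \<zeta>: "\<And>x. x \<in> B \<Longrightarrow> \<zeta> x = 1"
    and \<phi>: "Ckc 2 \<phi> B" "\<And>x. \<phi> x \<ge> 0"
  shows "0 \<le> (LINT x|lebesgue. (indicator (U \<inter> B) x * \<bar>u x\<bar>) * laplacian \<phi> x)"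
proof -
  define w where "w x = \<zeta> x * u x" for x
  have w: "L2_on U w" using H unfolding H10_def w_def by blast
  have l\<phi>: "Ckc 0 (laplacian \<phi>) B" by (rule Ckc_laplacian[OF \<phi>(1)])
  have l\<phi>_L2: "L2_on U (laplacian \<phi>)" by (rule Ckc_L2_on[OF U l\<phi>])
  have Us: "U \<in> sets lebesgue" using U by auto
  have aw: "L2_on U (\<lambda>x. \<bar>w x\<bar>)"
  proof -
    have "(\<lambda>x. \<bar>indicator U x *\<^sub>R w x\<bar>) \<in> borel_measurable lebesgue"
      using w unfolding L2_on_def set_borel_measurable_def by (intro borel_measurable_abs) simp
    also have "(\<lambda>x. \<bar>indicator U x *\<^sub>R w x\<bar>) = (\<lambda>x. indicator U x *\<^sub>R \<bar>w x\<bar>)"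
      by (auto simp: fun_eq_iff indicator_def)
    finally show ?thesis using w unfolding L2_on_def set_borel_measurable_def by simp
  qed
  have int: "set_integrable lebesgue U (\<lambda>x. \<bar>w x\<bar> * laplacian \<phi> x)"
    by (rule set_integrable_L2_mult[OF aw l\<phi>_L2])
  define I where "I = (LINT x:U|lebesgue. \<bar>w x\<bar> * laplacian \<phi> x)"
  define A where "A = (LINT x:U|lebesgue. \<bar>laplacian \<phi> x\<bar>)"
  have il: "set_integrable lebesgue U (laplacian \<phi>)"
    unfolding set_integrable_def using Ckc_integrable[OF l\<phi>] Us integrable_mult_indicator by blast
  have ila: "set_integrable lebesgue U (\<lambda>x. \<bar>laplacian \<phi> x\<bar>)"
    using set_integrable_abs[OF il] .
  have A: "A \<ge> 0" unfolding A_def set_lebesgue_integral_def by (rule Bochner_Integration.integral_nonneg) simp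
  have "I \<ge> - (d * A)" if d: "d > 0" for d
  proof -
    have "0 \<le> (LINT x:U|lebesgue. soft_abs d (w x) * laplacian \<phi> x)"
      unfolding w_def using soft_abs_weakly_subharmonic[OF U u H \<zeta> \<phi> d] by simp
    also have "\<dots> \<le> (LINT x:U|lebesgue. \<bar>w x\<bar> * laplacian \<phi> x + d * \<bar>laplacian \<phi> x\<bar>)"
    proof (rule set_integral_mono)
      show "set_integrable lebesgue U (\<lambda>x. \<bar>w x\<bar> * laplacian \<phi> x + d * \<bar>laplacian \<phi> x\<bar>)"
        by (intro set_integral_add set_integrable_mult_right int) (use ila in auto)
      have "(soft_abs d (w x) - \<bar>w x\<bar>) * laplacian \<phi> x \<le> d * \<bar>laplacian \<phi> x\<bar>" for x
      proof -
        have "(soft_abs d (w x) - \<bar>w x\<bar>) * laplacian \<phi> x \<le> \<bar>soft_abs d (w x) - \<bar>w x\<bar>\<bar> * \<bar>laplacian \<phi> x\<bar>"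
          by (metis abs_ge_self abs_mult)
        also have "\<dots> \<le> d * \<bar>laplacian \<phi> x\<bar>"
          using abs_diff_soft_abs_le[OF d, of "w x"] by (intro mult_right_mono) auto
        finally show ?thesis .
      qed
      then show "soft_abs d (w x) * laplacian \<phi> x \<le> \<bar>w x\<bar> * laplacian \<phi> x + d * \<bar>laplacian \<phi> x\<bar>" for x
        by (simp add: algebra_simps)
      show "set_integrable lebesgue U (\<lambda>x. soft_abs d (w x) * laplacian \<phi> x)"
        by (rule set_integrable_L2_mult[OF L2_on_soft_abs[OF d w] l\<phi>_L2])
    qed
    also have "\<dots> = I + d * A"
      unfolding I_def A_def by (subst set_integral_add) (use int ila in auto)
    finally show ?thesis by simp
  qed
  then have "I \<ge> 0"
  proof -
    have "((\<lambda>d. - (d * A)) \<longlongrightarrow> - (0 * A)) (at_right 0)" by (intro tendsto_intros)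
    moreover have "eventually (\<lambda>d. - (d * A) \<le> I) (at_right 0)"
      using \<open>\<And>d. d > 0 \<Longrightarrow> I \<ge> - (d * A)\<close> by (auto simp: eventually_at_right_field intro!: exI[of _ 1])
    ultimately have "- (0 * A) \<le> I" by (intro tendsto_upperbound) auto
    then show ?thesis by simp
  qed
  also have "I = (LINT x|lebesgue. (indicator (U \<inter> B) x * \<bar>u x\<bar>) * laplacian \<phi> x)"
    unfolding I_def set_lebesgue_integral_def
  proof (rule Bochner_Integration.integral_cong[OF refl])
    show "indicator U x *\<^sub>R (\<bar>w x\<bar> * laplacian \<phi> x) = indicator (U \<inter> B) x * \<bar>u x\<bar> * laplacian \<phi> x" for x
      using \<zeta>[of x] Ckc_zero[OF l\<phi>, of x] by (cases "x \<in> B") (auto simp: w_def indicator_def)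
  qed
  finally show ?thesis .
qed

section \<open>Weighted averages of subharmonic functions\<close>

lemma DERIV_piecewise:
  fixes f g :: "real \<Rightarrow> real"
  assumes f: "(f has_field_derivative D) (at a)" and g: "(g has_field_derivative D) (at a)" and "f a = g a"
  shows "((\<lambda>x. if x \<le> a then f x else g x) has_field_derivative D) (at a)"
proof -
  let ?h = "\<lambda>x. if x \<le> a then f x else g x"
  have f': "((\<lambda>y. (f y - f a) / (y - a)) \<longlongrightarrow> D) (at_left a)"
    and g': "((\<lambda>y. (g y - g a) / (y - a)) \<longlongrightarrow> D) (at_right a)"
    using f g by (auto simp: has_field_derivative_iff filterlim_at_split)
  have "((\<lambda>y. (?h y - ?h a) / (y - a)) \<longlongrightarrow> D) (at_left a)"
    by (rule Lim_transform_eventually[OF f']) (auto simp: eventually_at_filter)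
  moreover have "((\<lambda>y. (?h y - ?h a) / (y - a)) \<longlongrightarrow> D) (at_right a)"
    by (rule Lim_transform_eventually[OF g']) (auto simp: eventually_at_filter assms(3))
  ultimately show ?thesis by (simp add: has_field_derivative_iff filterlim_at_split)
qed

lemma DERIV_piecewise_everywhere:
  fixes f g f' g' :: "real \<Rightarrow> real"
  assumes f: "\<And>x. x \<le> a \<Longrightarrow> (f has_field_derivative f' x) (at x)"
    and g: "\<And>x. x \<ge> a \<Longrightarrow> (g has_field_derivative g' x) (at x)" and eq: "f a = g a" "f' a = g' a"
  shows "((\<lambda>x. if x \<le> a then f x else g x) has_field_derivative (if x \<le> a then f' x else g' x)) (at x)"
proof -
  consider "x < a" | "x > a" | "x = a" by linarith
  then show ?thesis
  proof cases
    case 1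
    show ?thesis
      by (rule has_field_derivative_transform_within_open[of f _ x "{..<a}"]) (use 1 f[of x] in auto)
  next
    case 2
    show ?thesis
      by (rule has_field_derivative_transform_within_open[of g _ x "{a<..}"]) (use 2 g[of x] in auto)
  next
    case 3
    show ?thesis
      using DERIV_piecewise[of f "f' a" a g] f[of a] g[of a] eq 3 by simp
  qed
qed

text \<open>Up to additive constants, the logarithmic potential in the plane of the weight \<open>bump 1\<close> below,
  as a function of the squared distance.\<close>

definition potential :: "real \<Rightarrow> real" where
  "potential s = (if s \<le> 1 then (s - 1)\<^sup>2 / 4 - (s - 1) / 2 else - ln s / 2)"

definition potential' :: "real \<Rightarrow> real" where
  "potential' s = (if s \<le> 1 then (s - 2) / 2 else - 1 / (2 * s))"

definition potential'' :: "real \<Rightarrow> real" where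
  "potential'' s = (if s \<le> 1 then 1 / 2 else 1 / (2 * s\<^sup>2))"

lemma DERIV_potential: "(potential has_field_derivative potential' s) (at s)"
  unfolding potential_def[abs_def] potential'_def
  by (rule DERIV_piecewise_everywhere)
    (auto intro!: derivative_eq_intros simp: field_simps)

lemma DERIV_potential': "(potential' has_field_derivative potential'' s) (at s)"
  unfolding potential'_def[abs_def] potential''_def
  by (rule DERIV_piecewise_everywhere)
    (auto intro!: derivative_eq_intros simp: field_simps power2_eq_square)

lemma continuous_potential'': "continuous_on UNIV potential''"
proof -
  have "continuous_on ({..1} \<union> {1..}) (\<lambda>s::real. if s \<le> 1 then 1 / 2 else 1 / (2 * s\<^sup>2))"
    by (rule continuous_on_If) (auto intro!: continuous_intros)
  moreover have "{..1} \<union> {1..} = (UNIV :: real set)" by auto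
  ultimately show ?thesis unfolding potential''_def[abs_def] by simp
qed

text \<open>Continuity is all that a C^2 potential requires of the weight. The factor
  \<open>1 / r\<^sup>2\<close> makes its integral independent of \<open>r\<close> in dimension
  two.\<close>

definition bump :: "real \<Rightarrow> 'a::euclidean_space \<Rightarrow> real" where
  "bump r x = max 0 (1 - (norm x)\<^sup>2 / r\<^sup>2) / r\<^sup>2"

text \<open>In the plane the Laplacian of f(|x|^2) is 4 (s f'(s))' at s = |x|^2: it is 0 for the
  logarithm and -4 (1 - s) for the quadratic branch of \<open>potential\<close>. The added
  logarithmic constants undo the rescaling, so that the two potentials agree outside the larger
  disc.\<close>

lemma laplacian_potential:
  fixes p :: "'a::euclidean_space"
  assumes "DIM('a) = 2" "r > 0" "e > 0"
  defines "\<phi> \<equiv> (\<lambda>x::'a. potential ((norm (x - p))\<^sup>2 / e\<^sup>2) + ln (1 / e\<^sup>2) / 2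
     - (potential ((norm (x - p))\<^sup>2 / r\<^sup>2) + ln (1 / r\<^sup>2) / 2))"
  shows "Ck_on 2 \<phi> UNIV" "laplacian \<phi> x = 4 * bump r (x - p) - 4 * bump e (x - p)"
proof -
  define f where "f s = potential (s / e\<^sup>2) + ln (1 / e\<^sup>2) / 2 - (potential (s / r\<^sup>2) + ln (1 / r\<^sup>2) / 2)" for s
  define f' where "f' s = potential' (s / e\<^sup>2) / e\<^sup>2 - potential' (s / r\<^sup>2) / r\<^sup>2" for s
  define f'' where "f'' s = potential'' (s / e\<^sup>2) / e\<^sup>2 / e\<^sup>2 - potential'' (s / r\<^sup>2) / r\<^sup>2 / r\<^sup>2" for s
  have sc: "((\<lambda>s. s / c) has_field_derivative 1 / c) (at s)" for c s :: real
    using DERIV_cdivide[OF DERIV_ident] .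
  have ch: "((\<lambda>s. P (s / c)) has_field_derivative P' (s / c) / c) (at s)"
    if "\<And>t. (P has_field_derivative P' t) (at t)" for P P' and c s :: real
    using DERIV_chain2[OF that sc] by simp
  have d1: "(f has_field_derivative f' s) (at s)" for s
    unfolding f_def f'_def using ch[OF DERIV_potential, of "e\<^sup>2" s] ch[OF DERIV_potential, of "r\<^sup>2" s]
    by (auto intro!: derivative_eq_intros)
  have d2: "(f' has_field_derivative f'' s) (at s)" for s
    unfolding f'_def f''_def
    by (intro DERIV_diff DERIV_cdivide ch DERIV_potential')
  have c: "continuous_on UNIV f''"
    unfolding f''_def[abs_def]
    by (intro continuous_intros continuous_on_compose2[OF continuous_potential'']) (use assms in auto)
  have "Ck_on (Suc (Suc 0)) f UNIV"
    by (rule Ck_on_SucI_real[OF open_UNIV d1 Ck_on_SucI_real[OF open_UNIV d2]]) (simp add: c)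
  then have fC: "Ck_on 2 f UNIV" by (simp only: numeral_2_eq_2)
  have \<phi>: "\<phi> = (\<lambda>x. f ((norm (x - p))\<^sup>2))" unfolding \<phi>_def f_def ..
  show "Ck_on 2 \<phi> UNIV" unfolding \<phi>
    by (rule Ck_on_compose[OF open_UNIV open_UNIV fC Ck_on_norm_square subset_UNIV])
  have D1: "deriv f = f'" using d1 by (auto intro!: ext DERIV_imp_deriv)
  have D2: "deriv f' = f''" using d2 by (auto intro!: ext DERIV_imp_deriv)
  define q where "q = (norm (x - p))\<^sup>2"
  have "laplacian \<phi> x = 4 * f' q + 4 * q * f'' q"
    unfolding \<phi> q_def using laplacian_radial[OF open_UNIV _ fC open_UNIV, of x p] assms(1)
    by (simp add: D1 D2)
  moreover have "4 * (potential' (q / c) / c) + 4 * q * (potential'' (q / c) / c / c) = - 4 * (max 0 (1 - q / c) / c)"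
    if "c > 0" for c
  proof (cases "q / c \<le> 1")
    case True
    then show ?thesis using that unfolding potential'_def potential''_def
      by (simp add: max_def field_simps)
  next
    case False
    then have "q > 0" using that by (metis divide_nonpos_pos linorder_not_le order_trans zero_le_one)
    with False show ?thesis using that unfolding potential'_def potential''_def
      by (simp add: max_def field_simps power2_eq_square)
  qed
  from this[of "e\<^sup>2"] this[of "r\<^sup>2"]
  have "4 * f' q + 4 * q * f'' q = 4 * bump r (x - p) - 4 * bump e (x - p)"
    unfolding f'_def f''_def bump_def q_def[symmetric] using assms by (simp add: algebra_simps)
  ultimately show "laplacian \<phi> x = 4 * bump r (x - p) - 4 * bump e (x - p)" by simp
qed

text \<open>Here \<open>c\<close> stands for 1/r^2. The derivative in \<open>c\<close>, multiplied
  by \<open>c\<close>, is (1 - s)^2 / 2 for s = q c \<le> 1 and 0 beyond: concentrating the weight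
  raises the potential, and only inside the disc.\<close>

lemma potential_mono:
  assumes "0 \<le> q" "0 < c" "c \<le> c'"
  shows "potential (q * c) + ln c / 2 \<le> potential (q * c') + ln c' / 2"
proof (rule DERIV_nonneg_imp_nondecreasing[OF assms(3)])
  fix t assume "c \<le> t" "t \<le> c'"
  then have t: "t > 0" using assms by simp
  have "((\<lambda>c. potential (q * c) + ln c / 2) has_field_derivative potential' (q * t) * q + 1 / t / 2) (at t)"
    using DERIV_chain2[OF DERIV_potential, of "\<lambda>c. q * c" q t UNIV] t
    by (auto intro!: derivative_eq_intros)
  moreover have "potential' (q * t) * q + 1 / t / 2 \<ge> 0"
  proof -
    have "t * (potential' (q * t) * q + 1 / t / 2) = potential' (q * t) * (q * t) + 1 / 2"
      using t by (simp add: field_simps)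
    also have "\<dots> \<ge> 0"
    proof (cases "q * t \<le> 1")
      case True
      have "potential' (q * t) * (q * t) + 1 / 2 = (q * t - 1)\<^sup>2 / 2"
        using True by (simp add: potential'_def power2_eq_square field_simps)
      then show ?thesis by (simp only: zero_le_power2 divide_nonneg_nonneg zero_le_numeral)
    next
      case False
      then show ?thesis by (simp add: potential'_def)
    qed
    finally show ?thesis using t by (simp add: zero_le_mult_iff)
  qed
  ultimately show "\<exists>y. ((\<lambda>c. potential (q * c) + ln c / 2) has_real_derivative y) (at t) \<and> 0 \<le> y" by blast
qed

section \<open>Averages against the weight\<close>

lemma bump_nonneg: "0 \<le> bump r x"
  by (simp add: bump_def)

lemma bump_le: "bump r x \<le> 1 / r\<^sup>2"
  unfolding bump_def by (rule divide_right_mono) auto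

lemma abs_bump_le: "\<bar>bump r x\<bar> \<le> 1 / r\<^sup>2"
  using bump_nonneg[of r x] bump_le[of r x] by simp

lemma continuous_bump: "r > 0 \<Longrightarrow> continuous_on UNIV (\<lambda>x. bump r (x - p))"
  unfolding bump_def by (intro continuous_intros) auto

lemma bump_zero: "r > 0 \<Longrightarrow> x \<notin> cball p r \<Longrightarrow> bump r (x - p) = 0"
proof -
  assume r: "r > 0" "x \<notin> cball p r"
  then have "r \<le> norm (x - p)" by (simp add: dist_norm norm_minus_commute)
  then have "r\<^sup>2 \<le> (norm (x - p))\<^sup>2" using r by (intro power_mono) auto
  then show ?thesis using r by (simp add: bump_def max_def)
qed

lemma Ckc_bump: "r > 0 \<Longrightarrow> cball p r \<subseteq> S \<Longrightarrow> Ckc 0 (\<lambda>x. bump r (x - p)) S"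
  by (rule CkcI[of _ _ "cball p r"]) (use bump_zero continuous_bump in auto)

lemma integral_affine:
  fixes f :: "'a::euclidean_space \<Rightarrow> real"
  assumes "r > 0" "continuous_on UNIV f"
  shows "(LINT x|lebesgue. f x) = r ^ DIM('a) * (LINT x|lebesgue. f (p + r *\<^sub>R x))"
proof -
  have m: "f \<in> borel_measurable borel" by (rule borel_measurable_continuous_onI[OF assms(2)])
  have c: "continuous_on UNIV (\<lambda>x. f (p + r *\<^sub>R x))"
    by (rule continuous_on_compose2[OF assms(2)]) (auto intro!: continuous_intros)
  have m2: "(\<lambda>x. f (p + r *\<^sub>R x)) \<in> borel_measurable borel"
    by (rule borel_measurable_continuous_onI[OF c])
  have "(LINT x|lebesgue. f x) = (LINT x|lborel. f x)"
    using integral_completion[of f lborel] m by simp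
  also have "\<dots> = (LINT x|density (distr lborel borel (\<lambda>x. p + r *\<^sub>R x)) (\<lambda>_. ennreal (\<bar>r\<bar> ^ DIM('a))). f x)"
    using lborel_affine[of r p] assms(1) by simp
  also have "\<dots> = (LINT x|distr lborel borel (\<lambda>x. p + r *\<^sub>R x). \<bar>r\<bar> ^ DIM('a) * f x)"
    by (subst integral_density) (use m in auto)
  also have "\<dots> = (LINT x|lborel. \<bar>r\<bar> ^ DIM('a) * f (p + r *\<^sub>R x))"
    by (rule integral_distr) (use m in auto)
  also have "\<dots> = r ^ DIM('a) * (LINT x|lebesgue. f (p + r *\<^sub>R x))"
    using integral_completion[of "\<lambda>x. f (p + r *\<^sub>R x)" lborel] m2 assms(1) by simp
  finally show ?thesis .
qed

lemma integral_Ckc_pos: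
  fixes f :: "'a::euclidean_space \<Rightarrow> real"
  assumes f: "Ckc 0 f U" "\<And>x. 0 \<le> f x" "0 < f p"
  shows "0 < (LINT x|lebesgue. f x)"
proof -
  have "continuous (at p) f"
    using Ckc_continuous[OF f(1)] by (simp add: continuous_on_eq_continuous_at)
  then obtain d where d: "d > 0" "\<And>x. dist x p < d \<Longrightarrow> dist (f x) (f p) < f p / 2"
    using f(3) unfolding continuous_at_eps_delta by (metis half_gt_zero)
  have "f x \<ge> indicator (ball p d) x * (f p / 2)" for x
  proof (cases "x \<in> ball p d")
    case True
    then have "\<bar>f x - f p\<bar> < f p / 2" using d(2)[of x] by (simp add: dist_commute[of x p] dist_real_def)
    then have "f p / 2 \<le> f x" unfolding abs_less_iff by linarith
    then show ?thesis using True by simp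
  qed (use f(2) in simp)
  moreover have "integrable lebesgue (\<lambda>x. indicator (ball p d) x * (f p / 2))"
    by (intro integrable_mult_left integrable_real_indicator) (use emeasure_bounded_finite[OF bounded_ball, of p d] in auto)
  ultimately have "(LINT x|lebesgue. indicator (ball p d) x * (f p / 2)) \<le> (LINT x|lebesgue. f x)"
    by (intro Bochner_Integration.integral_mono Ckc_integrable[OF f(1)]) auto
  moreover have "(LINT x|lebesgue. indicator (ball p d) x * (f p / 2)) = measure lebesgue (ball p d) * (f p / 2)"
    by simp
  moreover have "measure lebesgue (ball p d) > 0" using content_ball_pos[OF d(1)] by simp
  ultimately show ?thesis using f(3) by (smt (verit) mult_pos_pos half_gt_zero)
qed

definition bump_mass :: "'a::euclidean_space itself \<Rightarrow> real" where
  "bump_mass _ = (LINT x|lebesgue. bump 1 (x :: 'a))"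

lemma bump_mass_pos: "0 < bump_mass TYPE('a::euclidean_space)"
  unfolding bump_mass_def
  using integral_Ckc_pos[OF Ckc_bump[of 1 0 UNIV], of 0] by (simp add: bump_nonneg) (simp add: bump_def)

lemma bump_scale: "r > 0 \<Longrightarrow> bump r (r *\<^sub>R x) = bump 1 x / r\<^sup>2"
  by (simp add: bump_def power_mult_distrib)

lemma integral_bump:
  assumes "DIM('a::euclidean_space) = 2" "r > 0"
  shows "(LINT x|lebesgue. bump r (x - p :: 'a)) = bump_mass TYPE('a)"
  using integral_affine[OF assms(2) continuous_bump[OF assms(2)], of p p] assms
  by (simp add: bump_scale bump_mass_def)

definition wavg :: "real \<Rightarrow> ('a::euclidean_space \<Rightarrow> real) \<Rightarrow> 'a \<Rightarrow> real" where
  "wavg r f p = (LINT x|lebesgue. f x * bump r (x - p)) / bump_mass TYPE('a)"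

lemma integrable_bump_cmult: "r > 0 \<Longrightarrow> integrable lebesgue (\<lambda>x. c * bump r (x - p))"
  by (rule integrable_mult_right[OF Ckc_integrable[OF Ckc_bump[of r p UNIV]]]) auto

lemma wavg_mono:
  fixes p :: "'a::euclidean_space"
  assumes "r > 0" "integrable lebesgue (\<lambda>x. f x * bump r (x - p))"
    "integrable lebesgue (\<lambda>x. g x * bump r (x - p))"
    "\<And>x. x \<in> cball p r \<Longrightarrow> f x \<le> g x"
  shows "wavg r f p \<le> wavg r g p"
  unfolding wavg_def
proof (rule divide_right_mono[OF Bochner_Integration.integral_mono[OF assms(2,3)]])
  show "f x * bump r (x - p) \<le> g x * bump r (x - p)" for x
    using assms(4)[of x] bump_zero[OF assms(1), of x p] bump_nonneg[of r "x - p"]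
    by (cases "x \<in> cball p r") (auto intro: mult_right_mono)
qed (use bump_mass_pos[where 'a='a] in simp)

lemma wavg_const:
  assumes "DIM('a::euclidean_space) = 2" "r > 0"
  shows "wavg r (\<lambda>_. c) (p :: 'a) = c"
  unfolding wavg_def using integral_bump[OF assms, of p] bump_mass_pos[where 'a='a] by simp

lemma wavg_diff:
  assumes "integrable lebesgue (\<lambda>x. f x * bump r (x - p))"
    "integrable lebesgue (\<lambda>x. g x * bump r (x - p))"
  shows "wavg r (\<lambda>x. f x - g x) p = wavg r f p - wavg r g p"
  unfolding wavg_def by (simp add: left_diff_distrib diff_divide_distrib assms)

lemma wavg_cmult: "wavg r (\<lambda>x. c * f x) p = c * wavg r f p"
  unfolding wavg_def by (simp add: mult.assoc)

lemma integrable_mult_bump: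
  fixes w :: "'a::euclidean_space \<Rightarrow> real"
  assumes "integrable lebesgue w" "r > 0"
  shows "integrable lebesgue (\<lambda>x. w x * bump r (x - p))"
proof (rule Bochner_Integration.integrable_bound[of _ "\<lambda>x. w x * (1 / r\<^sup>2)"])
  show "(\<lambda>x. w x * bump r (x - p)) \<in> borel_measurable lebesgue"
    by (intro borel_measurable_times borel_measurable_integrable[OF assms(1)]
        borel_measurable_lebesgue_continuous continuous_bump assms(2))
  show "AE x in lebesgue. norm (w x * bump r (x - p)) \<le> norm (w x * (1 / r\<^sup>2))"
    by (intro AE_I2) (simp only: norm_mult, intro mult_left_mono, 
      use abs_bump_le in auto)
qed (use assms(1) in auto)

lemma continuous_wavg:
  fixes w :: "'a::euclidean_space \<Rightarrow> real"
  assumes "integrable lebesgue w" "r > 0"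
  shows "continuous_on UNIV (wavg r w)"
  unfolding continuous_on_sequentially comp_def
proof (intro ballI allI impI)
  fix X p assume X: "(\<forall>n. X n \<in> UNIV) \<and> X \<longlonglongrightarrow> (p :: 'a)"
  have "(\<lambda>n. LINT x|lebesgue. w x * bump r (x - X n)) \<longlonglongrightarrow> (LINT x|lebesgue. w x * bump r (x - p))"
  proof (rule integral_dominated_convergence[of _ _ _ "\<lambda>x. norm (w x * (1 / r\<^sup>2))"])
    show "(\<lambda>x. w x * bump r (x - p)) \<in> borel_measurable lebesgue"
      "\<And>n. (\<lambda>x. w x * bump r (x - X n)) \<in> borel_measurable lebesgue"
      using integrable_mult_bump[OF assms] by (auto dest: borel_measurable_integrable)
    show "integrable lebesgue (\<lambda>x. norm (w x * (1 / r\<^sup>2)))"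
      by (intro integrable_norm integrable_mult_left assms)
    show "AE x in lebesgue. norm (w x * bump r (x - X n)) \<le> norm (w x * (1 / r\<^sup>2))" for n
      by (intro AE_I2) (simp only: norm_mult, intro mult_left_mono, 
        use abs_bump_le in auto)
    have "continuous_on UNIV (\<lambda>p. bump r (x - p))" for x :: 'a
      unfolding bump_def using assms(2) by (intro continuous_intros) auto
    then have "(\<lambda>n. bump r (x - X n)) \<longlonglongrightarrow> bump r (x - p)" for x
      using X continuous_on_tendsto_compose[of UNIV "\<lambda>p. bump r (x - p)" X p sequentially] by auto
    then show "AE x in lebesgue. (\<lambda>n. w x * bump r (x - X n)) \<longlonglongrightarrow> w x * bump r (x - p)"
      by (intro AE_I2 tendsto_mult tendsto_const)
  qed
  then show "(\<lambda>n. wavg r w (X n)) \<longlonglongrightarrow> wavg r w p"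
    unfolding wavg_def by (intro tendsto_divide tendsto_const) (use bump_mass_pos[where 'a='a] in auto)
qed

text \<open>The difference of the potentials at the scales \<open>e\<close> and \<open>r\<close>
  vanishes off the larger ball, is nonnegative by monotonicity in the scale, and equals ln (r / e)
  at the centre. Testing against it compares the two averages.\<close>

lemma potential_difference_test:
  fixes p :: "'a::euclidean_space"
  assumes dim: "DIM('a) = 2" and r: "0 < e" "e < r" and S: "cball p r \<subseteq> S"
  shows "\<exists>\<phi>. Ckc 2 \<phi> S \<and> (\<forall>x. \<phi> x \<ge> 0) \<and> \<phi> p > 0 \<and>
    (\<forall>x. laplacian \<phi> x = 4 * bump r (x - p) - 4 * bump e (x - p))"
proof -
  define \<phi> where "\<phi> x = potential ((norm (x - p))\<^sup>2 / e\<^sup>2) + ln (1 / e\<^sup>2) / 2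
     - (potential ((norm (x - p))\<^sup>2 / r\<^sup>2) + ln (1 / r\<^sup>2) / 2)" for x
  have e2: "0 < e\<^sup>2" "e\<^sup>2 < r\<^sup>2" using r by (auto intro: power_strict_mono)
  have 1: "Ck_on 2 \<phi> UNIV" "\<And>x. laplacian \<phi> x = 4 * bump r (x - p) - 4 * bump e (x - p)"
    using laplacian_potential[OF dim, of r e p] r unfolding \<phi>_def[abs_def] by auto
  have 2: "\<phi> x \<ge> 0" for x
    using potential_mono[of "(norm (x - p))\<^sup>2" "1 / r\<^sup>2" "1 / e\<^sup>2"] e2 r
    by (simp add: \<phi>_def frac_le)
  have "\<phi> p = (ln (r\<^sup>2) - ln (e\<^sup>2)) / 2"
    using e2 by (simp add: \<phi>_def ln_div)
  moreover have "ln (e\<^sup>2) < ln (r\<^sup>2)" using e2 by (subst ln_less_cancel_iff) linarith+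
  ultimately have 3: "\<phi> p > 0" by (metis diff_gt_0_iff_gt half_gt_zero)
  have 4: "\<phi> x = 0" if "x \<notin> cball p r" for x
  proof -
    have "r < norm (x - p)" using that by (simp add: dist_norm norm_minus_commute)
    then have "r\<^sup>2 < (norm (x - p))\<^sup>2" using r by (intro power_strict_mono) auto
    then obtain q where q: "q = (norm (x - p))\<^sup>2" "r\<^sup>2 < q" by simp
    have "q > 0" "r\<^sup>2 > 0" using q(2) e2 by linarith+
    moreover have "\<not> q / e\<^sup>2 \<le> 1" "\<not> q / r\<^sup>2 \<le> 1" using q(2) e2 \<open>r\<^sup>2 > 0\<close> by (simp_all add: divide_le_eq)
    ultimately show ?thesis using e2(1) unfolding \<phi>_def q(1)[symmetric] potential_def
      by (simp add: ln_div diff_divide_distrib del: zero_less_power2)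
  qed
  have "Ckc 2 \<phi> S" by (rule CkcI[OF 1(1) compact_cball S 4])
  with 2 3 1(2) show ?thesis by blast
qed

section \<open>Weak subharmonicity and sub-mean inequalities\<close>

definition weakly_subharmonic :: "'a::euclidean_space set \<Rightarrow> ('a \<Rightarrow> real) \<Rightarrow> bool" where
  "weakly_subharmonic S w \<longleftrightarrow>
     (\<forall>\<phi>. Ckc 2 \<phi> S \<longrightarrow> (\<forall>x. \<phi> x \<ge> 0) \<longrightarrow> 0 \<le> (LINT x|lebesgue. w x * laplacian \<phi> x))"

lemma wavg_mono_radius:
  fixes p :: "'a::euclidean_space"
  assumes dim: "DIM('a) = 2" and w: "weakly_subharmonic S w"
    and i: "\<And>s. 0 < s \<Longrightarrow> s \<le> r \<Longrightarrow> integrable lebesgue (\<lambda>x. w x * bump s (x - p))"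
    and r: "0 < e" "e < r" and S: "cball p r \<subseteq> S"
  shows "wavg e w p \<le> wavg r w p"
proof -
  obtain \<phi> where \<phi>: "Ckc 2 \<phi> S" "\<And>x. \<phi> x \<ge> 0" "\<phi> p > 0"
    "\<And>x. laplacian \<phi> x = 4 * bump r (x - p) - 4 * bump e (x - p)"
    using potential_difference_test[OF dim r S] by (elim exE conjE) simp
  have "0 \<le> (LINT x|lebesgue. w x * laplacian \<phi> x)"
    using w \<phi>(1,2) unfolding weakly_subharmonic_def by blast
  also have "\<dots> = (LINT x|lebesgue. 4 * (w x * bump r (x - p)) - 4 * (w x * bump e (x - p)))"
    unfolding \<phi>(4) by (simp add: algebra_simps)
  also have "\<dots> = 4 * (LINT x|lebesgue. w x * bump r (x - p)) - 4 * (LINT x|lebesgue. w x * bump e (x - p))"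
    using i[of r] i[of e] r by (subst Bochner_Integration.integral_diff) auto
  finally show ?thesis
    unfolding wavg_def using bump_mass_pos[where 'a='a] by (simp add: divide_right_mono)
qed

text \<open>Averages increase with the radius, and over small balls they are nearly at least the
  value at \<open>p\<close>. Continuity at the single point \<open>p\<close> is the only pointwise
  information used.\<close>

lemma submean_property:
  fixes p :: "'a::euclidean_space"
  assumes dim: "DIM('a) = 2" and w: "weakly_subharmonic S w"
    and i: "\<And>s. 0 < s \<Longrightarrow> s \<le> r \<Longrightarrow> integrable lebesgue (\<lambda>x. w x * bump s (x - p))"
    and r: "0 < r" and S: "cball p r \<subseteq> S" and c: "isCont w p"
  shows "w p \<le> wavg r w p"
proof (rule field_le_epsilon)
  fix \<eta> :: real assume "\<eta> > 0"
  then obtain d where d: "d > 0" "\<And>x. dist x p < d \<Longrightarrow> dist (w x) (w p) < \<eta>"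
    using c unfolding continuous_at_eps_delta by metis
  define e where "e = min (d / 2) (r / 2)"
  have e: "0 < e" "e < r" "e < d" using d(1) r by (auto simp: e_def)
  have "w p - \<eta> = wavg e (\<lambda>_. w p - \<eta>) p" using wavg_const[OF dim e(1)] by simp
  also have "\<dots> \<le> wavg e w p"
  proof (rule wavg_mono[OF e(1) integrable_bump_cmult[OF e(1)] i])
    fix x assume "x \<in> cball p e"
    then have "dist x p < d" using e by (simp add: dist_commute)
    from d(2)[OF this] show "w p - \<eta> \<le> w x" by (simp add: dist_real_def)
  qed (use e in auto)
  also have "\<dots> \<le> wavg r w p" by (rule wavg_mono_radius[OF dim w i e(1,2) S])
  finally show "w p \<le> wavg r w p + \<eta>" by simp
qed

text \<open>The gain between the radii \<open>r / 2\<close> and \<open>r\<close> is a positive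
  multiple of the integral of the Laplacian of \<open>h\<close> against the potential difference,
  whose integrand is nonnegative and positive at \<open>p\<close>. From the point to radius
  \<open>r / 2\<close> the weak inequality suffices.\<close>

lemma strict_submean_property:
  fixes p :: "'a::euclidean_space"
  assumes dim: "DIM('a) = 2" and S: "open S" "cball p r \<subseteq> S" and r: "0 < r"
    and h: "Ck_on 2 h S" "\<And>x. x \<in> S \<Longrightarrow> laplacian h x > 0"
  shows "h p < wavg r h p"
proof -
  have h0: "Ck_on 0 h S" using Ck_on_continuous[OF h(1)] by simp
  have i: "integrable lebesgue (\<lambda>x. h x * bump s (x - p))" if "0 < s" "s \<le> r" for s
  proof (rule Ckc_integrable[OF Ckc_mult[OF S(1) h0 Ckc_bump[OF that(1)]]])
    show "cball p s \<subseteq> S" using S(2) that by force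
  qed
  have w: "weakly_subharmonic S h"
    unfolding weakly_subharmonic_def
  proof (intro allI impI)
    fix \<phi> assume \<phi>: "Ckc 2 \<phi> S" "\<forall>x. 0 \<le> \<phi> x"
    have "0 \<le> (LINT x|lebesgue. laplacian h x * \<phi> x)"
    proof (rule Bochner_Integration.integral_nonneg)
      show "0 \<le> laplacian h x * \<phi> x" for x
        using h(2)[of x] \<phi>(2) Ckc_zero[OF \<phi>(1), of x] by (cases "x \<in> S") auto
    qed
    then show "0 \<le> (LINT x|lebesgue. h x * laplacian \<phi> x)"
      using green_second[OF S(1) h(1) \<phi>(1)] by simp
  qed
  have p: "p \<in> S" using S(2) r by force
  then have c: "isCont h p"
    using h0 S(1) by (simp add: continuous_on_eq_continuous_at)
  have r2: "0 < r / 2" "r / 2 < r" using r by auto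
  obtain \<phi> where \<phi>: "Ckc 2 \<phi> S" "\<And>x. \<phi> x \<ge> 0" "\<phi> p > 0"
    "\<And>x. laplacian \<phi> x = 4 * bump r (x - p) - 4 * bump (r / 2) (x - p)"
    using potential_difference_test[OF dim r2 S(2)] by (elim exE conjE) simp
  have "Ck_on 0 (laplacian h) S" using continuous_on_laplacian[OF h(1)] by simp
  then have "Ckc 0 (\<lambda>x. laplacian h x * \<phi> x) S"
    by (rule Ckc_mult[OF S(1) _ Ckc_le[OF \<phi>(1)]]) simp
  then have "0 < (LINT x|lebesgue. laplacian h x * \<phi> x)"
  proof (rule integral_Ckc_pos)
    show "0 \<le> laplacian h x * \<phi> x" for x
      using h(2)[of x] \<phi>(2) Ckc_zero[OF \<phi>(1), of x] by (cases "x \<in> S") auto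
    show "0 < laplacian h p * \<phi> p" using h(2)[OF p] \<phi>(3) by simp
  qed
  also have "\<dots> = (LINT x|lebesgue. h x * laplacian \<phi> x)"
    using green_second[OF S(1) h(1) \<phi>(1)] by simp
  also have "\<dots> = (LINT x|lebesgue. 4 * (h x * bump r (x - p)) - 4 * (h x * bump (r / 2) (x - p)))"
    unfolding \<phi>(4) by (simp add: algebra_simps)
  also have "\<dots> = 4 * (LINT x|lebesgue. h x * bump r (x - p)) - 4 * (LINT x|lebesgue. h x * bump (r / 2) (x - p))"
    using i[of r] i[of "r / 2"] r by (subst Bochner_Integration.integral_diff) auto
  finally have "wavg (r / 2) h p < wavg r h p"
    unfolding wavg_def using bump_mass_pos[where 'a='a] by (simp add: divide_strict_right_mono)
  moreover have "h p \<le> wavg (r / 2) h p"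
  proof (rule submean_property[OF dim w i r2(1) _ c])
    show "cball p (r / 2) \<subseteq> S" using S(2) r by force
  qed (use r in auto)
  ultimately show ?thesis by simp
qed

section \<open>Comparison principle and growth near an exterior ball\<close>

lemma comparison_principle:
  fixes w b :: "'a::euclidean_space \<Rightarrow> real"
  assumes dim: "DIM('a) = 2" and S: "open S" "bounded S" and w: "integrable lebesgue w"
    and sub: "\<And>p r. 0 < r \<Longrightarrow> cball p r \<subseteq> S \<Longrightarrow> w p \<le> wavg r w p"
    and b: "continuous_on (closure S) b"
    and super: "\<And>p r. 0 < r \<Longrightarrow> cball p r \<subseteq> S \<Longrightarrow> wavg r b p < b p"
    and bd: "\<And>x. x \<in> S \<Longrightarrow> w x \<le> A"
    and bdry: "\<And>q e. q \<in> frontier S \<Longrightarrow> e > 0 \<Longrightarrow> \<exists>d>0. \<forall>x\<in>S \<inter> ball q d. w x \<le> b x + e"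
    and p: "p \<in> S"
  shows "w p \<le> b p"
proof (rule ccontr)
  assume "\<not> w p \<le> b p"
  then have pos: "w p - b p > 0" by simp
  have cS: "compact (closure S)" using S(2) by (simp add: compact_closure)
  have "bounded (b ` closure S)"
    using compact_imp_bounded compact_continuous_image[OF b cS] by blast
  then obtain B where B: "\<And>x. x \<in> closure S \<Longrightarrow> \<bar>b x\<bar> \<le> B"
    unfolding bounded_iff by auto
  define V where "V = (\<lambda>x. w x - b x) ` S"
  have "v \<le> A + B" if v: "v \<in> V" for v
  proof -
    obtain x where x: "x \<in> S" "v = w x - b x" using v unfolding V_def by blast
    then show ?thesis using bd[OF x(1)] B[of x] closure_subset[of S] by (auto simp: abs_le_iff)
  qed
  then have V: "bdd_above V" "V \<noteq> {}" using p by (auto simp: V_def bdd_above_def)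
  define m where "m = Sup V"
  have m_ub: "w x - b x \<le> m" if "x \<in> S" for x
    unfolding m_def using that by (intro cSup_upper V) (auto simp: V_def)
  have m_pos: "m > 0" using m_ub[OF p] pos by simp
  have "\<exists>x\<in>S. m - 1 / real (Suc n) < w x - b x" for n
  proof -
    have "m - 1 / real (Suc n) < Sup V" by (simp add: m_def)
    then show ?thesis using less_cSup_iff[OF V(2,1)] unfolding V_def by auto
  qed
  then obtain X where X: "\<And>n. X n \<in> S" "\<And>n. m - 1 / real (Suc n) < w (X n) - b (X n)"
    by metis
  have f_lim: "(\<lambda>n. w (X n) - b (X n)) \<longlonglongrightarrow> m"
  proof (rule tendsto_sandwich[OF _ _ _ tendsto_const])
    show "(\<lambda>n. m - 1 / real (Suc n)) \<longlonglongrightarrow> m"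
      using tendsto_diff[OF tendsto_const[of m] LIMSEQ_inverse_real_of_nat] by (simp add: inverse_eq_divide)
  qed (use X m_ub in \<open>auto intro!: always_eventually less_imp_le\<close>)
  have "\<forall>n. X n \<in> closure S" using X(1) closure_subset by blast
  then obtain q s where q: "q \<in> closure S" "strict_mono s" "(X \<circ> s) \<longlonglongrightarrow> q"
    using cS compact_imp_seq_compact seq_compactE by metis
  define Y where "Y = X \<circ> s"
  have Y: "Y \<longlonglongrightarrow> q" "Y n \<in> S" for n using q(3) X(1) by (auto simp: Y_def)
  have fY: "(\<lambda>n. w (Y n) - b (Y n)) \<longlonglongrightarrow> m"
    using LIMSEQ_subseq_LIMSEQ[OF f_lim q(2)] by (simp add: Y_def comp_def)
  show False
  proof (cases "q \<in> S")
    case False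
    then have "q \<in> frontier S" using q(1) S(1) by (simp add: frontier_def interior_open)
    then obtain d where d: "d > 0" "\<And>x. x \<in> S \<inter> ball q d \<Longrightarrow> w x \<le> b x + m / 2"
      using bdry[of q "m / 2"] m_pos by auto
    have "eventually (\<lambda>n. dist (Y n) q < d) sequentially" using Y(1) d(1) by (rule tendstoD)
    then have "eventually (\<lambda>n. w (Y n) - b (Y n) \<le> m / 2) sequentially"
    proof (rule eventually_mono)
      fix n assume "dist (Y n) q < d"
      then have "Y n \<in> S \<inter> ball q d" using Y(2) by (simp add: dist_commute)
      from d(2)[OF this] show "w (Y n) - b (Y n) \<le> m / 2" by simp
    qed
    then have "m \<le> m / 2" by (intro tendsto_upperbound[OF fY]) auto
    then show False using m_pos by simp
  next
    case True
    then obtain R where R: "R > 0" "cball q R \<subseteq> S" using S(1) open_contains_cball by blast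
    \<comment> \<open>Half of \<open>R\<close>, so that balls of this same radius about nearby
      points of the sequence still lie in \<open>cball q R\<close>.\<close>
    define r where "r = R / 2"
    have r: "r > 0" "cball q r \<subseteq> S" using R by (auto simp: r_def)
    have bS: "Ck_on 0 b S" using continuous_on_subset[OF b closure_subset] by simp
    have ib: "integrable lebesgue (\<lambda>x. b x * bump r (x - q))"
      by (rule Ckc_integrable[OF Ckc_mult[OF S(1) bS Ckc_bump[OF r]]])
    have ic: "integrable lebesgue (\<lambda>x. - m * bump r (x - q))" by (rule integrable_bump_cmult[OF r(1)])
    have "eventually (\<lambda>n. dist (Y n) q < r) sequentially" using Y(1) r(1) by (rule tendstoD)
    then have "eventually (\<lambda>n. w (Y n) - b (Y n) \<le> wavg r w (Y n) - b (Y n)) sequentially"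
    proof (rule eventually_mono)
      fix n assume n: "dist (Y n) q < r"
      have "cball (Y n) r \<subseteq> cball q R"
      proof
        fix y assume "y \<in> cball (Y n) r"
        then show "y \<in> cball q R"
          using n dist_triangle[of q y "Y n"] by (simp add: r_def dist_commute)
      qed
      then have "cball (Y n) r \<subseteq> S" using R(2) by blast
      from sub[OF r(1) this] show "w (Y n) - b (Y n) \<le> wavg r w (Y n) - b (Y n)" by simp
    qed
    moreover have "(\<lambda>n. wavg r w (Y n)) \<longlonglongrightarrow> wavg r w q"
      using continuous_on_tendsto_compose[OF continuous_wavg[OF w r(1)] Y(1)] by simp
    moreover have "(\<lambda>n. b (Y n)) \<longlonglongrightarrow> b q"
      by (rule continuous_on_tendsto_compose[OF b Y(1) q(1)])
        (intro always_eventually allI subsetD[OF closure_subset] Y(2))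
    ultimately have "m \<le> wavg r w q - b q"
      by (intro tendsto_le[OF _ tendsto_diff fY]) auto
    also have "wavg r w q \<le> wavg r (\<lambda>x. b x - (- m)) q"
    proof (rule wavg_mono[OF r(1) integrable_mult_bump[OF w r(1)]])
      show "integrable lebesgue (\<lambda>x. (b x - - m) * bump r (x - q))"
        unfolding left_diff_distrib using ib ic by (rule Bochner_Integration.integrable_diff)
      show "w x \<le> b x - - m" if "x \<in> cball q r" for x
        using m_ub[of x] that r(2) by auto
    qed
    also have "\<dots> = wavg r b q + m"
      using wavg_diff[OF ib ic] wavg_const[OF dim r(1), of "- m" q] by simp
    also have "wavg r b q < b q" by (rule super[OF r])
    finally show False by simp
  qed
qed

text \<open>In the plane the Laplacian of |x|^(-2) is 4 |x|^(-4), so the barrier is strictly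
  superharmonic, as the comparison requires; a logarithm would only be harmonic. It vanishes on the
  inner circle and \<open>A'\<close> makes it equal to \<open>A\<close> on the outer one. The inner
  radius \<open>a\<close> is taken below \<rho> because \<open>w\<close> is known to be 0 in a
  collar around the circle of radius \<open>a\<close>, while no boundary limit is known at
  \<rho>.\<close>

lemma annulus_barrier:
  fixes w :: "'a::euclidean_space \<Rightarrow> real"
  assumes dim: "DIM('a) = 2" and w: "integrable lebesgue w"
    and sub: "\<And>p r. 0 < r \<Longrightarrow> cball p r \<subseteq> ball c (2 * \<rho>) \<Longrightarrow> w p \<le> wavg r w p"
    and A: "A > 0" "\<And>x. x \<in> ball c (2 * \<rho>) \<Longrightarrow> w x \<le> A"
    and z: "\<And>x. x \<in> ball c \<rho> \<Longrightarrow> w x = 0"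
    and a: "0 < a" "a < \<rho>" and p: "\<rho> \<le> norm (p - c)" "norm (p - c) < 2 * \<rho>"
  shows "w p \<le> A / (1 - a\<^sup>2 / (2 * \<rho>)\<^sup>2) * (1 - a\<^sup>2 / (norm (p - c))\<^sup>2)"
proof -
  define A' where "A' = A / (1 - a\<^sup>2 / (2 * \<rho>)\<^sup>2)"
  define h where "h x = inverse ((norm (x - c))\<^sup>2)" for x
  define b where "b x = A' - A' * a\<^sup>2 * h x" for x
  define S where "S = {x. a < norm (x - c)} \<inter> ball c (2 * \<rho>)"
  have "a\<^sup>2 < (2 * \<rho>)\<^sup>2" using a by (intro power_strict_mono) auto
  then have k: "0 < 1 - a\<^sup>2 / (2 * \<rho>)\<^sup>2" using a by (simp add: divide_less_eq)
  then have A': "A' > 0" using A by (simp add: A'_def)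
  have oS: "open S" unfolding S_def by (intro open_Int open_Collect_less continuous_intros open_ball)
  have bS: "bounded S" unfolding S_def by (rule bounded_Int) simp
  have cl: "closure S \<subseteq> {x. a \<le> norm (x - c)} \<inter> cball c (2 * \<rho>)"
  proof (rule closure_minimal)
    show "closed ({x. a \<le> norm (x - c)} \<inter> cball c (2 * \<rho>))"
      by (intro closed_Int closed_Collect_le continuous_intros closed_cball)
  qed (auto simp: S_def)
  have hpos: "(norm (x - c))\<^sup>2 \<in> {0<..}" if "x \<in> S" for x
    using that a(1) by (auto simp: S_def)
  have hC: "Ck_on 2 h S" unfolding h_def[abs_def]
    by (rule Ck_on_compose[OF oS open_greaterThan Ck_on_inverse Ck_on_subset[OF Ck_on_norm_square subset_UNIV]])
      (use hpos in blast)
  have lap: "laplacian h x > 0" if x: "x \<in> S" for x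
  proof -
    define q where "q = (norm (x - c))\<^sup>2"
    have q: "q > 0" using hpos[OF x] by (simp add: q_def)
    have d1: "deriv inverse t = - (inverse t * inverse t)" if "t > 0" for t :: real
      using DERIV_inverse[of t UNIV] that by (intro DERIV_imp_deriv) (simp add: numeral_2_eq_2)
    have "((\<lambda>t::real. - (inverse t * inverse t)) has_field_derivative 2 * inverse q ^ 3) (at q)"
      using q by (auto intro!: derivative_eq_intros simp: field_simps power3_eq_cube)
    then have "(deriv inverse has_field_derivative 2 * inverse q ^ 3) (at q)"
      by (rule has_field_derivative_transform_within_open[of _ _ _ "{0<..}"]) (use q d1 in auto)
    then have d2: "deriv (deriv inverse) q = 2 * inverse q ^ 3" by (rule DERIV_imp_deriv)
    have "laplacian h x = 4 * deriv inverse q + 4 * q * deriv (deriv inverse) q"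
      unfolding h_def[abs_def] q_def
      using laplacian_radial[OF oS x Ck_on_inverse open_greaterThan hpos] dim by simp
    also have "\<dots> = 4 * (inverse q * inverse q)"
      using q d1[OF q] d2 by (simp add: field_simps power3_eq_cube)
    finally show ?thesis using q by simp
  qed
  have "w p \<le> b p"
  proof (rule comparison_principle[OF dim oS bS w])
    show "w q \<le> wavg r w q" if "0 < r" "cball q r \<subseteq> S" for q r
      by (rule sub) (use that in \<open>auto simp: S_def\<close>)
    show "continuous_on (closure S) b"
      unfolding b_def h_def by (intro continuous_intros) (use cl a in auto)
    show "wavg r b q < b q" if r: "0 < r" "cball q r \<subseteq> S" for q r
    proof -
      have h0: "Ck_on 0 (\<lambda>x. A' * a\<^sup>2 * h x) S"
        by (rule Ck_on_mult[OF oS Ck_on_const]) (use Ck_on_continuous[OF hC] in simp)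
      have i: "integrable lebesgue (\<lambda>x. (A' * a\<^sup>2 * h x) * bump r (x - q))"
        by (rule Ckc_integrable[OF Ckc_mult[OF oS h0 Ckc_bump[OF r]]])
      have "wavg r b q = A' - A' * a\<^sup>2 * wavg r h q"
        unfolding b_def[abs_def]
        by (subst wavg_diff[OF integrable_bump_cmult[OF r(1)] i]) (simp add: wavg_const[OF dim r(1)] wavg_cmult)
      moreover have "h q < wavg r h q" by (rule strict_submean_property[OF dim oS r(2,1) hC lap])
      ultimately show ?thesis using A' a by (simp add: b_def)
    qed
    show "w x \<le> A" if "x \<in> S" for x using A(2) that by (simp add: S_def)
    show "p \<in> S" using p a by (auto simp: S_def dist_norm norm_minus_commute)
    show "\<exists>d>0. \<forall>x\<in>S \<inter> ball q d. w x \<le> b x + e" if q: "q \<in> frontier S" and e: "e > 0" for q e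
    proof -
      have q1: "q \<in> closure S" "q \<notin> S" using q oS by (auto simp: frontier_def interior_open)
      then have "norm (q - c) = a \<or> norm (q - c) = 2 * \<rho>"
        using cl by (force simp: S_def dist_norm norm_minus_commute)
      then show ?thesis
      proof
        assume qa: "norm (q - c) = a"
        show ?thesis
        proof (intro exI[of _ "\<rho> - a"] conjI ballI)
          fix x assume x: "x \<in> S \<inter> ball q (\<rho> - a)"
          have "norm (x - c) \<le> norm (x - q) + norm (q - c)" by (rule norm_diff_triangle_le) auto
          then have "x \<in> ball c \<rho>" using x qa by (simp add: dist_norm norm_minus_commute)
          then have "w x = 0" by (rule z)
          moreover have "a\<^sup>2 * h x \<le> 1"
          proof -
            have "a < norm (x - c)" using x by (simp add: S_def)
            then have "a\<^sup>2 \<le> (norm (x - c))\<^sup>2" using a by (intro power_mono) auto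
            moreover have "(norm (x - c))\<^sup>2 > 0" using hpos[of x] x by simp
            ultimately show ?thesis by (simp add: h_def field_simps)
          qed
          then have "A' * (a\<^sup>2 * h x) \<le> A' * 1" using A' by (intro mult_left_mono) auto
          ultimately show "w x \<le> b x + e" using e by (simp add: b_def mult.assoc)
        qed (use a in auto)
      next
        assume qr: "norm (q - c) = 2 * \<rho>"
        have "b q = A"
        proof -
          have "b q = A' * (1 - a\<^sup>2 / (2 * \<rho>)\<^sup>2)"
            by (simp add: b_def h_def qr field_simps)
          also have "\<dots> = A"
            unfolding A'_def by (rule nonzero_eq_divide_eq[THEN iffD1, OF _ refl]) (use k in linarith)
          finally show ?thesis .
        qed
        have "isCont b q"
          unfolding b_def h_def using qr a by (intro continuous_intros) auto
        then obtain d where d: "d > 0" "\<And>x. dist x q < d \<Longrightarrow> dist (b x) (b q) < e"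
          using e unfolding continuous_at_eps_delta by metis
        show ?thesis
        proof (intro exI[of _ d] conjI ballI d(1))
          fix x assume x: "x \<in> S \<inter> ball q d"
          have "\<bar>b x - A\<bar> < e" using d(2)[of x] x \<open>b q = A\<close> by (simp add: dist_commute[of x] dist_real_def)
          moreover have "w x \<le> A" using x A(2) by (simp add: S_def)
          ultimately show "w x \<le> b x + e" by linarith
        qed
      qed
    qed
  qed
  also have "b p = A' * (1 - a\<^sup>2 / (norm (p - c))\<^sup>2)"
    by (simp add: b_def h_def field_simps)
  finally show ?thesis by (simp only: A'_def)
qed

text \<open>The inner radius of the barrier tends to \<rho> from below;
  \<open>A + (\<rho> - a)\<close> keeps the bound positive when \<open>A\<close> is 0. Of the
  constant, 4/3 is 1 / (1 - 1/4) and the factor 2 comes from 1 - \<rho>^2 / n^2 \<le> 2 (n - \<rho>)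
  / \<rho>.\<close>

lemma exterior_ball_linear_bound:
  fixes w :: "'a::euclidean_space \<Rightarrow> real"
  assumes dim: "DIM('a) = 2" and w: "integrable lebesgue w"
    and sub: "\<And>p r. 0 < r \<Longrightarrow> cball p r \<subseteq> ball c (2 * \<rho>) \<Longrightarrow> w p \<le> wavg r w p"
    and A: "A \<ge> 0" "\<And>x. x \<in> ball c (2 * \<rho>) \<Longrightarrow> w x \<le> A"
    and z: "\<And>x. x \<in> ball c \<rho> \<Longrightarrow> w x = 0"
    and \<rho>: "0 < \<rho>" and p: "\<rho> \<le> norm (p - c)" "norm (p - c) < 2 * \<rho>"
  shows "w p \<le> 8 / 3 * A / \<rho> * (norm (p - c) - \<rho>)"
proof -
  define n where "n = norm (p - c)"
  have n: "n > 0" "\<rho> \<le> n" using p \<rho> by (auto simp: n_def)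
  have "((\<lambda>a. (A + (\<rho> - a)) / (1 - a\<^sup>2 / (2 * \<rho>)\<^sup>2) * (1 - a\<^sup>2 / n\<^sup>2)) \<longlongrightarrow>
      (A + (\<rho> - \<rho>)) / (1 - \<rho>\<^sup>2 / (2 * \<rho>)\<^sup>2) * (1 - \<rho>\<^sup>2 / n\<^sup>2)) (at_left \<rho>)"
    by (intro tendsto_intros) (use \<rho> n in \<open>auto simp: power_mult_distrib\<close>)
  moreover have "eventually (\<lambda>a. w p \<le> (A + (\<rho> - a)) / (1 - a\<^sup>2 / (2 * \<rho>)\<^sup>2) * (1 - a\<^sup>2 / n\<^sup>2)) (at_left \<rho>)"
    unfolding eventually_at_left_field
  proof (intro exI[of _ 0] conjI allI impI \<rho>)
    fix a assume a: "0 < a" "a < \<rho>"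
    show "w p \<le> (A + (\<rho> - a)) / (1 - a\<^sup>2 / (2 * \<rho>)\<^sup>2) * (1 - a\<^sup>2 / n\<^sup>2)"
      unfolding n_def
    proof (rule annulus_barrier[OF dim w sub])
      show "w x \<le> A + (\<rho> - a)" if "x \<in> ball c (2 * \<rho>)" for x using A(2)[OF that] a by simp
    qed (use A(1) z a p in auto)
  qed
  ultimately have "w p \<le> (A + (\<rho> - \<rho>)) / (1 - \<rho>\<^sup>2 / (2 * \<rho>)\<^sup>2) * (1 - \<rho>\<^sup>2 / n\<^sup>2)"
    by (intro tendsto_lowerbound) auto
  then have "w p \<le> A / (1 - \<rho>\<^sup>2 / (2 * \<rho>)\<^sup>2) * (1 - \<rho>\<^sup>2 / n\<^sup>2)" by simp
  also have "A / (1 - \<rho>\<^sup>2 / (2 * \<rho>)\<^sup>2) = 4 / 3 * A"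
    using \<rho> by (simp add: power_mult_distrib)
  finally have w1: "w p \<le> 4 / 3 * A * (1 - \<rho>\<^sup>2 / n\<^sup>2)" .
  have "1 - \<rho>\<^sup>2 / n\<^sup>2 = (n + \<rho>) / n\<^sup>2 * (n - \<rho>)"
    using n by (simp add: field_simps power2_eq_square)
  also have "\<dots> \<le> 2 / \<rho> * (n - \<rho>)"
  proof (rule mult_right_mono)
    have "(n + \<rho>) * \<rho> \<le> (2 * n) * n" using n \<rho> by (intro mult_mono) auto
    then show "(n + \<rho>) / n\<^sup>2 \<le> 2 / \<rho>" using n \<rho> by (simp add: field_simps power2_eq_square)
  qed (use n in simp)
  finally have "4 / 3 * A * (1 - \<rho>\<^sup>2 / n\<^sup>2) \<le> 4 / 3 * A * (2 / \<rho> * (n - \<rho>))"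
    using A(1) by (intro mult_left_mono) auto
  also have "\<dots> = 8 / 3 * A / \<rho> * (n - \<rho>)" using \<rho> by (simp add: field_simps)
  finally show ?thesis using w1 unfolding n_def by (rule order_trans[rotated])
qed

section \<open>Supremum bound by the L2 norm\<close>

definition sup_const :: "'a::euclidean_space itself \<Rightarrow> real" where
  "sup_const _ = sqrt (LINT x|lebesgue. (bump 1 (x :: 'a))\<^sup>2) / bump_mass TYPE('a)"

text \<open>Cauchy-Schwarz: in dimension two the L2 norm of \<open>bump r\<close> is that of
  \<open>bump 1\<close> divided by \<open>r\<close>, and the mass does not depend on
  \<open>r\<close>.\<close>

lemma wavg_le_L2_norm:
  fixes w :: "'a::euclidean_space \<Rightarrow> real"
  assumes dim: "DIM('a) = 2" and w: "L2_on UNIV w" and r: "0 < r"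
  shows "wavg r w p \<le> sup_const TYPE('a) / r * L2_norm UNIV w"
proof -
  let ?b = "\<lambda>x::'a. bump r (x - p)"
  have b: "L2_on UNIV ?b" by (rule Ckc_L2_on[OF open_UNIV Ckc_bump[OF r subset_UNIV]])
  have c: "continuous_on UNIV (\<lambda>x. (?b x)\<^sup>2)" by (intro continuous_intros continuous_bump r)
  have "(LINT x|lebesgue. (?b x)\<^sup>2) = r\<^sup>2 * (LINT x|lebesgue. (bump r (r *\<^sub>R x :: 'a))\<^sup>2)"
    using integral_affine[OF r c, of p] dim by simp
  also have "\<dots> = (LINT x|lebesgue. (bump 1 (x :: 'a))\<^sup>2) / r\<^sup>2"
    using r by (simp add: bump_scale power_divide power2_eq_square)
  finally have "L2_norm UNIV ?b = sqrt (LINT x|lebesgue. (bump 1 (x :: 'a))\<^sup>2) / r"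
    using r unfolding L2_norm_def set_lebesgue_integral_def by (simp add: real_sqrt_divide)
  moreover have "\<bar>LINT x|lebesgue. w x * ?b x\<bar> \<le> L2_norm UNIV w * L2_norm UNIV ?b"
    using L2_cauchy_schwarz[OF w b] by (simp add: set_lebesgue_integral_def)
  ultimately have "(LINT x|lebesgue. w x * ?b x) \<le>
      L2_norm UNIV w * (sqrt (LINT x|lebesgue. (bump 1 (x :: 'a))\<^sup>2) / r)" by simp
  then have "wavg r w p \<le> (L2_norm UNIV w * (sqrt (LINT x|lebesgue. (bump 1 (x :: 'a))\<^sup>2) / r)) / bump_mass TYPE('a)"
    unfolding wavg_def using bump_mass_pos[where 'a='a] by (intro divide_right_mono) auto
  then show ?thesis by (simp add: sup_const_def mult.commute)
qed

definition abs_zero_ext :: "'a set \<Rightarrow> ('a \<Rightarrow> real) \<Rightarrow> 'a \<Rightarrow> real" where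
  "abs_zero_ext V u x = indicator V x * \<bar>u x\<bar>"

text \<open>A cutoff equal to 1 on the ball turns the boundary condition into membership in
  \<open>H10\<close>, which gives both square integrability and weak subharmonicity. Continuity is
  available only at points of \<open>U\<close> in the ball; at all other points \<open>w\<close> is
  0 and its averages are nonnegative.\<close>

lemma abs_zero_ext_submean:
  fixes u :: "'a::euclidean_space \<Rightarrow> real"
  assumes dim: "DIM('a) = 2" and U: "open U" and u: "harmonic_on u U" "vanishes_on_boundary U u"
    and R: "R > 0"
  defines "w \<equiv> abs_zero_ext (U \<inter> ball 0 R) u"
  shows "integrable lebesgue w" "L2_on UNIV w" "L2_norm UNIV w = L2_norm (U \<inter> ball 0 R) u"
    "\<And>p r. 0 < r \<Longrightarrow> cball p r \<subseteq> ball 0 R \<Longrightarrow> w p \<le> wavg r w p"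
proof -
  define \<zeta> :: "'a \<Rightarrow> real" where "\<zeta> = smooth_cutoff R"
  have \<zeta>: "\<zeta> x = 1" if "x \<in> ball 0 R" for x
    using smooth_cutoff_eq_1[OF R, of x] that by (simp add: \<zeta>_def)
  have H: "H10 U (\<lambda>x. \<zeta> x * u x)"
    using u(2) test_function_smooth_cutoff[OF R] unfolding vanishes_on_boundary_def \<zeta>_def by blast
  have Bs: "ball 0 R \<in> sets (lebesgue :: 'a measure)" by simp
  have cont: "continuous_on U u"
    using u(1) Ck_on_continuous unfolding harmonic_on_def by blast
  have m: "w \<in> borel_measurable lebesgue"
  proof -
    have "(\<lambda>x. indicator (U \<inter> ball 0 R) x *\<^sub>R u x) \<in> borel_measurable borel"
      by (rule borel_measurable_continuous_on_indicator) (use U continuous_on_subset[OF cont] in auto)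
    then have "(\<lambda>x. indicator (U \<inter> ball 0 R) x *\<^sub>R u x) \<in> borel_measurable lebesgue"
      by (intro measurable_completion) simp
    then have "(\<lambda>x. \<bar>indicator (U \<inter> ball 0 R) x *\<^sub>R u x\<bar>) \<in> borel_measurable lebesgue"
      by (rule borel_measurable_abs)
    then show ?thesis unfolding w_def abs_zero_ext_def[abs_def] by (simp add: abs_mult)
  qed
  have L2\<zeta>: "L2_on U (\<lambda>x. \<zeta> x * u x)" using H unfolding H10_def by blast
  then have "integrable lebesgue (\<lambda>x. indicator U x *\<^sub>R (\<zeta> x * u x)\<^sup>2)"
    unfolding L2_on_def set_integrable_def by simp
  then have "integrable lebesgue (\<lambda>x. indicator (ball 0 R) x *\<^sub>R (indicator U x *\<^sub>R (\<zeta> x * u x)\<^sup>2))"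
    by (rule integrable_mult_indicator[OF Bs])
  also have "(\<lambda>x. indicator (ball 0 R) x *\<^sub>R (indicator U x *\<^sub>R (\<zeta> x * u x)\<^sup>2)) = (\<lambda>x. (w x)\<^sup>2)"
    using \<zeta> by (auto simp: fun_eq_iff w_def abs_zero_ext_def indicator_def)
  finally have i2: "integrable lebesgue (\<lambda>x. (w x)\<^sup>2)" .
  show L2: "L2_on UNIV w"
    unfolding L2_on_def set_borel_measurable_def set_integrable_def using m i2 by simp
  have "L2_on UNIV (\<lambda>x::'a. indicator (ball 0 R) x :: real)"
  proof -
    have "(indicator (ball 0 R) x :: real)\<^sup>2 = indicator (ball 0 R) x" for x :: 'a
      by (simp add: indicator_def)
    then show ?thesis
      unfolding L2_on_def set_borel_measurable_def set_integrable_def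
      using emeasure_bounded_finite[OF bounded_ball, of "0::'a" R]
      by (simp add: borel_measurable_indicator integrable_real_indicator)
  qed
  from L2_on_inner[OF L2 this] have "integrable lebesgue (\<lambda>x. w x * indicator (ball 0 R) x)"
    unfolding set_integrable_def by simp
  also have "(\<lambda>x. w x * indicator (ball 0 R) x) = w"
    by (auto simp: fun_eq_iff w_def abs_zero_ext_def indicator_def)
  finally show i: "integrable lebesgue w" .
  show "L2_norm UNIV w = L2_norm (U \<inter> ball 0 R) u"
    unfolding L2_norm_def set_lebesgue_integral_def
    by (intro arg_cong[of _ _ sqrt] Bochner_Integration.integral_cong)
      (auto simp: w_def abs_zero_ext_def indicator_def)
  have ws: "weakly_subharmonic (ball 0 R) w"
    unfolding weakly_subharmonic_def w_def abs_zero_ext_def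
    using abs_weakly_subharmonic[OF U u(1) H \<zeta>] by blast
  fix p :: 'a and r :: real assume r: "0 < r" "cball p r \<subseteq> ball 0 R"
  show "w p \<le> wavg r w p"
  proof (cases "p \<in> U \<inter> ball 0 R")
    case True
    have "continuous_on (U \<inter> ball 0 R) (\<lambda>x. \<bar>u x\<bar>)"
      using continuous_on_subset[OF cont] by (intro continuous_intros) auto
    then have "continuous_on (U \<inter> ball 0 R) w"
      by (rule continuous_on_eq) (simp add: w_def abs_zero_ext_def)
    then have c: "isCont w p" using True U by (simp add: continuous_on_eq_continuous_at open_Int)
    show ?thesis
      by (rule submean_property[OF dim ws integrable_mult_bump[OF i] r c])
  next
    case False
    then have "w p = 0" by (simp add: w_def abs_zero_ext_def)
    also have "0 \<le> wavg r w p"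
      unfolding wavg_def using bump_mass_pos[where 'a='a]
      by (intro divide_nonneg_pos Bochner_Integration.integral_nonneg mult_nonneg_nonneg bump_nonneg)
        (auto simp: w_def abs_zero_ext_def)
    finally show ?thesis .
  qed
qed

section \<open>Harmonic functions in a disc\<close>

text \<open>Symmetry of second derivatives is obtained weakly, against radial bump functions, whose own mixed
  derivatives are visibly symmetric.\<close>

lemma mixed_partial_le:
  fixes u :: "'a::euclidean_space \<Rightarrow> real"
  assumes S: "open S" "p \<in> S" and u: "Ck_on 2 u S" and ab: "a \<in> Basis" "b \<in> Basis"
  shows "partial_deriv a (partial_deriv b u) p \<le> partial_deriv b (partial_deriv a u) p"
proof (rule ccontr)
  define h where "h x = partial_deriv a (partial_deriv b u) x - partial_deriv b (partial_deriv a u) x" for x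
  assume "\<not> ?thesis"
  then have hp: "h p > 0" by (simp add: h_def)
  have u1: "Ck_on (Suc 0) (partial_deriv v u) S" if "v \<in> Basis" for v
    using u that by (simp add: numeral_2_eq_2)
  have u2: "Ck_on 0 (partial_deriv w (partial_deriv v u)) S" if "v \<in> Basis" "w \<in> Basis" for v w
    using u that by (simp add: numeral_2_eq_2)
  have u0: "Ck_on 1 u S" by (rule Ck_on_le[OF u]) simp
  have hC: "Ck_on 0 h S" unfolding h_def[abs_def]
    by (rule Ck_on_diff[OF S(1) u2[OF ab(2,1)] u2[OF ab]])
  then have "isCont h p" using S by (simp add: continuous_on_eq_continuous_at)
  then obtain d where d: "d > 0" "\<And>x. dist x p < d \<Longrightarrow> dist (h x) (h p) < h p"
    using hp unfolding continuous_at_eps_delta by metis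
  obtain e where e: "e > 0" "cball p e \<subseteq> S" using S open_contains_cball by blast
  define r where "r = min (d / 2) e"
  have r: "r > 0" "r < d" "cball p r \<subseteq> S" using d e by (auto simp: r_def min_def)
  \<comment> \<open>Profile of a smooth radial bump, positive inside the ball of radius
    \<open>r\<close> about \<open>p\<close> and zero outside, where \<open>r\<close> is so small
    that \<open>h\<close> is positive on that ball.\<close>
  define f where "f s = flat 1 (s * (- 1 / r\<^sup>2) + 1)" for s
  have id: "Ck_on k (\<lambda>s::real. s) UNIV" for k using Ck_on_inner[of k 1 "UNIV :: real set"] by simp
  have fC: "Ck_on k f UNIV" for k unfolding f_def[abs_def]
    by (rule Ck_on_compose[OF open_UNIV open_UNIV Ck_on_flat _ subset_UNIV])
      (rule Ck_on_add[OF open_UNIV Ck_on_mult[OF open_UNIV id Ck_on_const] Ck_on_const])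
  define q where "q x = (norm (x - p))\<^sup>2" for x :: 'a
  have qC: "Ck_on k q UNIV" for k unfolding q_def[abs_def] by (rule Ck_on_norm_square)
  define \<phi> where "\<phi> x = f (q x)" for x
  have \<phi>C: "Ck_on k \<phi> UNIV" for k unfolding \<phi>_def[abs_def]
    by (rule Ck_on_compose[OF open_UNIV open_UNIV fC qC subset_UNIV])
  have \<phi>_nonneg: "\<phi> x \<ge> 0" for x by (simp add: \<phi>_def f_def flat_def)
  have \<phi>p: "\<phi> p > 0" by (simp add: \<phi>_def f_def flat_def q_def)
  have \<phi>0: "\<phi> x = 0" if "x \<notin> cball p r" for x
  proof -
    have "r < norm (x - p)" using that by (simp add: dist_norm norm_minus_commute)
    then have "r\<^sup>2 < q x" unfolding q_def using r by (intro power_strict_mono) auto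
    then show ?thesis using r by (simp add: \<phi>_def f_def flat_def field_simps)
  qed
  have \<phi>_Ckc: "Ckc k \<phi> S" for k by (rule CkcI[OF \<phi>C compact_cball r(3) \<phi>0])
  have qd: "q differentiable (at x)" for x using qC[of 1] by simp
  have fd: "f differentiable (at s)" for s using fC[of 1] by simp
  have f'C: "Ck_on k (deriv f) UNIV" for k by (rule Ck_on_Suc_real[OF open_UNIV fC])
  have f'd: "deriv f differentiable (at s)" for s using f'C[of 1] by simp
  have pd1: "partial_deriv v \<phi> = (\<lambda>x. deriv f (q x) * (2 * ((x - p) \<bullet> v)))" for v
    unfolding \<phi>_def[abs_def] using partial_deriv_compose[OF fd qd]
    by (auto simp: q_def[abs_def] partial_deriv_norm_square)
  have pd2: "partial_deriv w (partial_deriv v \<phi>) x =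
     deriv f (q x) * (2 * (w \<bullet> v)) + deriv (deriv f) (q x) * (2 * ((x - p) \<bullet> w)) * (2 * ((x - p) \<bullet> v))" for v w x
  proof -
    have lin: "((\<lambda>x. 2 * ((x - p) \<bullet> v)) has_derivative (\<lambda>k. 2 * (k \<bullet> v))) (at x)"
      by (auto intro!: derivative_eq_intros)
    then have lind: "(\<lambda>x. 2 * ((x - p) \<bullet> v)) differentiable (at x)" by (auto simp: differentiable_def)
    have "partial_deriv w (partial_deriv v \<phi>) x = deriv f (q x) * partial_deriv w (\<lambda>x. 2 * ((x - p) \<bullet> v)) x
        + partial_deriv w (\<lambda>x. deriv f (q x)) x * (2 * ((x - p) \<bullet> v))"
      unfolding pd1
      by (rule partial_deriv_mult[OF differentiable_compose_real[OF f'd qd] lind])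
    also have "partial_deriv w (\<lambda>x. 2 * ((x - p) \<bullet> v)) x = 2 * (w \<bullet> v)"
      by (rule partial_derivI[OF lin])
    also have "partial_deriv w (\<lambda>x. deriv f (q x)) x = deriv (deriv f) (q x) * (2 * ((x - p) \<bullet> w))"
      using partial_deriv_compose[OF f'd qd] by (simp add: q_def[abs_def] partial_deriv_norm_square)
    finally show ?thesis .
  qed
  have sym: "partial_deriv w (partial_deriv v \<phi>) x = partial_deriv v (partial_deriv w \<phi>) x" for v w x
    unfolding pd2 by (simp add: inner_commute)
  have \<phi>v: "Ckc 1 (partial_deriv v \<phi>) S" if "v \<in> Basis" for v
    using Ckc_partial_deriv[OF \<phi>_Ckc that, of 1] by simp
  have ibp: "(LINT x|lebesgue. partial_deriv w (partial_deriv v u) x * \<phi> x) =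
     (LINT x|lebesgue. u x * partial_deriv v (partial_deriv w \<phi>) x)" if vw: "v \<in> Basis" "w \<in> Basis" for v w
  proof -
    have "(LINT x|lebesgue. partial_deriv v u x * partial_deriv w \<phi> x) =
        - (LINT x|lebesgue. partial_deriv w (partial_deriv v u) x * \<phi> x)"
      by (rule integral_by_parts_partial_deriv[OF S(1) _ \<phi>_Ckc vw(2)]) (use u1[OF vw(1)] in simp)
    moreover have "(LINT x|lebesgue. u x * partial_deriv v (partial_deriv w \<phi>) x) =
        - (LINT x|lebesgue. partial_deriv v u x * partial_deriv w \<phi> x)"
      by (rule integral_by_parts_partial_deriv[OF S(1) u0 \<phi>v[OF vw(2)] vw(1)])
    ultimately show ?thesis by simp
  qed
  have i: "integrable lebesgue (\<lambda>x. partial_deriv w (partial_deriv v u) x * \<phi> x)"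
    if "v \<in> Basis" "w \<in> Basis" for v w
    by (rule Ckc_integrable[OF Ckc_mult[OF S(1) u2[OF that] \<phi>_Ckc]])
  have "(LINT x|lebesgue. h x * \<phi> x) = 0"
    unfolding h_def left_diff_distrib
    using Bochner_Integration.integral_diff[OF i[OF ab(2,1)] i[OF ab]] ibp[OF ab(2,1)] ibp[OF ab] sym
    by simp
  moreover have "0 < (LINT x|lebesgue. h x * \<phi> x)"
  proof (rule integral_Ckc_pos[OF Ckc_mult[OF S(1) hC \<phi>_Ckc]])
    show "0 < h p * \<phi> p" using hp \<phi>p by simp
    show "0 \<le> h x * \<phi> x" for x
    proof (cases "x \<in> cball p r")
      case True
      then have "dist x p < d" using r(2) by (simp add: dist_commute)
      from d(2)[OF this] have "\<bar>h x - h p\<bar> < h p" by (simp add: dist_real_def)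
      then have "0 \<le> h x" unfolding abs_less_iff by linarith
      then show ?thesis using \<phi>_nonneg by simp
    qed (simp add: \<phi>0)
  qed
  ultimately show False by simp
qed

lemma mixed_partial_commute:
  fixes u :: "'a::euclidean_space \<Rightarrow> real"
  assumes "open S" "p \<in> S" "Ck_on 2 u S" "a \<in> Basis" "b \<in> Basis"
  shows "partial_deriv a (partial_deriv b u) p = partial_deriv b (partial_deriv a u) p"
  using mixed_partial_le[OF assms] mixed_partial_le[OF assms(1-3,5,4)] by simp

section \<open>Harmonic functions as real parts, and the Poisson formula\<close>

lemma harmonic_eq_Re_holomorphic:
  fixes u :: "'a::euclidean_space \<Rightarrow> real" and c v1 v2 :: 'a and t :: real
  assumes S: "open S" and u: "harmonic_on u S"
    and v: "v1 \<bullet> v1 = 1" "v2 \<bullet> v2 = 1" "v1 \<bullet> v2 = 0"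
    and complete: "\<And>p :: 'a. p = (p \<bullet> v1) *\<^sub>R v1 + (p \<bullet> v2) *\<^sub>R v2"
  defines "T \<equiv> (\<lambda>z. c + Re z *\<^sub>R (t *\<^sub>R v1) + Im z *\<^sub>R (t *\<^sub>R v2))"
  assumes T: "\<And>z. z \<in> ball 0 1 \<Longrightarrow> T z \<in> S"
  obtains F where "F holomorphic_on ball 0 1" "\<And>z. z \<in> ball 0 1 \<Longrightarrow> Re (F z) = u (T z)"
proof -
  have uC: "Ck_on 2 u S" and lap: "\<And>x. x \<in> S \<Longrightarrow> laplacian u x = 0"
    using u by (auto simp: harmonic_on_def)
  have ud: "u differentiable (at x)" if "x \<in> S" for x using uC that by (auto simp: numeral_2_eq_2)
  have ubd: "partial_deriv b u differentiable (at x)" if "x \<in> S" "b \<in> Basis" for x b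
    using uC that by (auto simp: numeral_2_eq_2)
  define H where "H v w x = (\<Sum>b\<in>Basis. \<Sum>e\<in>Basis. (v \<bullet> b) * (w \<bullet> e) * partial_deriv e (partial_deriv b u) x)"
    for v w x
  define g where "g v x = (\<Sum>b\<in>Basis. (v \<bullet> b) * partial_deriv b u x)" for v x
  have g_gradient: "g v x = gradient u x \<bullet> v" for v x
    unfolding g_def gradient_def inner_sum_left by (intro sum.cong refl) (simp add: inner_commute)
  have dg: "(g v has_derivative (\<lambda>k. H v k x)) (at x)" if x: "x \<in> S" for v x
  proof -
    have "(g v has_derivative (\<lambda>k. \<Sum>b\<in>Basis. (v \<bullet> b) * (gradient (partial_deriv b u) x \<bullet> k))) (at x)"
      unfolding g_def[abs_def]
      by (intro has_derivative_sum has_derivative_mult_right has_derivative_gradient ubd x)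
    moreover have "(\<Sum>b\<in>Basis. (v \<bullet> b) * (gradient (partial_deriv b u) x \<bullet> k)) = H v k x" for k
      unfolding H_def gradient_def inner_sum_left sum_distrib_left
      by (intro sum.cong refl) (simp add: inner_commute)
    ultimately show ?thesis by simp
  qed
  have H_lin: "H v (k1 *\<^sub>R w1 + k2 *\<^sub>R w2) x = k1 * H v w1 x + k2 * H v w2 x" for v w1 w2 k1 k2 x
    unfolding H_def by (simp add: inner_add_left algebra_simps sum.distrib sum_distrib_left)
  have H_sym: "H v w x = H w v x" if x: "x \<in> S" for v w x
  proof -
    have "H v w x = (\<Sum>e\<in>Basis. \<Sum>b\<in>Basis. (v \<bullet> b) * (w \<bullet> e) * partial_deriv e (partial_deriv b u) x)"
      unfolding H_def by (rule sum.swap)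
    also have "\<dots> = H w v x"
      unfolding H_def using mixed_partial_commute[OF S x uC]
      by (intro sum.cong refl) (simp add: mult_ac)
    finally show ?thesis .
  qed
  \<comment> \<open>The Laplacian is the trace of the Hessian form \<open>H\<close> in any
    orthonormal frame; completeness enters as Parseval's identity for \<open>v1\<close>,
    \<open>v2\<close>.\<close>
  have trace: "H v1 v1 x + H v2 v2 x = 0" if x: "x \<in> S" for x
  proof -
    have parseval: "(v1 \<bullet> b) * (v1 \<bullet> e) + (v2 \<bullet> b) * (v2 \<bullet> e) = b \<bullet> e" for b e
    proof -
      have "b \<bullet> e = ((b \<bullet> v1) *\<^sub>R v1 + (b \<bullet> v2) *\<^sub>R v2) \<bullet> e" using complete[of b] by simp
      then show ?thesis unfolding inner_add_left inner_scaleR_left by (simp add: inner_commute)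
    qed
    have "H v1 v1 x + H v2 v2 x = (\<Sum>b\<in>Basis. \<Sum>e\<in>Basis. (b \<bullet> e) * partial_deriv e (partial_deriv b u) x)"
      unfolding H_def sum.distrib[symmetric] by (simp only: distrib_right[symmetric] parseval)
    also have "\<dots> = (\<Sum>b\<in>Basis. \<Sum>e\<in>Basis. if e = b then partial_deriv e (partial_deriv b u) x else 0)"
      by (intro sum.cong refl) (auto simp: inner_Basis)
    also have "\<dots> = laplacian u x" unfolding laplacian_def by simp
    finally show ?thesis using lap[OF x] by simp
  qed
  define T' where "T' k = Re k *\<^sub>R (t *\<^sub>R v1) + Im k *\<^sub>R (t *\<^sub>R v2)" for k
  have dT: "(T has_derivative T') (at z)" for z
    unfolding T_def T'_def[abs_def] by (auto intro!: derivative_eq_intros)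
  have HT: "H v (T' k) x = t * (Re k * H v v1 x + Im k * H v v2 x)" for v k x
    unfolding T'_def using H_lin[of v "Re k * t" v1 "Im k * t" v2 x] by (simp add: algebra_simps)
  \<comment> \<open>With U = u o T and z = x + i y this is U_x - i U_y, the complex derivative of
    the function sought. Its Cauchy-Riemann equations are the symmetry and the vanishing trace of
    the Hessian. A primitive then has real part U up to a constant.\<close>
  define f where "f z = complex_of_real (t * g v1 (T z)) - \<i> * complex_of_real (t * g v2 (T z))" for z
  have df: "(f has_field_derivative (complex_of_real (t\<^sup>2 * H v1 v1 (T z)) - \<i> * complex_of_real (t\<^sup>2 * H v1 v2 (T z)))) (at z)"
    if z: "z \<in> ball 0 1" for z
  proof -
    have 1: "((\<lambda>z. g v (T z)) has_derivative (\<lambda>k. H v (T' k) (T z))) (at z)" for v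
      using has_derivative_compose[OF dT dg[OF T[OF z]]] .
    have "(f has_derivative (\<lambda>k. complex_of_real (t * H v1 (T' k) (T z)) - \<i> * complex_of_real (t * H v2 (T' k) (T z)))) (at z)"
      unfolding f_def[abs_def]
      by (intro has_derivative_diff has_derivative_mult_right has_derivative_of_real 1)
    moreover have "complex_of_real (t * H v1 (T' k) (T z)) - \<i> * complex_of_real (t * H v2 (T' k) (T z)) =
       (complex_of_real (t\<^sup>2 * H v1 v1 (T z)) - \<i> * complex_of_real (t\<^sup>2 * H v1 v2 (T z))) * k" for k
    proof -
      have s: "H v2 v1 (T z) = H v1 v2 (T z)" "H v2 v2 (T z) = - H v1 v1 (T z)"
        using H_sym[OF T[OF z]] trace[OF T[OF z]] by (auto simp: eq_neg_iff_add_eq_0 add.commute)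
      show ?thesis unfolding HT s
        by (simp add: complex_eq_iff algebra_simps power2_eq_square)
    qed
    ultimately show ?thesis by (simp add: has_field_derivative_def)
  qed
  have "f holomorphic_on ball 0 1"
    using df by (intro holomorphic_onI) (auto simp: field_differentiable_def intro: has_field_derivative_at_within)
  then obtain G where G: "\<And>z. z \<in> ball 0 1 \<Longrightarrow> (G has_field_derivative f z) (at z within ball 0 1)"
    using holomorphic_convex_primitive'[of "ball 0 1" f] by (metis convex_ball open_ball)
  have du: "((\<lambda>z. u (T z)) has_derivative (\<lambda>k. gradient u (T z) \<bullet> T' k)) (at z)" if "z \<in> ball 0 1" for z
    using has_derivative_compose[OF dT has_derivative_gradient[OF ud[OF T[OF that]]]] .
  have "((\<lambda>z. Re (G z) - u (T z)) has_derivative (\<lambda>k. 0)) (at z within ball 0 1)" if z: "z \<in> ball 0 1" for z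
  proof -
    have "((\<lambda>z. Re (G z) - u (T z)) has_derivative (\<lambda>k. Re (f z * k) - gradient u (T z) \<bullet> T' k)) (at z within ball 0 1)"
      by (rule has_derivative_diff[OF bounded_linear.has_derivative[OF bounded_linear_Re
              G[OF z, unfolded has_field_derivative_def]] has_derivative_at_withinI[OF du[OF z]]])
    moreover have "Re (f z * k) - gradient u (T z) \<bullet> T' k = 0" for k
      unfolding f_def T'_def g_gradient by (simp add: inner_add_right algebra_simps)
    ultimately show ?thesis by simp
  qed
  from has_derivative_zero_constant[OF convex_ball this]
  obtain C where C: "\<forall>z\<in>ball 0 1. Re (G z) - u (T z) = C" ..
  have "G holomorphic_on ball 0 1"
    using G by (intro holomorphic_onI) (auto simp: field_differentiable_def)
  then have "(\<lambda>z. G z - complex_of_real C) holomorphic_on ball 0 1" by (intro holomorphic_intros)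
  moreover have "Re (G z - complex_of_real C) = u (T z)" if "z \<in> ball 0 1" for z
    using bspec[OF C that] by simp
  ultimately show thesis by (rule that)
qed

text \<open>To the Cauchy kernel a term \<open>k\<close> is added whose pole is the reflection of
  \<open>z\<close> in the circle, hence outside the closed disc, so it contributes 0. On the circle
  the sum of the two kernels is real, namely the Poisson kernel, and real parts may be
  taken.\<close>

lemma poisson_formula_holomorphic:
  assumes c: "continuous_on (cball 0 1) F" and h: "F holomorphic_on ball 0 1" and z: "norm z < 1"
  shows "((\<lambda>\<theta>. Re (F (cis \<theta>)) * ((1 - (norm z)\<^sup>2) / (norm (cis \<theta> - z))\<^sup>2)) has_integral 2 * pi * Re (F z)) {0..2 * pi}"
proof -
  have nz: "1 - cnj z * w \<noteq> 0" if "norm w \<le> 1" for w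
  proof
    assume "1 - cnj z * w = 0"
    then have "norm (cnj z * w) = 1" by (metis eq_iff_diff_eq_0 norm_one)
    moreover have "norm (cnj z * w) \<le> norm z * 1"
      unfolding norm_mult using that by (intro mult_mono) auto
    ultimately show False using z by simp
  qed
  define k where "k w = F w * cnj z / (1 - cnj z * w)" for w
  have 1: "((\<lambda>w. F w / (w - z)) has_contour_integral 2 * of_real pi * \<i> * F z) (circlepath 0 1)"
    by (rule Cauchy_integral_circlepath[OF c h]) (use z in simp)
  have 2: "(k has_contour_integral 0) (circlepath 0 1)"
  proof (rule Cauchy_theorem_convex[of "cball 0 1" k "{}"])
    show "continuous_on (cball 0 1) k" unfolding k_def
      by (intro continuous_intros c) (use nz in auto)
    have "k holomorphic_on ball 0 1" unfolding k_def
      by (intro holomorphic_intros h) (use nz in auto)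
    then show "k field_differentiable at x" if "x \<in> interior (cball 0 1) - {}" for x
      using that by (intro holomorphic_on_imp_differentiable_at[of k "ball 0 1"]) auto
  qed auto
  have "((\<lambda>w. F w / (w - z) + k w) has_contour_integral 2 * of_real pi * \<i> * F z) (circlepath 0 1)"
    using has_contour_integral_add[OF 1 2] by simp
  then have "((\<lambda>\<theta>. (F (cis \<theta>) / (cis \<theta> - z) + k (cis \<theta>)) * \<i> * cis \<theta>) has_integral 2 * of_real pi * \<i> * F z) {0..2 * pi}"
    unfolding circlepath_def by (subst (asm) has_contour_integral_part_circlepath_iff) auto
  then have "((\<lambda>\<theta>. - \<i> * ((F (cis \<theta>) / (cis \<theta> - z) + k (cis \<theta>)) * \<i> * cis \<theta>)) has_integral - \<i> * (2 * of_real pi * \<i> * F z)) {0..2 * pi}"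
    by (rule has_integral_mult_right)
  then have "((\<lambda>\<theta>. Re (- \<i> * ((F (cis \<theta>) / (cis \<theta> - z) + k (cis \<theta>)) * \<i> * cis \<theta>))) has_integral Re (- \<i> * (2 * of_real pi * \<i> * F z))) {0..2 * pi}"
    by (rule has_integral_Re)
  note integral = this
  have Re_val: "Re (- \<i> * (2 * of_real pi * \<i> * F z)) = 2 * pi * Re (F z)" by simp
  have Re_mult: "Re (a * complex_of_real x) = Re a * x" for a x by simp
  have kernel: "- \<i> * ((F w / (w - z) + k w) * \<i> * w) = F w * complex_of_real ((1 - (norm z)\<^sup>2) / (norm (w - z))\<^sup>2)"
    if w: "norm w = 1" for w
  proof -
    have ww: "w * cnj w = 1" using complex_norm_square[of w] w by simp
    have wz: "w - z \<noteq> 0" using w z by auto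
    have n1: "1 - cnj z * w \<noteq> 0" using nz[of w] w by simp
    have e1: "cnj (w - z) * w = 1 - cnj z * w" using ww by (simp add: algebra_simps)
    have e2: "complex_of_real ((norm (w - z))\<^sup>2) = (w - z) * cnj (w - z)" by (rule complex_norm_square)
    have e3: "complex_of_real (1 - (norm z)\<^sup>2) = 1 - z * cnj z" by (simp add: complex_norm_square[symmetric])
    have cz: "cnj (w - z) \<noteq> 0" using wz by simp
    have "- \<i> * ((F w / (w - z) + k w) * \<i> * w) = F w * w * (1 / (w - z) + cnj z / (1 - cnj z * w))"
      by (simp add: k_def algebra_simps add_divide_distrib)
    also have "1 / (w - z) + cnj z / (1 - cnj z * w) = (1 - z * cnj z) / ((w - z) * (1 - cnj z * w))"
      using wz n1 by (simp add: divide_simps) (simp add: algebra_simps)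
    also have "F w * w * ((1 - z * cnj z) / ((w - z) * (1 - cnj z * w))) =
        F w * ((1 - z * cnj z) / ((w - z) * cnj (w - z)))"
      unfolding e1[symmetric] using w by (auto simp: divide_simps)
    finally show ?thesis unfolding of_real_divide e2 e3 .
  qed
  have "Re (- \<i> * ((F (cis \<theta>) / (cis \<theta> - z) + k (cis \<theta>)) * \<i> * cis \<theta>)) =
      Re (F (cis \<theta>)) * ((1 - (norm z)\<^sup>2) / (norm (cis \<theta> - z))\<^sup>2)" for \<theta>
    by (simp only: kernel[OF norm_cis] Re_mult)
  then show ?thesis using integral unfolding Re_val by (simp only:)
qed

text \<open>Only the real part of \<open>F\<close> is known to extend continuously to the circle.
  The formula is therefore applied to the dilations \<open>F (r w)\<close> with r < 1, and r tends
  to 1 under dominated convergence.\<close>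

lemma poisson_formula:
  fixes U :: "complex \<Rightarrow> real"
  assumes c: "continuous_on (cball 0 1) U" and F: "F holomorphic_on ball 0 1"
    and UF: "\<And>z. z \<in> ball 0 1 \<Longrightarrow> Re (F z) = U z" and z: "norm z < 1"
  shows "((\<lambda>\<theta>. U (cis \<theta>) * ((1 - (norm z)\<^sup>2) / (norm (cis \<theta> - z))\<^sup>2)) has_integral 2 * pi * U z) {0..2 * pi}"
proof -
  \<comment> \<open>The double \<open>Suc\<close> makes \<open>r 0 = 1 / 2\<close>, so that every
    dilation factor is positive.\<close>
  define r where "r n = 1 - 1 / real (Suc (Suc n))" for n
  have r: "0 < r n" "r n < 1" for n by (auto simp: r_def field_simps)
  have r_lim: "r \<longlonglongrightarrow> 1"
  proof -
    have "(\<lambda>n. 1 / real (Suc (Suc n))) \<longlonglongrightarrow> 0"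
      using LIMSEQ_Suc[OF LIMSEQ_inverse_real_of_nat] by (simp add: inverse_eq_divide)
    from tendsto_diff[OF tendsto_const[of 1] this] show ?thesis unfolding r_def[abs_def] by simp
  qed
  have rb: "complex_of_real (r n) * w \<in> ball 0 1" if "norm w \<le> 1" for n w
  proof -
    have "r n * norm w \<le> r n * 1" using r that by (intro mult_left_mono) (auto intro: less_imp_le)
    then have "r n * norm w < 1" using r[of n] by linarith
    then show ?thesis using r[of n] by (simp add: norm_mult)
  qed
  have U_lim: "(\<lambda>n. U (complex_of_real (r n) * w)) \<longlonglongrightarrow> U w" if w: "norm w \<le> 1" for w
  proof -
    have "(\<lambda>n. complex_of_real (r n) * w) \<longlonglongrightarrow> complex_of_real 1 * w"
      by (intro tendsto_intros r_lim)
    then have "(\<lambda>n. complex_of_real (r n) * w) \<longlonglongrightarrow> w" by simp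
    then show ?thesis
      by (rule continuous_on_tendsto_compose[OF c])
        (use w rb[OF w] in \<open>auto intro!: always_eventually less_imp_le\<close>)
  qed
  define P where "P \<theta> = (1 - (norm z)\<^sup>2) / (norm (cis \<theta> - z))\<^sup>2" for \<theta>
  have ne: "cis \<theta> \<noteq> z" for \<theta> using z by auto
  have cP: "continuous_on {0..2 * pi} P"
    unfolding P_def by (intro continuous_intros) (use ne in auto)
  obtain B where B: "\<And>w. w \<in> cball 0 1 \<Longrightarrow> \<bar>U w\<bar> \<le> B"
  proof -
    have "bounded (U ` cball 0 1)"
      by (rule compact_imp_bounded[OF compact_continuous_image[OF c compact_cball]])
    then obtain B where "\<forall>y\<in>U ` cball 0 1. norm y \<le> B" unfolding bounded_iff by blast
    then show thesis by (intro that[of B]) simp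
  qed
  have Pr: "((\<lambda>\<theta>. U (complex_of_real (r n) * cis \<theta>) * P \<theta>) has_integral 2 * pi * U (complex_of_real (r n) * z)) {0..2 * pi}" for n
  proof -
    define G where "G w = F (complex_of_real (r n) * w)" for w
    have "F holomorphic_on (\<lambda>w. complex_of_real (r n) * w) ` cball 0 1"
      by (rule holomorphic_on_subset[OF F]) (use rb in auto)
    then have G: "G holomorphic_on cball 0 1"
      unfolding G_def using holomorphic_on_compose[of "\<lambda>w. complex_of_real (r n) * w" "cball 0 1" F]
      by (auto simp: comp_def intro!: holomorphic_intros)
    have "((\<lambda>\<theta>. Re (G (cis \<theta>)) * ((1 - (norm z)\<^sup>2) / (norm (cis \<theta> - z))\<^sup>2)) has_integral 2 * pi * Re (G z)) {0..2 * pi}"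
      by (rule poisson_formula_holomorphic[OF holomorphic_on_imp_continuous_on[OF G] holomorphic_on_subset[OF G] z]) auto
    moreover have "Re (G w) = U (complex_of_real (r n) * w)" if "norm w \<le> 1" for w
      unfolding G_def by (rule UF[OF rb[OF that]])
    ultimately show ?thesis unfolding P_def using z by (simp add: less_imp_le)
  qed
  have hI: "(\<lambda>\<theta>. B * \<bar>P \<theta>\<bar>) integrable_on {0..2 * pi}"
    by (intro integrable_continuous_interval continuous_intros cP)
  have fI: "(\<lambda>\<theta>. U (complex_of_real (r n) * cis \<theta>) * P \<theta>) integrable_on {0..2 * pi}" for n
    using Pr by blast
  have le: "norm (U (complex_of_real (r n) * cis \<theta>) * P \<theta>) \<le> B * \<bar>P \<theta>\<bar>" for n \<theta>
    using B[of "complex_of_real (r n) * cis \<theta>"] rb[of "cis \<theta>" n]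
    by (auto simp: abs_mult intro!: mult_right_mono)
  have conv: "(\<lambda>n. U (complex_of_real (r n) * cis \<theta>) * P \<theta>) \<longlonglongrightarrow> U (cis \<theta>) * P \<theta>" for \<theta>
    by (intro tendsto_mult tendsto_const U_lim) simp
  note d = dominated_convergence[OF fI hI le conv]
  have "(\<lambda>n. 2 * pi * U (complex_of_real (r n) * z)) \<longlonglongrightarrow> 2 * pi * U z"
    by (intro tendsto_mult tendsto_const U_lim) (use z in simp)
  with d(2) have eq: "integral {0..2 * pi} (\<lambda>\<theta>. U (cis \<theta>) * P \<theta>) = 2 * pi * U z"
    unfolding integral_unique[OF Pr] by (rule LIMSEQ_unique)
  from integrable_integral[OF d(1)] show ?thesis unfolding eq unfolding P_def .
qed

text \<open>Since \<open>1 - (norm z)\<^sup>2\<close> vanishes on the circle, \<open>\<nu>\<close> is the Poisson integral of \<open>U\<close> divided by that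
  factor, evaluated at the boundary point \<open>1\<close>.\<close>

lemma boundary_expansion:
  fixes U :: "complex \<Rightarrow> real"
  assumes c: "continuous_on (cball 0 1) U" and F: "F holomorphic_on ball 0 1"
    and UF: "\<And>z. z \<in> ball 0 1 \<Longrightarrow> Re (F z) = U z"
    and K: "\<And>w. norm w = 1 \<Longrightarrow> \<bar>U w\<bar> \<le> K * (norm (w - 1))\<^sup>2"
  obtains \<nu> where "\<bar>\<nu>\<bar> \<le> K"
    "\<And>z. norm z < 1 \<Longrightarrow> \<bar>U z - (1 - (norm z)\<^sup>2) * \<nu>\<bar> \<le>
       K * ((norm (1 - z))\<^sup>2 + 2 * sqrt (1 - (norm z)\<^sup>2) * norm (1 - z))"
proof -
  have K0: "K \<ge> 0" using K[of "-1"] by (simp add: abs_ge_zero order_trans[OF abs_ge_zero] zero_le_mult_iff)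
  define g where "g \<theta> = U (cis \<theta>) / (norm (cis \<theta> - 1))\<^sup>2" for \<theta>
  \<comment> \<open>Since \<open>g\<close> may be discontinuous where
    \<open>cis \<theta> = 1\<close>, it is approximated with positive denominators: these functions
    are continuous and bounded by \<open>K\<close>. At the exceptional angle the numerator vanishes,
    so they converge to the default value 0 of the quotient.\<close>
  define gn where "gn n \<theta> = U (cis \<theta>) / ((norm (cis \<theta> - 1))\<^sup>2 + 1 / real (Suc n))" for n \<theta>
  have cU: "continuous_on {0..2 * pi} (\<lambda>\<theta>. U (cis \<theta>))"
    by (rule continuous_on_compose2[OF c]) (auto intro!: continuous_intros)
  have pos: "0 < (norm (cis \<theta> - 1))\<^sup>2 + 1 / real (Suc n)" for n \<theta>
    by (rule add_nonneg_pos) auto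
  have gnI: "gn n integrable_on {0..2 * pi}" for n
    unfolding gn_def[abs_def]
    by (intro integrable_continuous_interval continuous_intros cU) (use pos in \<open>simp add: less_imp_neq[symmetric]\<close>)
  have gn_le: "norm (gn n \<theta>) \<le> K" for n \<theta>
  proof -
    have "\<bar>U (cis \<theta>)\<bar> \<le> K * (norm (cis \<theta> - 1))\<^sup>2" by (rule K) simp
    also have "\<dots> \<le> K * ((norm (cis \<theta> - 1))\<^sup>2 + 1 / real (Suc n))"
      using K0 by (intro mult_left_mono) auto
    finally have "\<bar>U (cis \<theta>)\<bar> / ((norm (cis \<theta> - 1))\<^sup>2 + 1 / real (Suc n)) \<le> K"
      unfolding pos_divide_le_eq[OF pos] .
    then show ?thesis unfolding gn_def real_norm_def abs_divide abs_of_pos[OF pos] .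
  qed
  have gn_lim: "(\<lambda>n. gn n \<theta>) \<longlonglongrightarrow> g \<theta>" for \<theta>
  proof (cases "cis \<theta> = 1")
    case True
    then have "U (cis \<theta>) = 0" using K[of 1] by simp
    then show ?thesis by (simp add: gn_def g_def)
  next
    case False
    have "(\<lambda>n. U (cis \<theta>) / ((norm (cis \<theta> - 1))\<^sup>2 + 1 / real (Suc n))) \<longlonglongrightarrow>
        U (cis \<theta>) / ((norm (cis \<theta> - 1))\<^sup>2 + 0)"
      using LIMSEQ_inverse_real_of_nat False by (intro tendsto_intros) (auto simp: inverse_eq_divide)
    then show ?thesis by (simp add: gn_def g_def)
  qed
  have KI: "(\<lambda>_::real. K) integrable_on {0..2 * pi}" by (rule integrable_const_ivl)
  note gI = dominated_convergence(1)[OF gnI KI gn_le gn_lim]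
  define \<nu> where "\<nu> = integral {0..2 * pi} g / (2 * pi)"
  have g_le: "norm (g \<theta>) \<le> K" for \<theta>
    by (rule tendsto_upperbound[OF tendsto_norm[OF gn_lim]]) (use gn_le in auto)
  show thesis
  proof (rule that)
    have "norm (integral {0..2 * pi} g) \<le> integral {0..2 * pi} (\<lambda>_. K)"
      by (rule integral_norm_bound_integral[OF gI KI]) (rule g_le)
    also have "integral {0..2 * pi} (\<lambda>_. K) = K * (2 * pi)" by simp
    finally have "\<bar>integral {0..2 * pi} g\<bar> \<le> K * (2 * pi)" unfolding real_norm_def .
    moreover have "\<bar>\<nu>\<bar> = \<bar>integral {0..2 * pi} g\<bar> / (2 * pi)" unfolding \<nu>_def abs_divide by simp
    moreover have "0 < 2 * pi" by simp
    ultimately show "\<bar>\<nu>\<bar> \<le> K" by (simp only: pos_divide_le_eq)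
  next
    fix z :: complex assume z: "norm z < 1"
    define a where "a = 1 - (norm z)\<^sup>2"
    define d where "d = norm (1 - z)"
    \<comment> \<open>Balancing parameter for the estimate 2 b \<le> l + b^2 / l: as the Poisson
      kernel has integral 2 pi, the two terms contribute multiples of \<open>l\<close> and of
      \<open>a / l\<close>, which agree for this choice.\<close>
    define l where "l = sqrt a"
    define P where "P \<theta> = a / (norm (cis \<theta> - z))\<^sup>2" for \<theta>
    have a: "a > 0" using z by (simp add: a_def abs_square_less_1)
    then have l: "l > 0" "l\<^sup>2 = a" by (simp_all add: l_def)
    have U: "((\<lambda>\<theta>. U (cis \<theta>) * P \<theta>) has_integral 2 * pi * U z) {0..2 * pi}"
      using poisson_formula[OF c F UF z] unfolding P_def a_def .
    have "((\<lambda>\<theta>. 1 * P \<theta>) has_integral 2 * pi * 1) {0..2 * pi}"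
      using poisson_formula[of "\<lambda>_. 1" "\<lambda>_. 1", OF _ _ _ z] unfolding P_def a_def by simp
    then have P1: "(P has_integral 2 * pi) {0..2 * pi}" by simp
    have gi: "((\<lambda>\<theta>. a * g \<theta>) has_integral a * (2 * pi * \<nu>)) {0..2 * pi}"
      using has_integral_mult_right[OF integrable_integral[OF gI], of a] by (simp add: \<nu>_def)
    have diff: "((\<lambda>\<theta>. U (cis \<theta>) * P \<theta> - a * g \<theta>) has_integral 2 * pi * U z - a * (2 * pi * \<nu>)) {0..2 * pi}"
      by (rule has_integral_diff[OF U gi])
    have bd: "((\<lambda>\<theta>. K * (d\<^sup>2 + d * l) * P \<theta> + K * d * a / l) has_integral
       K * (d\<^sup>2 + d * l) * (2 * pi) + K * d * a / l * (2 * pi)) {0..2 * pi}"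
      using has_integral_add[OF has_integral_mult_right[OF P1, of "K * (d\<^sup>2 + d * l)"]
          has_integral_const_real[of "K * d * a / l" 0 "2 * pi"]] by (simp add: mult.commute)
    have le: "norm (U (cis \<theta>) * P \<theta> - a * g \<theta>) \<le> K * (d\<^sup>2 + d * l) * P \<theta> + K * d * a / l" for \<theta>
    proof -
      define x where "x = norm (cis \<theta> - 1)"
      define b where "b = norm (cis \<theta> - z)"
      have "cis \<theta> \<noteq> z" using z by auto
      then have b: "b > 0" by (simp add: b_def)
      have d: "d \<ge> 0" by (simp add: d_def)
      have "\<bar>x - b\<bar> \<le> norm ((cis \<theta> - 1) - (cis \<theta> - z))"
        unfolding x_def b_def by (rule norm_triangle_ineq3)
      also have "\<dots> = d" unfolding d_def by (simp add: norm_minus_commute)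
      finally have xb: "\<bar>x - b\<bar> \<le> d" .
      have "\<bar>x\<^sup>2 - b\<^sup>2\<bar> = \<bar>x - b\<bar> * (x + b)"
        using b by (simp add: power2_eq_square square_diff_square_factored abs_mult x_def mult.commute)
      also have "\<dots> \<le> d * (d + 2 * b)"
        using xb b d by (intro mult_mono) (auto simp: x_def)
      finally have sq: "\<bar>x\<^sup>2 - b\<^sup>2\<bar> \<le> d * (d + 2 * b)" .
      have amgm: "2 * b \<le> l + b\<^sup>2 / l"
      proof -
        have "2 * b * l \<le> l * l + b\<^sup>2"
          using sum_squares_bound[of b l] by (simp add: power2_eq_square add.commute)
        then have "2 * b \<le> (l * l + b\<^sup>2) / l" using l(1) by (subst pos_le_divide_eq) auto
        then show ?thesis using l(1) by (simp add: add_divide_distrib)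
      qed
      have "norm (U (cis \<theta>) * P \<theta> - a * g \<theta>) \<le> K * a / b\<^sup>2 * \<bar>x\<^sup>2 - b\<^sup>2\<bar>"
      proof (cases "x = 0")
        case True
        then have "U (cis \<theta>) = 0" using K[of "cis \<theta>"] by (simp add: x_def)
        then show ?thesis using K0 a by (simp add: g_def)
      next
        case False
        then have x: "x > 0" by (simp add: x_def)
        \<comment> \<open>The two kernels differ by the factor x^2 - b^2. Both \<open>x\<close> and
          \<open>b\<close> are distances from the same point of the circle, to 1 and to
          \<open>z\<close>, so they differ by at most \<open>d\<close>.\<close>
        have "U (cis \<theta>) * P \<theta> - a * g \<theta> = a / b\<^sup>2 * (U (cis \<theta>) / x\<^sup>2) * (x\<^sup>2 - b\<^sup>2)"
          unfolding P_def g_def x_def[symmetric] b_def[symmetric] using x b by (simp add: field_simps)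
        then have "norm (U (cis \<theta>) * P \<theta> - a * g \<theta>) = a / b\<^sup>2 * \<bar>U (cis \<theta>) / x\<^sup>2\<bar> * \<bar>x\<^sup>2 - b\<^sup>2\<bar>"
          using a by (simp add: abs_mult)
        also have "\<dots> \<le> a / b\<^sup>2 * K * \<bar>x\<^sup>2 - b\<^sup>2\<bar>"
          using g_le[of \<theta>] a unfolding g_def x_def by (intro mult_right_mono mult_left_mono) auto
        finally show ?thesis by (simp add: mult_ac)
      qed
      also have "\<dots> \<le> K * a / b\<^sup>2 * (d * (d + (l + b\<^sup>2 / l)))"
        using sq amgm d K0 a
        by (intro mult_left_mono order_trans[OF sq]) auto
      also have "\<dots> = K * (d\<^sup>2 + d * l) * P \<theta> + K * d * a / l"
        unfolding P_def b_def[symmetric] using b l(1) by (simp add: field_simps power2_eq_square)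
      finally show ?thesis .
    qed
    have "norm (2 * pi * U z - a * (2 * pi * \<nu>)) \<le> K * (d\<^sup>2 + d * l) * (2 * pi) + K * d * a / l * (2 * pi)"
      using integral_norm_bound_integral[OF has_integral_integrable[OF diff] has_integral_integrable[OF bd] le]
      unfolding integral_unique[OF diff] integral_unique[OF bd] .
    also have "K * d * a / l = K * d * l"
      using l by (metis nonzero_mult_div_cancel_right less_irrefl mult.assoc power2_eq_square)
    also have "2 * pi * U z - a * (2 * pi * \<nu>) = 2 * pi * (U z - a * \<nu>)" by (simp add: algebra_simps)
    also have "K * (d\<^sup>2 + d * l) * (2 * pi) + K * d * l * (2 * pi) = 2 * pi * (K * (d\<^sup>2 + 2 * l * d))"
      by (simp add: algebra_simps)
    finally have "2 * pi * \<bar>U z - a * \<nu>\<bar> \<le> 2 * pi * (K * (d\<^sup>2 + 2 * l * d))"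
      unfolding real_norm_def abs_mult[of "2 * pi"] by simp
    then show "\<bar>U z - (1 - (norm z)\<^sup>2) * \<nu>\<bar> \<le>
       K * ((norm (1 - z))\<^sup>2 + 2 * sqrt (1 - (norm z)\<^sup>2) * norm (1 - z))"
      unfolding a_def[symmetric] l_def[symmetric] d_def[symmetric]
      using pi_gt_zero by (simp only: mult_le_cancel_left_pos mult_pos_pos zero_less_numeral)
  qed
qed

section \<open>Geometry at the boundary point\<close>

text \<open>A 2 by 2 matrix with orthonormal rows has orthonormal columns.\<close>

lemma orthonormal_frame_expand:
  assumes "orthonormal_frame e1 e2"
  shows "p = (p \<bullet> e1) *\<^sub>R e1 + (p \<bullet> e2) *\<^sub>R e2"
proof -
  define a b c d where "a = e1 $ 1" "b = e1 $ 2" "c = e2 $ 1" "d = e2 $ 2"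
  have "e1 \<bullet> e1 = 1" "e2 \<bullet> e2 = 1" "e1 \<bullet> e2 = 0"
    using assms unfolding orthonormal_frame_def orthogonal_def by (simp_all add: norm_eq_1)
  then have 1: "a * a + b * b = 1" "c * c + d * d = 1" "a * c + b * d = 0"
    by (simp_all add: inner_vec_def sum_2 a_b_c_d_def)
  have "a * a + c * c = 1" "a * b + c * d = 0" "b * b + d * d = 1"
    using 1 by algebra+
  moreover have "(x * a + y * b) * a + (x * c + y * d) * c = x * (a * a + c * c) + y * (a * b + c * d)"
    "(x * a + y * b) * b + (x * c + y * d) * d = x * (a * b + c * d) + y * (b * b + d * d)" for x y
    by (simp_all add: algebra_simps)
  ultimately have "(x * a + y * b) * a + (x * c + y * d) * c = x"
    "(x * a + y * b) * b + (x * c + y * d) * d = y" for x y by simp_all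
  then show ?thesis
    by (simp add: vec_eq_iff forall_2 inner_vec_def sum_2 a_b_c_d_def)
qed

text \<open>The condition on balls carries the threshold M0 r^2 with the radius of the ball;
  choosing \<open>r\<close> slightly above \<open>norm p\<close> turns it into a pointwise parabolic
  one.\<close>

lemma quadratic_epigraph_interior:
  assumes q: "\<And>r. 0 < r \<Longrightarrow> r < r0 \<Longrightarrow> {p \<in> ball 0 r. p \<bullet> e2 > M0 * r\<^sup>2} \<subseteq> (U :: 'a::euclidean_space set)"
    and M0: "M0 > 0" and p: "norm p < r0" "M0 * (norm p)\<^sup>2 < p \<bullet> e2"
  shows "p \<in> U"
proof -
  have "(norm p)\<^sup>2 < p \<bullet> e2 / M0" using p(2) M0 by (simp add: field_simps)
  then have "norm p < sqrt (p \<bullet> e2 / M0)" by (rule real_less_rsqrt)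
  with p(1) obtain r where r: "norm p < r" "r < min r0 (sqrt (p \<bullet> e2 / M0))"
    using dense[of "norm p" "min r0 (sqrt (p \<bullet> e2 / M0))"] by auto
  have r0: "0 < r" using r(1) norm_ge_zero[of p] by linarith
  have "0 < p \<bullet> e2 / M0" using p(2) M0 by (smt (verit) divide_pos_pos mult_nonneg_nonneg zero_le_power2)
  then have "r\<^sup>2 < p \<bullet> e2 / M0"
    using r(2) r0 real_sqrt_less_iff[of "r\<^sup>2" "p \<bullet> e2 / M0"] by simp
  then have "M0 * r\<^sup>2 < p \<bullet> e2" using M0 by (simp add: field_simps)
  then show ?thesis using q[OF r0] r by auto
qed

text \<open>Unless \<open>c\<close> is opposite to \<open>e2\<close>, the bisecting direction
  \<open>d = e2 + c / R\<close> has positive inner product with both vectors. A short multiple of it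
  then lies in the parabolic region inside \<open>U\<close> and in the exterior ball at
  once.\<close>

lemma exterior_ball_center:
  fixes U :: "'a::euclidean_space set"
  assumes int: "\<And>p. norm p < r0 \<Longrightarrow> M0 * (norm p)\<^sup>2 < p \<bullet> e2 \<Longrightarrow> p \<in> U"
    and pos: "M0 > 0" "r0 > 0" and e2: "norm e2 = 1"
    and c: "norm c = 1 / M0" "ball c (1 / M0) \<subseteq> - U"
  shows "c = - (1 / M0) *\<^sub>R e2"
proof -
  define R where "R = 1 / M0"
  have R: "R > 0" "M0 * R = 1" using pos by (auto simp: R_def)
  define k where "k = 1 + c \<bullet> e2 / R"
  have ee: "e2 \<bullet> e2 = 1" using e2 by (simp add: norm_eq_1)
  have cc: "c \<bullet> c = R\<^sup>2" using c(1) by (simp add: R_def power2_norm_eq_inner[symmetric])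
  have "\<bar>c \<bullet> e2\<bar> \<le> R" using Cauchy_Schwarz_ineq2[of c e2] c(1) e2 by (simp add: R_def)
  then have k: "0 \<le> k" "k \<le> 2" using R by (auto simp: k_def field_simps abs_le_iff)
  have "k = 0"
  proof (rule ccontr)
    assume "k \<noteq> 0"
    then have k0: "k > 0" using k by simp
    define d where "d = e2 + (1 / R) *\<^sub>R c"
    \<comment> \<open>The first bound makes the quadratic term in the parabolic condition at most
      half of the linear one; the second keeps the point within r0 / 2, since \<open>norm d\<close>
      is at most 2.\<close>
    define \<tau> where "\<tau> = min (R / 4) (r0 / 4)"
    have \<tau>: "0 < \<tau>" "\<tau> \<le> R / 4" "\<tau> \<le> r0 / 4" using R pos by (auto simp: \<tau>_def)
    have de: "d \<bullet> e2 = k" by (simp add: d_def k_def inner_add_left ee)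
    have dc: "d \<bullet> c = R * k"
      using R by (simp add: d_def k_def inner_add_left cc inner_commute[of e2 c] field_simps power2_eq_square)
    have dd: "d \<bullet> d = 2 * k"
    proof -
      have "d \<bullet> d = d \<bullet> e2 + (1 / R) * (d \<bullet> c)"
        by (subst (2) d_def) (simp add: inner_add_right)
      then show ?thesis using de dc R by simp
    qed
    have nd: "(norm d)\<^sup>2 = 2 * k" using dd by (simp add: power2_norm_eq_inner)
    then have "(norm d)\<^sup>2 \<le> 2\<^sup>2" using k by simp
    then have nd2: "norm d \<le> 2" by (rule power2_le_imp_le) simp
    have "\<tau> *\<^sub>R d \<in> U"
    proof (rule int)
      have "\<tau> * norm d \<le> r0 / 4 * 2" using \<tau> nd2 by (intro mult_mono) auto
      then show "norm (\<tau> *\<^sub>R d) < r0" using \<tau>(1) pos by simp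
      have "M0 * (norm (\<tau> *\<^sub>R d))\<^sup>2 = (2 * M0 * \<tau>) * (\<tau> * k)"
        using nd \<tau>(1) by (simp add: power_mult_distrib power2_eq_square)
      also have "\<dots> < 1 * (\<tau> * k)"
      proof (rule mult_strict_right_mono)
        have "2 * M0 * \<tau> \<le> 2 * M0 * (R / 4)" using \<tau> pos by (intro mult_left_mono) auto
        then show "2 * M0 * \<tau> < 1" using R by simp
      qed (use \<tau> k0 in simp)
      finally show "M0 * (norm (\<tau> *\<^sub>R d))\<^sup>2 < (\<tau> *\<^sub>R d) \<bullet> e2" by (simp add: de)
    qed
    moreover have "\<tau> *\<^sub>R d \<in> ball c R"
    proof -
      have "(norm (c - \<tau> *\<^sub>R d))\<^sup>2 = R\<^sup>2 - 2 * \<tau> * k * (R - \<tau>)"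
        unfolding power2_norm_eq_inner
        by (simp add: inner_diff_left inner_diff_right cc dc dd inner_commute[of c d] algebra_simps)
      also have "\<dots> < R\<^sup>2" using \<tau> k0 R by simp
      finally have "norm (c - \<tau> *\<^sub>R d) < R" using R by (metis less_imp_le power2_less_imp_less)
      then show ?thesis by (simp add: dist_norm)
    qed
    ultimately show False using c(2) by (auto simp: R_def)
  qed
  then have ce: "c \<bullet> e2 = - R" using R by (simp add: k_def field_simps)
  have "(c + R *\<^sub>R e2) \<bullet> (c + R *\<^sub>R e2) = 0"
    by (simp add: inner_add_left inner_add_right cc ce ee inner_commute[of e2 c] power2_eq_square)
  then have "c + R *\<^sub>R e2 = 0" by simp
  then show ?thesis by (simp add: R_def eq_neg_iff_add_eq_0)
qed

text \<open>The exterior ball may be much larger than \<open>r0\<close>, and then its barrier would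
  leave the region where \<open>w\<close> is controlled. Moving to radius \<open>s\<close> along the
  ray through \<open>p\<close> keeps the distance from \<open>p\<close> to the ball equal to |n| -
  R. As the new centre has norm below 3 s, its ball of radius 2 s lies within 5 s < r0. The stated
  height is (|n|^2 - R^2) / (2 R), which bounds |n| - R because |n| \<ge> R.\<close>

lemma linear_growth_near_exterior_ball:
  fixes w :: "'a::euclidean_space \<Rightarrow> real"
  assumes dim: "DIM('a) = 2" and w: "integrable lebesgue w"
    and sub: "\<And>p r. 0 < r \<Longrightarrow> cball p r \<subseteq> ball 0 (2 * r0) \<Longrightarrow> w p \<le> wavg r w p"
    and A: "A \<ge> 0" "\<And>x. x \<in> ball 0 r0 \<Longrightarrow> w x \<le> A"
    and R: "R > 0" "norm e2 = 1" and z: "\<And>x. x \<in> ball (- R *\<^sub>R e2) R \<Longrightarrow> w x = 0"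
    and s: "0 < s" "s \<le> R" "8 * s \<le> r0" and p: "norm p < s" "p \<notin> ball (- R *\<^sub>R e2) R"
  shows "w p \<le> 8 / 3 * A / s * (p \<bullet> e2 + (norm p)\<^sup>2 / (2 * R))" "0 \<le> p \<bullet> e2 + (norm p)\<^sup>2 / (2 * R)"
proof -
  define n where "n = p + R *\<^sub>R e2"
  have pn: "p - (- R *\<^sub>R e2) = n" by (simp add: n_def)
  have nR: "R \<le> norm n"
    using p(2) by (simp add: dist_norm norm_minus_commute[of _ p] n_def add.commute norm_minus_cancel[symmetric, of "- (R *\<^sub>R e2) - p"] del: norm_minus_cancel)
  have n_le: "norm n \<le> norm p + R"
    using norm_triangle_ineq[of p "R *\<^sub>R e2"] R by (simp add: n_def)
  have n0: "norm n > 0" using nR R(1) by linarith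
  define c' where "c' = - R *\<^sub>R e2 + ((R - s) / norm n) *\<^sub>R n"
  have "p - c' = n - ((R - s) / norm n) *\<^sub>R n" by (simp add: c'_def n_def)
  also have "\<dots> = (1 - (R - s) / norm n) *\<^sub>R n" by (simp add: scaleR_diff_left)
  finally have "norm (p - c') = \<bar>1 - (R - s) / norm n\<bar> * norm n" by simp
  also have "\<dots> = \<bar>(1 - (R - s) / norm n) * norm n\<bar>" by (simp add: abs_mult)
  also have "(1 - (R - s) / norm n) * norm n = norm n - (R - s)" using n0 by (simp add: field_simps)
  finally have pc: "norm (p - c') = norm n - R + s" using nR s by simp
  have cc: "norm (c' - (- R *\<^sub>R e2)) = R - s" using n0 s by (simp add: c'_def)
  have c': "norm c' < 3 * s"
  proof -
    have "norm c' \<le> norm p + norm (p - c')" using norm_triangle_ineq4[of p "p - c'"] by simp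
    then show ?thesis using pc n_le p(1) by linarith
  qed
  have sub': "ball c' (2 * s) \<subseteq> ball 0 r0"
  proof
    fix x assume "x \<in> ball c' (2 * s)"
    then have "norm (x - c') < 2 * s" by (simp add: dist_norm norm_minus_commute)
    then have "norm x < 5 * s" using c' norm_triangle_ineq[of "x - c'" c'] by simp
    then show "x \<in> ball 0 r0" using s by simp
  qed
  have sub2: "ball 0 r0 \<subseteq> ball (0::'a) (2 * r0)" using s by (intro subset_ball) auto
  have "w p \<le> 8 / 3 * A / s * (norm (p - c') - s)"
  proof (rule exterior_ball_linear_bound[OF dim w])
    show "A \<ge> 0" "0 < s" by (rule A(1), rule s(1))
    show "w q \<le> wavg r w q" if "0 < r" "cball q r \<subseteq> ball c' (2 * s)" for q r
      by (rule sub[OF that(1)]) (use that(2) sub' sub2 in blast)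
    show "w x \<le> A" if "x \<in> ball c' (2 * s)" for x using A(2) sub' that by blast
    show "w x = 0" if "x \<in> ball c' s" for x
    proof (rule z)
      have "norm (x - (- R *\<^sub>R e2)) \<le> norm (x - c') + norm (c' - (- R *\<^sub>R e2))"
        by (rule norm_diff_triangle_le) auto
      also have "\<dots> < R" using that cc by (simp add: dist_norm norm_minus_commute)
      finally show "x \<in> ball (- R *\<^sub>R e2) R" by (simp only: mem_ball dist_norm norm_minus_commute[of _ x])
    qed
    show "s \<le> norm (p - c')" using pc nR by simp
    show "norm (p - c') < 2 * s" using pc n_le p(1) by linarith
  qed
  also have "norm (p - c') - s = norm n - R" using pc by simp
  finally have w1: "w p \<le> 8 / 3 * A / s * (norm n - R)" .
  have "(norm n)\<^sup>2 = (norm p)\<^sup>2 + 2 * R * (p \<bullet> e2) + R\<^sup>2"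
    using R(2) unfolding n_def power2_norm_eq_inner
    by (simp add: inner_add_left inner_add_right inner_commute[of e2 p] norm_eq_1 power2_eq_square distrib_left)
  moreover have "(norm n - R) * (2 * R) \<le> (norm n - R) * (norm n + R)"
    using nR by (intro mult_left_mono) auto
  ultimately have "(norm n - R) * (2 * R) \<le> (norm p)\<^sup>2 + 2 * R * (p \<bullet> e2)"
    by (simp add: algebra_simps power2_eq_square)
  then have "norm n - R \<le> ((norm p)\<^sup>2 + 2 * R * (p \<bullet> e2)) / (2 * R)"
    using R by (simp add: pos_le_divide_eq)
  then have d: "norm n - R \<le> p \<bullet> e2 + (norm p)\<^sup>2 / (2 * R)"
    using R by (simp add: add_divide_distrib add.commute)
  then show "0 \<le> p \<bullet> e2 + (norm p)\<^sup>2 / (2 * R)" using nR by linarith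
  have "8 / 3 * A / s * (norm n - R) \<le> 8 / 3 * A / s * (p \<bullet> e2 + (norm p)\<^sup>2 / (2 * R))"
    using d A(1) s(1) by (intro mult_left_mono) auto
  with w1 show "w p \<le> 8 / 3 * A / s * (p \<bullet> e2 + (norm p)\<^sup>2 / (2 * R))" by linarith
qed


text \<open>The inequality for \<open>norm p\<close> describes the open disc of radius
  \<open>t\<close> about t e2. \<open>T\<close> maps the unit disc onto it with real axis along -e2,
  so that 1 goes to 0 and 1 - Re z is the height over \<open>t\<close>. On the circle the height is
  |p|^2 / (2 t), so linear growth becomes quadratic decay and the boundary expansion applies.
  Inside, 1 - |z|^2 is 2 (p, e2) / t - |1 - z|^2, which gives the slope 2 \<nu> / t and one more
  error term.\<close>

lemma tangent_disc_estimate: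
  fixes U :: "'a::euclidean_space set"
  assumes U: "open U" and u: "harmonic_on u U"
    and e: "e1 \<bullet> e1 = 1" "e2 \<bullet> e2 = 1" "e1 \<bullet> e2 = 0"
    and complete: "\<And>p :: 'a. p = (p \<bullet> e1) *\<^sub>R e1 + (p \<bullet> e2) *\<^sub>R e2"
    and t: "0 < t" "0 < M0" "M0 * t \<le> 1 / 16"
    and int: "\<And>p. norm p < 4 * t \<Longrightarrow> M0 * (norm p)\<^sup>2 < p \<bullet> e2 \<Longrightarrow> p \<in> U"
    and A: "A \<ge> 0"
    and lin: "\<And>p. p \<in> U \<Longrightarrow> norm p < 4 * t \<Longrightarrow> \<bar>u p\<bar> \<le> 2 / 3 * A / t * (p \<bullet> e2 + M0 * (norm p)\<^sup>2 / 2)"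
  shows "\<exists>\<nu>. \<bar>\<nu>\<bar> \<le> A \<and> (\<forall>p. (norm p)\<^sup>2 < 2 * t * (p \<bullet> e2) \<longrightarrow>
     p \<in> U \<and> \<bar>u p - 2 * \<nu> / t * (p \<bullet> e2)\<bar> \<le> 6 * A * ((norm p / t) * sqrt (norm p / t)))"
proof -
  define T where "T z = t *\<^sub>R e2 + Re z *\<^sub>R (t *\<^sub>R - e2) + Im z *\<^sub>R (t *\<^sub>R e1)" for z
  have T_eq: "T z = (t * (1 - Re z)) *\<^sub>R e2 + (t * Im z) *\<^sub>R e1" for z
    by (simp add: T_def algebra_simps)
  have e21: "e2 \<bullet> e1 = 0" using e(3) by (simp add: inner_commute)
  have T2: "T z \<bullet> e2 = t * (1 - Re z)" and T1: "T z \<bullet> e1 = t * Im z" for z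
    unfolding T_eq by (simp_all add: inner_add_left e e21)
  have nsq: "(norm (1 - z))\<^sup>2 = (1 - Re z)\<^sup>2 + (Im z)\<^sup>2" for z by (simp add: cmod_power2)
  have "(norm (T z))\<^sup>2 = t\<^sup>2 * (norm (1 - z))\<^sup>2" for z
    unfolding nsq unfolding power2_norm_eq_inner T_eq
    by (simp add: inner_add_left inner_add_right e e21 power2_eq_square algebra_simps)
  then have "(norm (T z))\<^sup>2 = (t * norm (1 - z))\<^sup>2" for z by (simp add: power_mult_distrib)
  then have nT: "norm (T z) = t * norm (1 - z)" for z
    using t(1) by (metis abs_ge_zero abs_norm_cancel less_imp_le mult_nonneg_nonneg power2_eq_imp_eq norm_ge_zero)
  have zsq: "(norm z)\<^sup>2 = 1 - 2 * (1 - Re z) + (norm (1 - z))\<^sup>2" for z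
    unfolding nsq cmod_power2[of z] by (simp add: power2_eq_square algebra_simps)
  have near: "norm (1 - z) \<le> 2" if "norm z \<le> 1" for z :: complex
    using norm_triangle_ineq4[of 1 z] that by simp
  have nT4: "norm (T z) < 4 * t" if "norm z \<le> 1" for z
  proof -
    have "t * norm (1 - z) \<le> t * 2" using near[OF that] t(1) by (intro mult_left_mono) auto
    then show ?thesis using t(1) by (simp add: nT)
  qed
  have TU: "T z \<in> U" if z: "norm z \<le> 1" "z \<noteq> 1" for z
  proof (rule int[OF nT4[OF z(1)]])
    have "(norm z)\<^sup>2 \<le> 1" using z(1) by (simp add: power_le_one)
    then have le: "(norm (1 - z))\<^sup>2 \<le> 2 * (1 - Re z)" using zsq[of z] by linarith
    have "0 < (norm (1 - z))\<^sup>2" using z(2) by simp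
    then have "0 < 2 * (1 - Re z)" using le by (rule order.strict_trans2)
    then have pos: "0 < 1 - Re z" by simp
    have "M0 * (norm (T z))\<^sup>2 = (M0 * t) * t * (norm (1 - z))\<^sup>2"
      unfolding nT by (simp add: power2_eq_square)
    also have "\<dots> \<le> (1 / 16) * t * (2 * (1 - Re z))"
      using t le by (intro mult_mono) auto
    also have "\<dots> < T z \<bullet> e2" unfolding T2 using t(1) pos by simp
    finally show "M0 * (norm (T z))\<^sup>2 < T z \<bullet> e2" .
  qed
  \<comment> \<open>\<open>T 1 = 0\<close> is the boundary point, where the value of
    \<open>u\<close> carries no information; \<open>V_lin\<close> shows that 0 is the limit
    there.\<close>
  define V where "V z = (if z = 1 then 0 else u (T z))" for z
  have ucont: "continuous_on U u" using u Ck_on_continuous unfolding harmonic_on_def by blast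
  have Tcont: "continuous_on S T" for S unfolding T_def by (intro continuous_intros)
  have V_lin: "\<bar>V z\<bar> \<le> 2 / 3 * A / t * (t * (1 - Re z) + M0 * (t * norm (1 - z))\<^sup>2 / 2)" if "norm z \<le> 1" for z
  proof (cases "z = 1")
    case False
    then show ?thesis using lin[OF TU[OF that False] nT4[OF that]] unfolding V_def T2 nT by simp
  qed (simp add: V_def)
  have Vc: "continuous_on (cball 0 1) V"
    unfolding continuous_on_def
  proof
    fix z :: complex assume z: "z \<in> cball 0 1"
    show "(V \<longlongrightarrow> V z) (at z within cball 0 1)"
    proof (cases "z = 1")
      case True
      have "((\<lambda>z. 2 / 3 * A / t * (t * (1 - Re z) + M0 * (t * norm (1 - z))\<^sup>2 / 2)) \<longlongrightarrow>
          2 / 3 * A / t * (t * (1 - Re 1) + M0 * (t * norm (1 - 1 :: complex))\<^sup>2 / 2)) (at 1 within cball 0 1)"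
        by (intro tendsto_intros) (use t in auto)
      then have lim: "((\<lambda>z. 2 / 3 * A / t * (t * (1 - Re z) + M0 * (t * norm (1 - z))\<^sup>2 / 2)) \<longlongrightarrow> 0) (at 1 within cball 0 1)"
        by simp
      have "(V \<longlongrightarrow> 0) (at 1 within cball 0 1)"
        by (rule Lim_null_comparison[OF _ lim])
          (use V_lin in \<open>auto simp: eventually_at_filter\<close>)
      moreover have "V 1 = 0" by (simp add: V_def)
      ultimately show ?thesis using True by simp
    next
      case False
      have "continuous_on (cball 0 1 - {1}) (\<lambda>z. u (T z))"
      proof (rule continuous_on_compose2[OF ucont Tcont], rule image_subsetI)
        show "T x \<in> U" if "x \<in> cball 0 1 - {1}" for x
          by (rule TU) (use that in simp_all)
      qed
      then have "((\<lambda>z. u (T z)) \<longlongrightarrow> u (T z)) (at z within (cball 0 1 - {1}))"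
        using z False by (auto simp: continuous_on_def)
      moreover have "at z within (cball 0 1 - {1}) = at z within cball 0 1"
        by (rule at_within_nhd[of _ "- {1}"]) (use False in auto)
      ultimately have "((\<lambda>z. u (T z)) \<longlongrightarrow> u (T z)) (at z within cball 0 1)" by simp
      moreover have "eventually (\<lambda>w. u (T w) = V w) (at z within cball 0 1)"
        unfolding eventually_at_topological
        by (intro exI[of _ "- {1}"]) (use False in \<open>auto simp: V_def\<close>)
      ultimately have "(V \<longlongrightarrow> u (T z)) (at z within cball 0 1)" by (rule Lim_transform_eventually)
      then show ?thesis using False by (simp add: V_def)
    qed
  qed
  have bdry: "\<bar>V w\<bar> \<le> A * (norm (w - 1))\<^sup>2" if w: "norm w = 1" for w
  proof -
    define q where "q = (norm (1 - w))\<^sup>2"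
    have q: "q \<ge> 0" by (simp add: q_def)
    have re: "1 - Re w = q / 2" using zsq[of w] w by (simp add: q_def)
    have "\<bar>V w\<bar> \<le> 2 / 3 * A / t * (t * (1 - Re w) + M0 * (t * norm (1 - w))\<^sup>2 / 2)"
      using V_lin[of w] w by simp
    also have "\<dots> = 2 / 3 * A * (q / 2 + (M0 * t) * q / 2)"
      unfolding re power_mult_distrib q_def[symmetric] using t(1)
      by (simp add: power2_eq_square[of t] field_simps)
    also have "\<dots> \<le> 2 / 3 * A * (q / 2 + (1 / 16) * q / 2)"
      using A q t by (intro mult_left_mono add_left_mono divide_right_mono mult_right_mono) auto
    \<comment> \<open>The numerical factor is 2/3 * 17/32, that is 17/48.\<close>
    also have "\<dots> \<le> A * q" using mult_nonneg_nonneg[OF A q] by simp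
    finally show ?thesis by (simp add: q_def norm_minus_commute)
  qed
  obtain F where F: "F holomorphic_on ball 0 1" "\<And>z. z \<in> ball 0 1 \<Longrightarrow> Re (F z) = u (T z)"
  proof (rule harmonic_eq_Re_holomorphic[OF U u, of "- e2" e1 "t *\<^sub>R e2" t])
    show "p = (p \<bullet> - e2) *\<^sub>R - e2 + (p \<bullet> e1) *\<^sub>R e1" for p
      using complete[of p] by (simp add: add.commute)
    show "t *\<^sub>R e2 + Re z *\<^sub>R t *\<^sub>R - e2 + Im z *\<^sub>R t *\<^sub>R e1 \<in> U" if "z \<in> ball 0 1" for z
    proof -
      have "norm z \<le> 1" "z \<noteq> 1" using that by auto
      from TU[OF this] show ?thesis unfolding T_def .
    qed
  qed (use e e21 that in \<open>auto simp: T_def\<close>)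
  have FV: "Re (F z) = V z" if "z \<in> ball 0 1" for z
    using F(2)[OF that] that by (auto simp: V_def)
  obtain \<nu> where \<nu>: "\<bar>\<nu>\<bar> \<le> A" and exp: "\<And>z. norm z < 1 \<Longrightarrow> \<bar>V z - (1 - (norm z)\<^sup>2) * \<nu>\<bar> \<le>
       A * ((norm (1 - z))\<^sup>2 + 2 * sqrt (1 - (norm z)\<^sup>2) * norm (1 - z))"
    by (rule boundary_expansion[OF Vc F(1) FV bdry]) auto
  show ?thesis
  proof (intro exI[of _ \<nu>] conjI[OF \<nu>] allI impI)
    fix p assume p: "(norm p)\<^sup>2 < 2 * t * (p \<bullet> e2)"
    define z where "z = Complex (1 - p \<bullet> e2 / t) (p \<bullet> e1 / t)"
    have Tz: "T z = p"
      using t(1) complete[of p] unfolding T_eq z_def by (simp add: add.commute)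
    have np: "norm p / t = norm (1 - z)" using nT[of z] Tz t(1) by simp
    have re: "1 - Re z = (p \<bullet> e2) / t" by (simp add: z_def)
    have z1: "norm z < 1"
    proof -
      have "(norm (1 - z))\<^sup>2 < 2 * (1 - Re z)"
        unfolding np[symmetric] re using p t(1)
        by (simp add: power_divide divide_simps) (simp add: power2_eq_square mult_ac)
      then have "(norm z)\<^sup>2 < 1\<^sup>2" using zsq[of z] by simp
      then show ?thesis by (rule power2_less_imp_less) simp
    qed
    then have "z \<noteq> 1" by auto
    then have pU: "p \<in> U" and Vz: "V z = u p" using TU[of z] z1 Tz by (auto simp: V_def)
    define d where "d = norm (1 - z)"
    have d: "0 \<le> d" "d \<le> 2" using near[of z] z1 by (auto simp: d_def)
    have d_sq: "d\<^sup>2 \<le> sqrt 2 * (d * sqrt d)"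
    proof -
      have "d\<^sup>2 = (d * sqrt d) * sqrt d" using d(1) by (simp add: power2_eq_square mult.assoc)
      also have "\<dots> \<le> (d * sqrt d) * sqrt 2" using d by (intro mult_left_mono) auto
      finally show ?thesis by (simp add: mult.commute)
    qed
    \<comment> \<open>The source of the exponent 3/2: for tangential as well as radial approach,
      sqrt(1 - |z|^2) d is at most a multiple of d sqrt d. The quadratic terms are absorbed because
      \<open>d\<close> is at most 2.\<close>
    have "1 - (norm z)\<^sup>2 \<le> 2 * d"
    proof -
      have "1 - Re z \<le> d" unfolding d_def using complex_Re_le_cmod[of "1 - z"] by simp
      moreover have "1 - (norm z)\<^sup>2 = 2 * (1 - Re z) - (norm (1 - z))\<^sup>2" by (simp add: zsq[of z])
      moreover have "2 * (1 - Re z) - (norm (1 - z))\<^sup>2 \<le> 2 * (1 - Re z)" by simp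
      ultimately show ?thesis by (metis mult_left_mono order_trans zero_le_numeral)
    qed
    then have sq: "sqrt (1 - (norm z)\<^sup>2) \<le> sqrt 2 * sqrt d"
      by (simp add: real_sqrt_mult[symmetric])
    have "\<bar>V z - (1 - (norm z)\<^sup>2) * \<nu>\<bar> \<le> A * (d\<^sup>2 + 2 * sqrt (1 - (norm z)\<^sup>2) * d)"
      using exp[OF z1] by (simp add: d_def)
    also have "\<dots> \<le> A * (sqrt 2 * (d * sqrt d) + 2 * (sqrt 2 * sqrt d) * d)"
      using A d_sq sq d(1) by (intro mult_left_mono add_mono mult_right_mono) auto
    also have "\<dots> = 3 * sqrt 2 * A * (d * sqrt d)" by (simp add: algebra_simps)
    finally have 1: "\<bar>V z - (1 - (norm z)\<^sup>2) * \<nu>\<bar> \<le> 3 * sqrt 2 * A * (d * sqrt d)" .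
    have "\<bar>d\<^sup>2 * \<nu>\<bar> \<le> d\<^sup>2 * A" using \<nu> by (simp add: abs_mult mult_left_mono)
    also have "\<dots> \<le> sqrt 2 * (d * sqrt d) * A" using d_sq A by (rule mult_right_mono)
    finally have 2: "\<bar>d\<^sup>2 * \<nu>\<bar> \<le> sqrt 2 * A * (d * sqrt d)" by (simp add: mult_ac)
    have "u p - 2 * \<nu> / t * (p \<bullet> e2) = (V z - (1 - (norm z)\<^sup>2) * \<nu>) - d\<^sup>2 * \<nu>"
      unfolding Vz zsq[of z] re d_def[symmetric] by (simp add: algebra_simps)
    then have "\<bar>u p - 2 * \<nu> / t * (p \<bullet> e2)\<bar> \<le> 3 * sqrt 2 * A * (d * sqrt d) + sqrt 2 * A * (d * sqrt d)"
      using 1 2 by linarith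
    also have "\<dots> = (4 * sqrt 2) * (A * (d * sqrt d))" by (simp add: algebra_simps)
    also have "\<dots> \<le> 6 * (A * (d * sqrt d))"
    proof (rule mult_right_mono)
      have "sqrt 2 \<le> 3 / 2" by (rule real_le_lsqrt) (auto simp: power2_eq_square)
      then show "4 * sqrt 2 \<le> 6" by simp
    qed (use A d in simp)
    finally show "p \<in> U \<and> \<bar>u p - 2 * \<nu> / t * (p \<bullet> e2)\<bar> \<le> 6 * A * ((norm p / t) * sqrt (norm p / t))"
      using pU unfolding np d_def by (simp add: mult.assoc)
  qed
qed

text \<open>\<open>A\<close> is the supremum bound from averages of radius \<open>r0 / 2\<close>.
  With s = 4 t, the bound s \<le> 1 / (4 M0) gives M0 t \<le> 1/16, so that the tangent disc lies in
  the parabolic region, and 8 s \<le> r0 leaves room for the barrier. In units of \<open>t\<close>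
  the three cases are: distance at least 4, where boundedness by \<open>A\<close> is enough; the
  tangent disc; and the rest of the ball of radius 4, where both terms are of order distance squared
  and a bounded distance lowers the power to 3/2.\<close>

lemma linear_approximation_at_boundary:
  fixes U :: "'a::euclidean_space set" and u :: "'a \<Rightarrow> real"
  assumes dim: "DIM('a) = 2" and U: "open U"
    and u: "harmonic_on u U" "vanishes_on_boundary U u"
    and e: "e1 \<bullet> e1 = 1" "e2 \<bullet> e2 = 1" "e1 \<bullet> e2 = 0"
    and complete: "\<And>p :: 'a. p = (p \<bullet> e1) *\<^sub>R e1 + (p \<bullet> e2) *\<^sub>R e2"
    and pos: "0 < M0" "0 < r0"
    and int: "\<And>p. norm p < r0 \<Longrightarrow> M0 * (norm p)\<^sup>2 < p \<bullet> e2 \<Longrightarrow> p \<in> U"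
    and ext: "ball (- (1 / M0) *\<^sub>R e2) (1 / M0) \<subseteq> - U"
  defines "t \<equiv> min (1 / (4 * M0)) (r0 / 8) / 4"
    and "A \<equiv> 2 * sup_const TYPE('a) / r0 * L2_norm (U \<inter> ball 0 (2 * r0)) u"
  shows "\<exists>v. \<forall>p\<in>U. norm p < r0 \<longrightarrow> \<bar>u p - p \<bullet> v\<bar> \<le> 6 * A * ((norm p / t) * sqrt (norm p / t))"
proof -
  define s where "s = min (1 / (4 * M0)) (r0 / 8)"
  have s: "0 < s" "s \<le> 1 / (4 * M0)" "8 * s \<le> r0" using pos by (auto simp: s_def)
  have ts: "s = 4 * t" by (simp add: t_def s_def)
  have t: "0 < t" using s ts by simp
  have M0s: "M0 * s \<le> 1 / 4"
    using mult_left_mono[OF s(2), of M0] pos by simp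
  then have M0t: "M0 * t \<le> 1 / 16" by (simp add: ts)
  have sR: "s \<le> 1 / M0"
  proof -
    have "1 / (4 * M0) \<le> 1 / M0" using pos by (intro divide_left_mono) auto
    then show ?thesis using s(2) by simp
  qed
  define w where "w = abs_zero_ext (U \<inter> ball 0 (2 * r0)) u"
  have "2 * r0 > 0" using pos by simp
  note w = abs_zero_ext_submean[OF dim U u this, folded w_def]
  have sup0: "0 \<le> sup_const TYPE('a)"
    unfolding sup_const_def using bump_mass_pos[where 'a='a] by (intro divide_nonneg_pos) auto
  have A0: "A \<ge> 0" unfolding A_def using pos sup0 by (simp add: L2_norm_nonneg)
  have w_le: "w x \<le> A" if "x \<in> ball 0 r0" for x
  proof -
    have "cball x (r0 / 2) \<subseteq> ball 0 (2 * r0)"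
    proof
      fix y assume "y \<in> cball x (r0 / 2)"
      then have "norm (y - x) \<le> r0 / 2" by (simp add: dist_norm norm_minus_commute)
      then show "y \<in> ball 0 (2 * r0)"
        using that pos norm_triangle_ineq[of "y - x" x] by simp
    qed
    then have "w x \<le> wavg (r0 / 2) w x" using pos by (intro w(4)) auto
    also have "\<dots> \<le> sup_const TYPE('a) / (r0 / 2) * L2_norm UNIV w"
      using pos by (intro wavg_le_L2_norm[OF dim w(2)]) auto
    also have "\<dots> = A" by (simp add: w(3) A_def)
    finally show ?thesis .
  qed
  have w_u: "w p = \<bar>u p\<bar>" if "p \<in> U" "norm p < r0" for p
    using that pos by (simp add: w_def abs_zero_ext_def)
  have u_le: "\<bar>u p\<bar> \<le> A" if "p \<in> U" "norm p < r0" for p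
    using w_le[of p] w_u[OF that] that by simp
  have ne2: "norm e2 = 1" using e(2) by (simp add: norm_eq_1)
  have R0: "0 < 1 / M0" using pos by simp
  have near: "\<bar>u p\<bar> \<le> 2 / 3 * A / t * (p \<bullet> e2 + M0 * (norm p)\<^sup>2 / 2)" "0 \<le> p \<bullet> e2 + M0 * (norm p)\<^sup>2 / 2"
    if p: "p \<in> U" "norm p < 4 * t" for p
  proof -
    have ps: "norm p < s" using p ts by simp
    have pb: "p \<notin> ball (- (1 / M0) *\<^sub>R e2) (1 / M0)" using ext p(1) by blast
    have wz: "w x = 0" if "x \<in> ball (- (1 / M0) *\<^sub>R e2) (1 / M0)" for x
      using subsetD[OF ext that] by (simp add: w_def abs_zero_ext_def)
    note l = linear_growth_near_exterior_ball[OF dim w(1,4) A0 w_le R0 ne2 wz s(1) sR s(3) ps pb]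
    have eq: "p \<bullet> e2 + (norm p)\<^sup>2 / (2 * (1 / M0)) = p \<bullet> e2 + M0 * (norm p)\<^sup>2 / 2" by simp
    show "0 \<le> p \<bullet> e2 + M0 * (norm p)\<^sup>2 / 2" using l(2) unfolding eq .
    have "norm p < r0" using ps s by simp
    moreover have "8 / 3 * A / s = 2 / 3 * A / t" using t by (simp add: ts)
    ultimately show "\<bar>u p\<bar> \<le> 2 / 3 * A / t * (p \<bullet> e2 + M0 * (norm p)\<^sup>2 / 2)"
      using l(1) w_u[OF p(1)] unfolding eq by simp
  qed
  have int': "p \<in> U" if "norm p < 4 * t" "M0 * (norm p)\<^sup>2 < p \<bullet> e2" for p
    using int[of p] that s ts by simp
  have "\<exists>\<nu>. \<bar>\<nu>\<bar> \<le> A \<and> (\<forall>p. (norm p)\<^sup>2 < 2 * t * (p \<bullet> e2) \<longrightarrow>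
       p \<in> U \<and> \<bar>u p - 2 * \<nu> / t * (p \<bullet> e2)\<bar> \<le> 6 * A * ((norm p / t) * sqrt (norm p / t)))"
    by (rule tangent_disc_estimate[OF U u(1) e complete t pos(1) M0t int' A0 near(1)])
  then obtain \<nu> where \<nu>: "\<bar>\<nu>\<bar> \<le> A" and disc: "\<And>p. (norm p)\<^sup>2 < 2 * t * (p \<bullet> e2) \<Longrightarrow>
       p \<in> U \<and> \<bar>u p - 2 * \<nu> / t * (p \<bullet> e2)\<bar> \<le> 6 * A * ((norm p / t) * sqrt (norm p / t))"
    by blast
  have "\<bar>u p - p \<bullet> ((2 * \<nu> / t) *\<^sub>R e2)\<bar> \<le> 6 * A * ((norm p / t) * sqrt (norm p / t))"
    if p: "p \<in> U" "norm p < r0" for p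
  proof -
    define d where "d = norm p / t"
    have d0: "d \<ge> 0" using t by (simp add: d_def)
    have npd: "norm p = t * d" using t by (simp add: d_def)
    have tri: "\<bar>u p - 2 * \<nu> / t * (p \<bullet> e2)\<bar> \<le> \<bar>u p\<bar> + 2 * A / t * \<bar>p \<bullet> e2\<bar>"
    proof -
      have "\<bar>2 * \<nu> / t * (p \<bullet> e2)\<bar> = 2 * \<bar>\<nu>\<bar> / t * \<bar>p \<bullet> e2\<bar>" using t by (simp add: abs_mult)
      also have "\<dots> \<le> 2 * A / t * \<bar>p \<bullet> e2\<bar>"
        using \<nu> t by (intro mult_right_mono divide_right_mono mult_left_mono) auto
      finally show ?thesis by linarith
    qed
    have "\<bar>u p - 2 * \<nu> / t * (p \<bullet> e2)\<bar> \<le> 6 * A * (d * sqrt d)"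
    proof (cases "norm p < 4 * t")
      case False
      then have "4 * t \<le> t * d" by (simp add: npd)
      then have d4: "4 \<le> d" using t by (simp add: mult.commute[of 4])
      have "\<bar>p \<bullet> e2\<bar> \<le> t * d" using Cauchy_Schwarz_ineq2[of p e2] ne2 by (simp add: npd)
      then have "2 * A / t * \<bar>p \<bullet> e2\<bar> \<le> 2 * A / t * (t * d)"
        using A0 t by (intro mult_left_mono) auto
      also have "\<dots> = A * (2 * d)" using t by simp
      finally have "\<bar>u p - 2 * \<nu> / t * (p \<bullet> e2)\<bar> \<le> A * 1 + A * (2 * d)"
        using tri u_le[OF p] by linarith
      also have "\<dots> = A * (1 + 2 * d)" by (simp add: algebra_simps)
      also have "\<dots> \<le> A * (6 * (d * sqrt d))"
      proof (rule mult_left_mono[OF _ A0])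
        have "1 \<le> sqrt d" using d4 by simp
        then have "d * 1 \<le> d * sqrt d" using d0 by (rule mult_left_mono)
        then show "1 + 2 * d \<le> 6 * (d * sqrt d)" using d4 by linarith
      qed
      finally show ?thesis by simp
    next
      case True
      show ?thesis
      proof (cases "(norm p)\<^sup>2 < 2 * t * (p \<bullet> e2)")
        case True
        then show ?thesis using disc[OF True] by (simp add: d_def)
      next
        case False
        have d4: "d \<le> 4" using \<open>norm p < 4 * t\<close> t by (simp add: npd mult.commute[of 4])
        have "2 * t * (p \<bullet> e2) \<le> (t * d)\<^sup>2" using False by (simp add: npd)
        then have "t * (2 * (p \<bullet> e2)) \<le> t * (t * d\<^sup>2)" by (simp add: power2_eq_square mult_ac)
        then have up: "p \<bullet> e2 \<le> t * d\<^sup>2 / 2" using t by simp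
        have "M0 * (norm p)\<^sup>2 = (M0 * t) * (t * d\<^sup>2)" by (simp add: npd power2_eq_square)
        also have "\<dots> \<le> (1 / 16) * (t * d\<^sup>2)" using M0t t by (intro mult_right_mono) auto
        finally have q: "M0 * (norm p)\<^sup>2 \<le> t * d\<^sup>2 / 16" by simp
        have td: "0 \<le> t * d\<^sup>2" using t by simp
        \<comment> \<open>The lower bound for the height expresses that \<open>p\<close> is outside
          the exterior ball; the upper bound \<open>up\<close> that it is outside the tangent disc.
          Together they squeeze the height to quadratic size.\<close>
        have lo: "- (t * d\<^sup>2 / 2) \<le> p \<bullet> e2" using near(2)[OF p(1) \<open>norm p < 4 * t\<close>] q td by linarith
        have "\<bar>u p\<bar> \<le> 2 / 3 * A / t * (p \<bullet> e2 + M0 * (norm p)\<^sup>2 / 2)"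
          by (rule near(1)[OF p(1) \<open>norm p < 4 * t\<close>])
        also have "\<dots> \<le> 2 / 3 * A / t * (t * d\<^sup>2)"
        proof (rule mult_left_mono)
          show "p \<bullet> e2 + M0 * (norm p)\<^sup>2 / 2 \<le> t * d\<^sup>2" using up q td by linarith
        qed (use A0 t in simp)
        also have "\<dots> = 2 / 3 * (A * d\<^sup>2)" using t by simp
        finally have 1: "\<bar>u p\<bar> \<le> 2 / 3 * (A * d\<^sup>2)" .
        have "2 * A / t * \<bar>p \<bullet> e2\<bar> \<le> 2 * A / t * (t * d\<^sup>2 / 2)"
          using up lo A0 t by (intro mult_left_mono) (auto simp: abs_le_iff)
        also have "\<dots> = A * d\<^sup>2" using t by simp
        finally have "\<bar>u p - 2 * \<nu> / t * (p \<bullet> e2)\<bar> \<le> 3 * (A * d\<^sup>2)"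
          using 1 tri mult_nonneg_nonneg[OF A0 zero_le_power2[of d]] by linarith
        also have "\<dots> \<le> 3 * (A * (2 * (d * sqrt d)))"
        proof -
          have "sqrt d \<le> 2" using real_sqrt_le_mono[OF d4] by simp
          then have "d * sqrt d * sqrt d \<le> d * sqrt d * 2" using d0 by (intro mult_left_mono) auto
          moreover have "d\<^sup>2 = d * sqrt d * sqrt d"
            using d0 by (simp add: power2_eq_square mult.assoc)
          ultimately have "d\<^sup>2 \<le> 2 * (d * sqrt d)" by linarith
          then show ?thesis using A0 by (intro mult_left_mono) auto
        qed
        finally show ?thesis by simp
      qed
    qed
    then show ?thesis by (simp add: d_def mult.commute[of "2 * \<nu> / t"])
  qed
  then show ?thesis by blast
qed

text \<open>Every direction with positive \<open>e2\<close> component enters \<open>U\<close>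
  through the parabolic region, and along it the error is of higher order than the distance. Hence
  \<open>x = v - v'\<close> is orthogonal to the open upper half-space; testing with
  \<open>e2\<close> and then with \<open>e2 + x\<close> gives \<open>x = 0\<close>.\<close>

lemma linear_approximation_unique:
  fixes U :: "'a::euclidean_space set"
  assumes int: "\<And>p. norm p < r0 \<Longrightarrow> M0 * (norm p)\<^sup>2 < p \<bullet> e2 \<Longrightarrow> p \<in> U"
    and pos: "0 < M0" "0 < r0" and e2: "e2 \<bullet> e2 = 1"
    and v: "\<And>p. p \<in> U \<Longrightarrow> norm p < r0 \<Longrightarrow> \<bar>u p - p \<bullet> v\<bar> \<le> C * (norm p * sqrt (norm p))"
    and v': "\<And>p. p \<in> U \<Longrightarrow> norm p < r0 \<Longrightarrow> \<bar>u p - p \<bullet> v'\<bar> \<le> C * (norm p * sqrt (norm p))"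
  shows "v = v'"
proof -
  define x where "x = v - v'"
  have bound: "\<bar>p \<bullet> x\<bar> \<le> 2 * C * (norm p * sqrt (norm p))" if "p \<in> U" "norm p < r0" for p
    using v[OF that] v'[OF that] by (simp add: x_def inner_diff_right)
  have zero: "d \<bullet> x = 0" if d: "d \<bullet> e2 > 0" for d
  proof -
    have "((\<lambda>\<tau>. 2 * C * (norm d * sqrt (\<tau> * norm d))) \<longlongrightarrow> 2 * C * (norm d * sqrt (0 * norm d))) (at_right 0)"
      by (intro tendsto_intros)
    moreover have "eventually (\<lambda>\<tau>. \<bar>d \<bullet> x\<bar> \<le> 2 * C * (norm d * sqrt (\<tau> * norm d))) (at_right 0)"
    proof -
      have d0: "norm d > 0" using d by auto
      define b where "b = min (r0 / norm d) (d \<bullet> e2 / (M0 * (norm d)\<^sup>2))"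
      have "b > 0" using d d0 pos by (simp add: b_def)
      moreover have "\<bar>d \<bullet> x\<bar> \<le> 2 * C * (norm d * sqrt (\<tau> * norm d))" if \<tau>: "0 < \<tau>" "\<tau> < b" for \<tau>
      proof -
        have 1: "norm (\<tau> *\<^sub>R d) < r0" using \<tau> d0 by (simp add: b_def pos_less_divide_eq)
        have "\<tau> < d \<bullet> e2 / (M0 * (norm d)\<^sup>2)" using \<tau> by (simp add: b_def)
        then have "\<tau> * (M0 * (norm d)\<^sup>2) < d \<bullet> e2" using d0 pos by (simp add: pos_less_divide_eq)
        then have "\<tau> * (\<tau> * (M0 * (norm d)\<^sup>2)) < \<tau> * (d \<bullet> e2)" using \<tau>(1) by simp
        then have 2: "M0 * (norm (\<tau> *\<^sub>R d))\<^sup>2 < (\<tau> *\<^sub>R d) \<bullet> e2"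
          by (simp add: power_mult_distrib power2_eq_square mult_ac)
        have "\<bar>(\<tau> *\<^sub>R d) \<bullet> x\<bar> \<le> 2 * C * (norm (\<tau> *\<^sub>R d) * sqrt (norm (\<tau> *\<^sub>R d)))"
          by (rule bound[OF int[OF 1 2] 1])
        then have "\<tau> * \<bar>d \<bullet> x\<bar> \<le> \<tau> * (2 * C * (norm d * sqrt (\<tau> * norm d)))"
          using \<tau>(1) by (simp add: abs_mult mult_ac)
        then show ?thesis using \<tau>(1) by (simp only: mult_le_cancel_left_pos)
      qed
      ultimately show ?thesis unfolding eventually_at_right_field by blast
    qed
    ultimately have "\<bar>d \<bullet> x\<bar> \<le> 2 * C * (norm d * sqrt (0 * norm d))"
      by (intro tendsto_lowerbound) auto
    then show ?thesis by simp
  qed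
  have "e2 \<bullet> x = 0" using e2 by (intro zero) simp
  moreover have "(e2 + x) \<bullet> x = 0"
  proof (rule zero)
    show "0 < (e2 + x) \<bullet> e2"
      using \<open>e2 \<bullet> x = 0\<close> e2 by (simp add: inner_add_left inner_commute[of x e2])
  qed
  ultimately have "x \<bullet> x = 0" by (simp add: inner_add_left)
  then show ?thesis by (simp add: x_def)
qed

section \<open>The planar statement with explicit exponent and constant\<close>

theorem theorem2p12:
  shows "\<exists>(\<alpha> :: real \<Rightarrow> real) (M :: real \<Rightarrow> real \<Rightarrow> real).
    (\<forall>L>0. 0 < \<alpha> L \<and> \<alpha> L < 1) \<and> (\<forall>K>0. \<forall>L>0. M K L > 0) \<and>
    (\<forall>(U :: (real^2) set) (L :: real) (r\<^sub>0 :: real) (M\<^sub>0 :: real) (u :: real^2 \<Rightarrow> real).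
       lipschitz_domain U \<longrightarrow> 0 \<in> frontier U \<longrightarrow> L > 0 \<longrightarrow> r\<^sub>0 > 0 \<longrightarrow> M\<^sub>0 > 0 \<longrightarrow>
       lipschitz_graph_boundary_in L (ball 0 (2 * r\<^sub>0)) U \<longrightarrow>
       quadratic_epigraph_at_0 M\<^sub>0 r\<^sub>0 U \<longrightarrow>
       exterior_ball_at 0 (1 / M\<^sub>0) U \<longrightarrow>
       harmonic_on u U \<longrightarrow> vanishes_on_boundary U u \<longrightarrow>
       (\<exists>!v :: real^2. \<forall>p\<in>U. norm p < r\<^sub>0 \<longrightarrow>
          \<bar>u p - p \<bullet> v\<bar> \<le> M (M\<^sub>0 * r\<^sub>0) L * ((norm p)\<^sup>2) powr ((1 + \<alpha> L) / 2)
             * r\<^sub>0 powr (- 2 - \<alpha> L) * L2_norm (U \<inter> ball 0 (2 * r\<^sub>0)) u))"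
proof -
  define S where "S = sup_const TYPE(real^2)"
  have S: "S \<ge> 0"
    unfolding S_def sup_const_def using bump_mass_pos[where 'a="real^2"] by (intro divide_nonneg_pos) auto
  define \<alpha> :: "real \<Rightarrow> real" where "\<alpha> L = 1 / 2" for L
  \<comment> \<open>\<open>16 * K + 32\<close> bounds r0 / t, as t is the smaller of 1 / (16 M0) and
    r0 / 32, and it enters to the power 3/2. The factor 12 is 6 times the 2 in \<open>A\<close>;
    \<open>S + 1\<close> keeps the constant positive when only \<open>S \<ge> 0\<close> is at
    hand.\<close>
  define M :: "real \<Rightarrow> real \<Rightarrow> real" where
    "M K L = 12 * (S + 1) * ((16 * K + 32) * sqrt (16 * K + 32))" for K L
  have M_pos: "M K L > 0" if "K > 0" for K L
    unfolding M_def using S that by (intro mult_pos_pos) auto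
  have main: "\<exists>!v. \<forall>p\<in>U. norm p < r0 \<longrightarrow>
          \<bar>u p - p \<bullet> v\<bar> \<le> M (M0 * r0) L * ((norm p)\<^sup>2) powr ((1 + \<alpha> L) / 2)
             * r0 powr (- 2 - \<alpha> L) * L2_norm (U \<inter> ball 0 (2 * r0)) u"
    if hU: "lipschitz_domain U" and pos: "r0 > 0" "M0 > 0"
      and q: "quadratic_epigraph_at_0 M0 r0 U" and ext: "exterior_ball_at 0 (1 / M0) U"
      and u: "harmonic_on u U" "vanishes_on_boundary U u"
    for U :: "(real^2) set" and L r0 M0 :: real and u :: "real^2 \<Rightarrow> real"
  proof -
    define N where "N = L2_norm (U \<inter> ball 0 (2 * r0)) u"
    have N: "N \<ge> 0" by (simp add: N_def L2_norm_nonneg)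
    have U: "open U" using hU by (simp add: lipschitz_domain_def)
    obtain e1 e2 where fr: "orthonormal_frame e1 e2"
      and q2: "\<And>r. 0 < r \<Longrightarrow> r < r0 \<Longrightarrow> {p \<in> ball 0 r. p \<bullet> e2 > M0 * r\<^sup>2} \<subseteq> U"
      using q unfolding quadratic_epigraph_at_0_def by fastforce
    have e: "e1 \<bullet> e1 = 1" "e2 \<bullet> e2 = 1" "e1 \<bullet> e2 = 0" and ne2: "norm e2 = 1"
      using fr unfolding orthonormal_frame_def orthogonal_def by (simp_all add: norm_eq_1)
    have int: "p \<in> U" if "norm p < r0" "M0 * (norm p)\<^sup>2 < p \<bullet> e2" for p
      by (rule quadratic_epigraph_interior[OF q2 pos(2) that])
    obtain c where c: "ball c (1 / M0) \<subseteq> - closure U" "0 \<in> frontier (ball c (1 / M0))"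
      using ext unfolding exterior_ball_at_def by blast
    have nc: "norm c = 1 / M0" using c(2) pos by (simp add: frontier_ball)
    have cU: "ball c (1 / M0) \<subseteq> - U" using c(1) closure_subset[of U] by blast
    have "c = - (1 / M0) *\<^sub>R e2"
      by (rule exterior_ball_center[OF int pos(2,1) ne2 nc cU])
    with cU have extb: "ball (- (1 / M0) *\<^sub>R e2) (1 / M0) \<subseteq> - U" by simp
    define t where "t = min (1 / (4 * M0)) (r0 / 8) / 4"
    define A where "A = 2 * S / r0 * N"
    have dim: "DIM(real^2) = 2" by simp
    obtain v where v: "\<And>p. p \<in> U \<Longrightarrow> norm p < r0 \<Longrightarrow> \<bar>u p - p \<bullet> v\<bar> \<le> 6 * A * ((norm p / t) * sqrt (norm p / t))"
      using linear_approximation_at_boundary[OF dim U u e orthonormal_frame_expand[OF fr] pos(2,1) int extb]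
      unfolding t_def[symmetric] S_def[symmetric] N_def[symmetric] A_def[symmetric] by blast
    define Q where "Q = 16 * (M0 * r0) + 32"
    have Q: "Q > 0" using pos by (simp add: Q_def add_pos_pos)
    have t: "t > 0" using pos by (simp add: t_def)
    have rt: "r0 / t \<le> Q"
    proof (cases "1 / (4 * M0) \<le> r0 / 8")
      case True
      then show ?thesis using pos by (simp add: t_def Q_def min_def)
    next
      case False
      then show ?thesis using pos by (simp add: t_def Q_def min_def)
    qed
    define C where "C = M (M0 * r0) L * (1 / (r0\<^sup>2 * sqrt r0)) * N"
    \<comment> \<open>For \<alpha> = 1/2 the real powers reduce to products with square roots, the
      common form of the existence and uniqueness estimates. At \<open>p = 0\<close> both sides are
      0.\<close>
    have rhs: "M (M0 * r0) L * ((norm p)\<^sup>2) powr ((1 + \<alpha> L) / 2) * r0 powr (- 2 - \<alpha> L) * N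
        = C * (norm p * sqrt (norm p))" for p :: "real^2"
    proof -
      have "((norm p)\<^sup>2) powr ((1 + \<alpha> L) / 2) = norm p * sqrt (norm p)"
      proof (cases "p = 0")
        case False
        then have p: "norm p > 0" by simp
        have "((norm p)\<^sup>2) powr ((1 + \<alpha> L) / 2) = (norm p powr 2) powr (3 / 4)"
          using p by (simp add: \<alpha>_def powr_numeral)
        also have "\<dots> = norm p powr (1 + 1 / 2)" by (simp only: powr_powr) simp
        also have "\<dots> = norm p powr 1 * norm p powr (1 / 2)" by (rule powr_add)
        also have "\<dots> = norm p * sqrt (norm p)" using p by (simp add: powr_half_sqrt)
        finally show ?thesis .
      qed simp
      moreover have "r0 powr (- 2 - \<alpha> L) = 1 / (r0\<^sup>2 * sqrt r0)"
      proof -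
        have "r0 powr (- 2 - \<alpha> L) = r0 powr (- (2 + 1 / 2))" by (simp add: \<alpha>_def)
        also have "\<dots> = 1 / (r0 powr 2 * r0 powr (1 / 2))"
          unfolding powr_minus powr_add by (simp add: inverse_eq_divide)
        also have "\<dots> = 1 / (r0\<^sup>2 * sqrt r0)" using pos by (simp add: powr_numeral powr_half_sqrt)
        finally show ?thesis .
      qed
      ultimately show ?thesis by (simp add: C_def mult_ac)
    qed
    have vC: "\<bar>u p - p \<bullet> v\<bar> \<le> C * (norm p * sqrt (norm p))" if p: "p \<in> U" "norm p < r0" for p
    proof -
      define y where "y = norm p / r0"
      have y: "y \<ge> 0" using pos by (simp add: y_def)
      have "norm p / t = y * (r0 / t)" using pos by (simp add: y_def)
      also have "\<dots> \<le> y * Q" using rt y by (rule mult_left_mono)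
      finally have pt: "norm p / t \<le> y * Q" .
      have "(norm p / t) * sqrt (norm p / t) \<le> (y * Q) * sqrt (y * Q)"
        using pt y Q t by (intro mult_mono real_sqrt_le_mono) auto
      then have "6 * A * ((norm p / t) * sqrt (norm p / t)) \<le> 6 * A * ((y * Q) * sqrt (y * Q))"
        using S N pos by (intro mult_left_mono) (auto simp: A_def)
      also have "\<dots> = 12 * S * (Q * sqrt Q) * (y * sqrt y / r0) * N"
        by (simp add: A_def real_sqrt_mult mult_ac)
      also have "\<dots> \<le> 12 * (S + 1) * (Q * sqrt Q) * (y * sqrt y / r0) * N"
        using N Q y pos by (intro mult_right_mono) auto
      also have "y * sqrt y / r0 = 1 / (r0\<^sup>2 * sqrt r0) * (norm p * sqrt (norm p))"
        by (simp add: y_def real_sqrt_divide power2_eq_square mult_ac)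
      also have "12 * (S + 1) * (Q * sqrt Q) * (1 / (r0\<^sup>2 * sqrt r0) * (norm p * sqrt (norm p))) * N = C * (norm p * sqrt (norm p))"
        by (simp add: C_def M_def Q_def mult_ac)
      finally show ?thesis using v[OF p] by linarith
    qed
    show ?thesis
      unfolding N_def[symmetric] rhs
    proof (rule ex1I[of _ v])
      show "\<forall>p\<in>U. norm p < r0 \<longrightarrow> \<bar>u p - p \<bullet> v\<bar> \<le> C * (norm p * sqrt (norm p))" using vC by blast
      show "v' = v" if "\<forall>p\<in>U. norm p < r0 \<longrightarrow> \<bar>u p - p \<bullet> v'\<bar> \<le> C * (norm p * sqrt (norm p))" for v'
      proof (rule linear_approximation_unique[OF int pos(2,1) e(2)])
        show "\<bar>u p - p \<bullet> v'\<bar> \<le> C * (norm p * sqrt (norm p))" if p: "p \<in> U" "norm p < r0" for p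
          using \<open>\<forall>p\<in>U. norm p < r0 \<longrightarrow> \<bar>u p - p \<bullet> v'\<bar> \<le> C * (norm p * sqrt (norm p))\<close> p by blast
      qed (auto intro: vC)
    qed
  qed
  show ?thesis
  proof (intro exI[of _ \<alpha>] exI[of _ M] conjI allI impI)
    show "0 < \<alpha> L" "\<alpha> L < 1" for L by (simp_all add: \<alpha>_def)
    show "M K L > 0" if "K > 0" for K L by (rule M_pos[OF that])
  qed (rule main)
qed

end
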